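(* Let $x\in\mathcal E_{\varepsilon_1,\varepsilon_3}$ for some small $\varepsilon_1,\varepsilon_3>0$. Fix $b\in\mathbb R$, let the scale $a$ range over $[a_1(b),a_2(b)]$, and let $\tilde\varepsilon_1,\tilde\varepsilon_2>0$. With the notation of the context, the following hold. (a) Suppose $\tilde\varepsilon_1\ge a_2(b)\sigma(b)\Pi_0(a_2(b),b)+\tau_0\sum_{k=1}^KA_k(b)$. Then for $(a,b)$ with $|\widetilde W_x(a,b)|>\tilde\varepsilon_1$ there exists $k\in\{1,\dots,K\}$ such that $(a,b)\in O_k$. (b) Suppose $(a,b)$ satisfies $|\widetilde W_x(a,b)|>\tilde\varepsilon_1$, $\big|\partial_a\big(a\widetilde W_x^{g_1}(a,b)/\widetilde W_x(a,b)\big)\big|>\tilde\varepsilon_2$, and $(a,b)\in O_k$. Then $$\omega_x^{\rm 2adp,c}(a,b)-\phi_k'(b)={\rm Res}_4,\qquad{\rm Res}_4:=\frac1{i2\pi\widetilde W_x(a,b)}\big({\rm Res}_1-a\widetilde W_x^{g_1}(a,b)\,{\rm Res}_3\big).$$ Furthermore, $$|\omega_x^{\rm 2adp}(a,b)-\phi_k'(b)|<{\rm Bd}_k,$$ where $${\rm Bd}_k:=\sup_{l_k(b)<a<u_k(b)}\Big\{\frac{|{\rm Res}_1|}{2\pi\tilde\varepsilon_1}+\frac1{2\pi\tilde\varepsilon_1^3\tilde\varepsilon_2}\,a\,|\widetilde W_x^{g_1}(a,b)|\big(\tilde\varepsilon_1|{\rm Res}_2|+|\partial_a\widetilde W_x(a,b)|\,|{\rm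 Res}_1|\big)\Big\}.$$ (c) Let $k\in\{1,\dots,K\}$. Suppose $\tilde\varepsilon_1$ satisfies the condition in (a) and $\max_{1\le\ell\le K}{\rm Bd}_\ell\le\frac12L_k(b)$. Then for any $\tilde\varepsilon_3=\tilde\varepsilon_3(b)>0$ with $\max_{1\le\ell\le K}{\rm Bd}_\ell\le\tilde\varepsilon_3\le\frac12L_k(b)$, $$\Big|\lim_{\lambda\to0}\frac1{c_\psi^k(b)}\int_{|\xi-\phi_k'(b)|<\tilde\varepsilon_3}T^{\rm 2adp,\lambda}_{x,\tilde\varepsilon_1,\tilde\varepsilon_2}(\xi,b)\,d\xi-x_k(b)\Big|\le\frac1{|c_\psi^k(b)|}\widetilde{\rm Bd}_k,$$ where $\widetilde{\rm Bd}_k:=\widetilde{\rm Bd}_k'+\widetilde{\rm Bd}_k''$ with (writing $u_k=u_k(b)$, $l_k=l_k(b)$) $$\widetilde{\rm Bd}_k':=\tilde\varepsilon_1\ln\frac{u_k}{l_k}+\sigma(b)K\varepsilon_1I_1(u_k-l_k)+\frac\pi9\varepsilon_3I_3(u_k-l_k)^3\sigma^3(b)\sum_{j=1}^KA_j(b)+\sum_{\ell\ne k}A_\ell(b)M_{\ell,k}(b),$$ $$\widetilde{\rm Bd}_k'':=\frac{A_k(b)}{l_k}\|g\|_1|U_b|+\sigma(b)K\varepsilon_1I_1(u_k-l_k)+\frac\pi9\varepsilon_3I_3(u_k-l_k)^3\sigma^3(b)\sum_{j=1}^KA_j(b)+\sum_{\ell\ne k}A_\ell(b)M_{\ell,k}(b),$$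 and $|U_b|$ is the Lebesgue measure of $$U_b:=\big\{a:(a,b)\in O_k,\ |\widetilde W_x(a,b)|>\tilde\varepsilon_1,\ \big|\partial_a\big(a\widetilde W_x^{g_1}(a,b)/\widetilde W_x(a,b)\big)\big|\le\tilde\varepsilon_2\big\}.$$
   Context: Fixed data: $\mu>0$; $g$ in the Schwartz class, with either $\widehat g$ supported in $[-\alpha,\alpha]$, or $|\widehat g|$ even and decreasing on $[0,\infty)$ with $|\widehat g(\alpha)|=\tau_0$; $0<\tau_0<1$ a given small threshold; $\sigma:\mathbb R\to(0,\infty)$ differentiable with $\sigma(b)>\alpha/\mu$. Here $\widehat f(\xi)=\int f(t)e^{-i2\pi\xi t}dt$. Adaptive CWT: for a Schwartz function $w$, $a>0$: $\widetilde W^w_x(a,b):=\int_{\mathbb R}x(b+at)\frac1{\sigma(b)}w\big(\frac t{\sigma(b)}\big)e^{-i2\pi\mu t}dt$; $\widetilde W_x:=\widetilde W_x^g$; $g_1(t):=tg(t)$, $g_3(t):=tg'(t)$. Signals: $x(t)=\sum_{k=1}^Kx_k(t)$, $x_k(t)=A_k(t)e^{i2\pi\phi_k(t)}$, $A_k,\phi_k$ real-valued, $A_k>0$, $\phi_k'>0$, $\phi_{k-1}'<\phi_k'$, $A_k\in C^2(\mathbb R)\cap L_\infty(\mathbb R)$, $\phi_k\in C^3(\mathbb R)$, $\phi_k''\in L_\infty(\mathbb R)$, $\inf_{2\le k\le K,\,t}\frac{\phi_k'(t)-\phi_{k-1}'(t)}{\phi_k'(t)+\phi_{k-1}'(t)}>0$.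 For $j\ge0$, $$G_{j,k}(a,b):=\int_{\mathbb R}e^{i2\pi(\phi_k'(b)at+\frac12\phi_k''(b)a^2t^2)}\frac{t^j}{\sigma(b)^{j+1}}g\Big(\frac t{\sigma(b)}\Big)e^{-i2\pi\mu t}dt .$$ Zones: it is assumed that there are functions $0<l_k(b)<u_k(b)$ such that, with $O_k:=\{(a,b):l_k(b)<a<u_k(b),\,b\in\mathbb R\}$, one has $|G_{0,k}(a,b)|\le\tau_0$ for $(a,b)\notin O_k$, and that $x$ is well-separated: $u_k(b)\le l_{k-1}(b)$ for $b\in\mathbb R$, $2\le k\le K$ (so the $O_k$ are pairwise disjoint). $\mathcal E_{\varepsilon_1,\varepsilon_3}$ is the set of all such $x$ satisfying in addition $|A_k'(t)|\le\varepsilon_1$, $|\phi_k^{(3)}(t)|\le\varepsilon_3$ for all $t\in\mathbb R$, $1\le k\le K$. Scales are restricted to $a\in[a_1(b),a_2(b)]$, where $0<a_1(b)\le l_K(b)$ and $u_1(b)\le a_2(b)<\infty$. Phase transformation: where $\widetilde W_x\ne0$ and $\partial_a\big(a\widetilde W_x^{g_1}/\widetilde W_x\big)\ne0$, $$\omega_x^{\rm 2adp,c}(a,b):=\frac{\partial_b\widetilde W_x}{i2\pi\widetilde W_x}+\frac{\sigma'(b)}{i2\pi\sigma(b)}\Big(1+\frac{\widetilde W_x^{g_3}}{\widetilde W_x}\Big)-a\frac{\widetilde W_x^{g_1}}{i2\pi\widetilde W_x}R_0(a,b),$$ $$R_0(a,b):=\frac1{\partial_a\big(a\widetilde W_x^{g_1}/\widetilde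 W_x\big)}\Big\{\partial_a\Big(\frac{\partial_b\widetilde W_x}{\widetilde W_x}\Big)+\frac{\sigma'(b)}{\sigma(b)}\partial_a\Big(\frac{\widetilde W_x^{g_3}}{\widetilde W_x}\Big)\Big\},$$ all evaluated at $(a,b)$; $\omega_x^{\rm 2adp}:={\rm Re}\,\omega_x^{\rm 2adp,c}$. Second-order adaptive WSST, for $\gamma_1,\gamma_2,\lambda>0$ and a fixed compactly supported function $h$ with certain smoothness (say continuous) and $\int_{\mathbb R}h=1$: $$T^{\rm 2adp,\lambda}_{x,\gamma_1,\gamma_2}(\xi,b):=\int_{\{a\in[a_1(b),a_2(b)]:\,|\widetilde W_x|>\gamma_1,\ |\partial_a(a\widetilde W_x^{g_1}/\widetilde W_x)|>\gamma_2\}}\widetilde W_x(a,b)\frac1\lambda h\Big(\frac{\xi-\omega_x^{\rm 2adp}(a,b)}\lambda\Big)\frac{da}a.$$ Residuals: $x_{\rm r}(a,b,t):=x(b+at)-\sum_{k=1}^Kx_k(b)e^{i2\pi(\phi_k'(b)at+\frac12\phi_k''(b)(at)^2)}$; for a Schwartz function $w$ put ${\rm res}[w]:=\int_{\mathbb R}x_{\rm r}(a,b,t)\frac1{\sigma(b)}w\big(\frac t{\sigma(b)}\big)e^{-i2\pi\mu t}dt$, and ${\rm res}_0={\rm res}[g]$, ${\rm res}_1={\rm res}[tg]$, ${\rm res}_2={\rm res}[t^2g]$, ${\rm res}_0'={\rm res}[g']$, ${\rm res}_1'={\rm res}[tg']$, ${\rm res}_2'={\rm res}[t^2g']$, ${\rm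 res}_1''={\rm res}[tg'']$ (here e.g. $tg$ denotes $t\mapsto tg(t)$). For each $k$ (all sums over $\ell\in\{1,\dots,K\}\setminus\{k\}$): $B_k:=\sum_{\ell\ne k}x_\ell(b)(\phi_\ell'(b)-\phi_k'(b))G_{0,\ell}(a,b)$, $D_k:=\sum_{\ell\ne k}x_\ell(b)(\phi_\ell''(b)-\phi_k''(b))G_{1,\ell}(a,b)$, $E_k:=\sum_{\ell\ne k}x_\ell(b)(\phi_\ell'(b)-\phi_k'(b))\big(\phi_\ell'(b)G_{1,\ell}(a,b)+\phi_\ell''(b)a\sigma(b)G_{2,\ell}(a,b)\big)$, $F_k:=\sum_{\ell\ne k}x_\ell(b)(\phi_\ell''(b)-\phi_k''(b))\big(\phi_\ell'(b)G_{2,\ell}(a,b)+\phi_\ell''(b)a\sigma(b)G_{3,\ell}(a,b)\big)$. Then (depending on $k,a,b$) $${\rm Res}_1:=i2\pi B_k+i2\pi a\sigma(b)D_k+i2\pi\Big(\frac\mu a-\phi_k'(b)\Big){\rm res}_0-\frac{{\rm res}_0'}{a\sigma(b)}-i2\pi\phi_k''(b)a\sigma(b)\,{\rm res}_1,$$ $${\rm Res}_2:=-4\pi^2\sigma(b)E_k+i2\pi\sigma(b)D_k-4\pi^2a\sigma^2(b)F_k+\frac{i2\pi}{a^2}(a\phi_k'(b)-2\mu)({\rm res}_0+{\rm res}_1')$$ $$\quad+i2\pi\sigma(b)\Big(\phi_k''(b)-\frac{i2\pi\mu}{a^2}(a\phi_k'(b)-\mu)\Big){\rm res}_1-i2\pi\sigma(b)\phi_k''(b)\big(i2\pi\mu\sigma(b)\,{\rm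 res}_2-{\rm res}_2'\big)+\frac1{a^2\sigma(b)}(2\,{\rm res}_0'+{\rm res}_1''),$$ $${\rm Res}_3:=\frac{\widetilde W_x\,{\rm Res}_2-\partial_a\widetilde W_x\,{\rm Res}_1}{\widetilde W_x\widetilde W_x^{g_1}+a\widetilde W_x\partial_a\widetilde W_x^{g_1}-a\widetilde W_x^{g_1}\partial_a\widetilde W_x}.$$ Constants: $I_n:=\int_{\mathbb R}|t^ng(t)|dt$; $\Pi_0(a,b):=K\varepsilon_1I_1+\frac\pi3\varepsilon_3I_3a^2\sigma^2(b)\sum_{k=1}^KA_k(b)$; $M_{\ell,k}(b):=\int_{l_k(b)}^{u_k(b)}|G_{0,\ell}(a,b)|\frac{da}a$; $c_\psi^k(b):=\int_{l_k(b)}^{u_k(b)}G_{0,k}(a,b)\frac{da}a$; $\|g\|_1=\int|g|$. $L_k(b):=\min\{\phi_k'(b)-\phi_{k-1}'(b),\ \phi_{k+1}'(b)-\phi_k'(b)\}$, terms with the undefined $\phi_0'$ or $\phi_{K+1}'$ being omitted.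
   Formalization: In (b) the strict bound is replaced by "< Bd_k, or both sides are 0" (a pure tone has Bd_k = 0); in (c) the factor (u_k−l_k)^3 in both error terms is corrected to u_k^3−l_k^3, since the printed bound fails for narrow zones; c_ψ^k(b) ≠ 0 is made explicit. *)

theory Defs
  imports "HOL-Analysis.Analysis"
begin

definition vderiv :: "(real \<Rightarrow> 'a::real_normed_vector) \<Rightarrow> real \<Rightarrow> 'a" where
  "vderiv f = (\<lambda>t. vector_derivative f (at t))"

definition schwartz :: "(real \<Rightarrow> complex) \<Rightarrow> bool" where
  "schwartz f \<longleftrightarrow>
     (\<forall>n t. (vderiv ^^ n) f differentiable (at t)) \<and>
     (\<forall>m n. bounded (range (\<lambda>t. t ^ m *\<^sub>R (vderiv ^^ n) f t)))"

definition C_n :: "nat \<Rightarrow> (real \<Rightarrow> real) \<Rightarrow> bool" where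
  "C_n n f \<longleftrightarrow>
     (\<forall>j<n. \<forall>t. (deriv ^^ j) f differentiable (at t)) \<and> continuous_on UNIV ((deriv ^^ n) f)"

definition fourier :: "(real \<Rightarrow> complex) \<Rightarrow> real \<Rightarrow> complex" where
  "fourier f \<xi> = (LINT t|lborel. f t * cis (- 2 * pi * \<xi> * t))"

definition tmul :: "nat \<Rightarrow> (real \<Rightarrow> complex) \<Rightarrow> real \<Rightarrow> complex" where
  "tmul n w = (\<lambda>t. of_real t ^ n * w t)"

definition Da :: "(real \<Rightarrow> real \<Rightarrow> complex) \<Rightarrow> real \<Rightarrow> real \<Rightarrow> complex" where
  "Da F a b = vector_derivative (\<lambda>s. F s b) (at a)"

definition Db :: "(real \<Rightarrow> real \<Rightarrow> complex) \<Rightarrow> real \<Rightarrow> real \<Rightarrow> complex" where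
  "Db F a b = vector_derivative (\<lambda>s. F a s) (at b)"

text \<open>
  The locale carries no assumptions: it only fixes the data from which the quantities below
  are built. The components of a signal are indexed by \<open>1, ..., K\<close>; \<open>l k\<close> and \<open>u k\<close>
  bound the zone of the \<open>k\<close>-th component, and \<open>a1\<close>, \<open>a2\<close> the range of scales.
\<close>

locale wsst =
  fixes \<mu> :: real and g :: "real \<Rightarrow> complex" and \<sigma> :: "real \<Rightarrow> real"
    and K :: nat and A \<phi> :: "nat \<Rightarrow> real \<Rightarrow> real"
    and l u :: "nat \<Rightarrow> real \<Rightarrow> real"
    and a1 a2 :: "real \<Rightarrow> real" and h :: "real \<Rightarrow> complex"
begin

abbreviation \<phi>' :: "nat \<Rightarrow> real \<Rightarrow> real" where
  "\<phi>' k \<equiv> deriv (\<phi> k)"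

abbreviation \<phi>'' :: "nat \<Rightarrow> real \<Rightarrow> real" where
  "\<phi>'' k \<equiv> deriv (deriv (\<phi> k))"

definition comp :: "nat \<Rightarrow> real \<Rightarrow> complex" where
  "comp k t = A k t * cis (2 * pi * \<phi> k t)"

definition signal :: "real \<Rightarrow> complex" where
  "signal t = (\<Sum>k=1..K. comp k t)"

definition W :: "(real \<Rightarrow> complex) \<Rightarrow> real \<Rightarrow> real \<Rightarrow> complex" where
  "W w a b = (LINT t|lborel.
     signal (b + a * t) * (1 / \<sigma> b) * w (t / \<sigma> b) * cis (- 2 * pi * \<mu> * t))"

definition G :: "nat \<Rightarrow> nat \<Rightarrow> real \<Rightarrow> real \<Rightarrow> complex" where
  "G j k a b = (LINT t|lborel.
     cis (2 * pi * (\<phi>' k b * a * t + 1 / 2 * \<phi>'' k b * a\<^sup>2 * t\<^sup>2)) *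
     (t ^ j / \<sigma> b ^ (j + 1)) * g (t / \<sigma> b) * cis (- 2 * pi * \<mu> * t))"

definition zone :: "nat \<Rightarrow> (real \<times> real) set" where
  "zone k = {(a, b). l k b < a \<and> a < u k b}"

text \<open>
  Membership of the signal in the class $\mathcal{E}_{\varepsilon_1,\varepsilon_3}$. The infimum
  is taken in \<^typ>\<open>ereal\<close>, so that the separation condition is void for \<open>K = 1\<close>.
  Boundedness is $L_\infty$ membership, as the functions concerned are continuous.
\<close>

definition signal_class :: "real \<Rightarrow> real \<Rightarrow> real \<Rightarrow> bool" where
  "signal_class \<tau>0 \<epsilon>1 \<epsilon>3 \<longleftrightarrow>
     1 \<le> K \<and>
     (\<forall>k\<in>{1..K}.
        C_n 2 (A k) \<and> bounded (range (A k)) \<and> C_n 3 (\<phi> k) \<and> bounded (range (\<phi>'' k)) \<and>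
        (\<forall>t. A k t > 0 \<and> \<phi>' k t > 0 \<and>
             \<bar>deriv (A k) t\<bar> \<le> \<epsilon>1 \<and> \<bar>(deriv ^^ 3) (\<phi> k) t\<bar> \<le> \<epsilon>3)) \<and>
     (\<forall>k\<in>{2..K}. \<forall>t. \<phi>' (k - 1) t < \<phi>' k t) \<and>
     0 < (INF k\<in>{2..K}. INF t.
            ereal ((\<phi>' k t - \<phi>' (k - 1) t) / (\<phi>' k t + \<phi>' (k - 1) t))) \<and>
     (\<forall>k\<in>{1..K}. \<forall>b. 0 < l k b \<and> l k b < u k b) \<and>
     (\<forall>k\<in>{1..K}. \<forall>a>0. \<forall>b. (a, b) \<notin> zone k \<longrightarrow> cmod (G 0 k a b) \<le> \<tau>0) \<and>
     (\<forall>k\<in>{2..K}. \<forall>b. u k b \<le> l (k - 1) b)"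

definition ratio :: "real \<Rightarrow> real \<Rightarrow> complex" where
  "ratio a b = a * W (tmul 1 g) a b / W g a b"

definition R0 :: "real \<Rightarrow> real \<Rightarrow> complex" where
  "R0 a b = 1 / Da ratio a b *
     (Da (\<lambda>a b. Db (W g) a b / W g a b) a b +
      deriv \<sigma> b / \<sigma> b * Da (\<lambda>a b. W (tmul 1 (vderiv g)) a b / W g a b) a b)"

definition omega_c :: "real \<Rightarrow> real \<Rightarrow> complex" where
  "omega_c a b =
     Db (W g) a b / (\<i> * 2 * pi * W g a b) +
     deriv \<sigma> b / (\<i> * 2 * pi * \<sigma> b) * (1 + W (tmul 1 (vderiv g)) a b / W g a b) -
     a * (W (tmul 1 g) a b / (\<i> * 2 * pi * W g a b)) * R0 a b"

definition omega :: "real \<Rightarrow> real \<Rightarrow> real" where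
  "omega a b = Re (omega_c a b)"

definition T :: "real \<Rightarrow> real \<Rightarrow> real \<Rightarrow> real \<Rightarrow> real \<Rightarrow> complex" where
  "T \<gamma>1 \<gamma>2 s \<xi> b =
     (LINT a:{a \<in> {a1 b..a2 b}. cmod (W g a b) > \<gamma>1 \<and> cmod (Da ratio a b) > \<gamma>2}|lborel.
        W g a b * (1 / s) * h ((\<xi> - omega a b) / s) / a)"

definition x_r :: "real \<Rightarrow> real \<Rightarrow> real \<Rightarrow> complex" where
  "x_r a b t = signal (b + a * t) -
     (\<Sum>k=1..K. comp k b * cis (2 * pi * (\<phi>' k b * a * t + 1 / 2 * \<phi>'' k b * (a * t)\<^sup>2)))"

definition res :: "(real \<Rightarrow> complex) \<Rightarrow> real \<Rightarrow> real \<Rightarrow> complex" where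
  "res w a b = (LINT t|lborel.
     x_r a b t * (1 / \<sigma> b) * w (t / \<sigma> b) * cis (- 2 * pi * \<mu> * t))"

definition B :: "nat \<Rightarrow> real \<Rightarrow> real \<Rightarrow> complex" where
  "B k a b = (\<Sum>j\<in>{1..K} - {k}. comp j b * (\<phi>' j b - \<phi>' k b) * G 0 j a b)"

definition D :: "nat \<Rightarrow> real \<Rightarrow> real \<Rightarrow> complex" where
  "D k a b = (\<Sum>j\<in>{1..K} - {k}. comp j b * (\<phi>'' j b - \<phi>'' k b) * G 1 j a b)"

definition E :: "nat \<Rightarrow> real \<Rightarrow> real \<Rightarrow> complex" where
  "E k a b = (\<Sum>j\<in>{1..K} - {k}. comp j b * (\<phi>' j b - \<phi>' k b) *
     (\<phi>' j b * G 1 j a b + \<phi>'' j b * a * \<sigma> b * G 2 j a b))"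

definition F :: "nat \<Rightarrow> real \<Rightarrow> real \<Rightarrow> complex" where
  "F k a b = (\<Sum>j\<in>{1..K} - {k}. comp j b * (\<phi>'' j b - \<phi>'' k b) *
     (\<phi>' j b * G 2 j a b + \<phi>'' j b * a * \<sigma> b * G 3 j a b))"

definition Res1 :: "nat \<Rightarrow> real \<Rightarrow> real \<Rightarrow> complex" where
  "Res1 k a b =
     \<i> * 2 * pi * B k a b + \<i> * 2 * pi * a * \<sigma> b * D k a b +
     \<i> * 2 * pi * (\<mu> / a - \<phi>' k b) * res g a b -
     res (vderiv g) a b / (a * \<sigma> b) -
     \<i> * 2 * pi * \<phi>'' k b * a * \<sigma> b * res (tmul 1 g) a b"

definition Res2 :: "nat \<Rightarrow> real \<Rightarrow> real \<Rightarrow> complex" where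
  "Res2 k a b =
     - 4 * pi\<^sup>2 * \<sigma> b * E k a b + \<i> * 2 * pi * \<sigma> b * D k a b - 4 * pi\<^sup>2 * a * (\<sigma> b)\<^sup>2 * F k a b +
     \<i> * 2 * pi / a\<^sup>2 * (a * \<phi>' k b - 2 * \<mu>) * (res g a b + res (tmul 1 (vderiv g)) a b) +
     \<i> * 2 * pi * \<sigma> b * (\<phi>'' k b - \<i> * 2 * pi * \<mu> / a\<^sup>2 * (a * \<phi>' k b - \<mu>)) *
       res (tmul 1 g) a b -
     \<i> * 2 * pi * \<sigma> b * \<phi>'' k b *
       (\<i> * 2 * pi * \<mu> * \<sigma> b * res (tmul 2 g) a b - res (tmul 2 (vderiv g)) a b) +
     1 / (a\<^sup>2 * \<sigma> b) * (2 * res (vderiv g) a b + res (tmul 1 (vderiv (vderiv g))) a b)"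

definition Res3 :: "nat \<Rightarrow> real \<Rightarrow> real \<Rightarrow> complex" where
  "Res3 k a b =
     (W g a b * Res2 k a b - Da (W g) a b * Res1 k a b) /
     (W g a b * W (tmul 1 g) a b + a * W g a b * Da (W (tmul 1 g)) a b -
      a * W (tmul 1 g) a b * Da (W g) a b)"

definition Res4 :: "nat \<Rightarrow> real \<Rightarrow> real \<Rightarrow> complex" where
  "Res4 k a b =
     1 / (\<i> * 2 * pi * W g a b) * (Res1 k a b - a * W (tmul 1 g) a b * Res3 k a b)"

definition I :: "nat \<Rightarrow> real" where
  "I n = (LINT t|lborel. cmod (t ^ n * g t))"

definition Pi0 :: "real \<Rightarrow> real \<Rightarrow> real \<Rightarrow> real \<Rightarrow> real" where
  "Pi0 \<epsilon>1 \<epsilon>3 a b =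
     real K * \<epsilon>1 * I 1 + pi / 3 * \<epsilon>3 * I 3 * a\<^sup>2 * (\<sigma> b)\<^sup>2 * (\<Sum>k=1..K. A k b)"

definition M :: "nat \<Rightarrow> nat \<Rightarrow> real \<Rightarrow> real" where
  "M j k b = (LINT a:{l k b..u k b}|lborel. cmod (G 0 j a b) / a)"

definition c_psi :: "nat \<Rightarrow> real \<Rightarrow> complex" where
  "c_psi k b = (LINT a:{l k b..u k b}|lborel. G 0 k a b / a)"

text \<open>
  The minimum of the gaps between \<open>\<phi>' k b\<close> and its neighbours. Index \<open>j\<close> stands for the gap
  between components \<open>j\<close> and \<open>j + 1\<close>; gaps involving an undefined neighbour are left out,
  and for \<open>K = 1\<close> the value is \<open>\<infinity>\<close>.
\<close>

definition L :: "nat \<Rightarrow> real \<Rightarrow> ereal" where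
  "L k b = (INF j\<in>{k - 1, k} \<inter> {1..<K}. ereal (\<phi>' (j + 1) b - \<phi>' j b))"

text \<open>
  The real supremum is unproblematic: the expression under it depends continuously on \<open>a > 0\<close>,
  and \<open>0 < l k b\<close>, so it is bounded on the zone.
\<close>

definition Bd :: "real \<Rightarrow> real \<Rightarrow> nat \<Rightarrow> real \<Rightarrow> real" where
  "Bd \<delta>1 \<delta>2 k b = (SUP a\<in>{l k b<..<u k b}.
     cmod (Res1 k a b) / (2 * pi * \<delta>1) +
     1 / (2 * pi * \<delta>1 ^ 3 * \<delta>2) * a * cmod (W (tmul 1 g) a b) *
       (\<delta>1 * cmod (Res2 k a b) + cmod (Da (W g) a b) * cmod (Res1 k a b)))"

definition U :: "real \<Rightarrow> real \<Rightarrow> nat \<Rightarrow> real \<Rightarrow> real set" where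
  "U \<delta>1 \<delta>2 k b =
     {a. (a, b) \<in> zone k \<and> cmod (W g a b) > \<delta>1 \<and> cmod (Da ratio a b) \<le> \<delta>2}"

text \<open>
  The terms with \<open>u ^ 3 - l ^ 3\<close> come from integrating $a^2$ over $[l, u]$, in the bound for
  the integral of $a \sigma(b) \Pi_0(a,b)$ with respect to $da/a$. A factor \<open>(u - l) ^ 3\<close>
  would be too small, as \<open>(u - l) ^ 3 < u ^ 3 - l ^ 3\<close> for \<open>0 < l < u\<close>.
\<close>

definition Bd_tilde1 :: "real \<Rightarrow> real \<Rightarrow> real \<Rightarrow> nat \<Rightarrow> real \<Rightarrow> real" where
  "Bd_tilde1 \<epsilon>1 \<epsilon>3 \<delta>1 k b =
     \<delta>1 * ln (u k b / l k b) + \<sigma> b * real K * \<epsilon>1 * I 1 * (u k b - l k b) +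
     pi / 9 * \<epsilon>3 * I 3 * (u k b ^ 3 - l k b ^ 3) * \<sigma> b ^ 3 * (\<Sum>j=1..K. A j b) +
     (\<Sum>j\<in>{1..K} - {k}. A j b * M j k b)"

definition Bd_tilde2 :: "real \<Rightarrow> real \<Rightarrow> real \<Rightarrow> real \<Rightarrow> nat \<Rightarrow> real \<Rightarrow> real" where
  "Bd_tilde2 \<epsilon>1 \<epsilon>3 \<delta>1 \<delta>2 k b =
     A k b / l k b * (LINT t|lborel. cmod (g t)) * measure lebesgue (U \<delta>1 \<delta>2 k b) +
     \<sigma> b * real K * \<epsilon>1 * I 1 * (u k b - l k b) +
     pi / 9 * \<epsilon>3 * I 3 * (u k b ^ 3 - l k b ^ 3) * \<sigma> b ^ 3 * (\<Sum>j=1..K. A j b) +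
     (\<Sum>j\<in>{1..K} - {k}. A j b * M j k b)"

definition Bd_tilde :: "real \<Rightarrow> real \<Rightarrow> real \<Rightarrow> real \<Rightarrow> nat \<Rightarrow> real \<Rightarrow> real" where
  "Bd_tilde \<epsilon>1 \<epsilon>3 \<delta>1 \<delta>2 k b = Bd_tilde1 \<epsilon>1 \<epsilon>3 \<delta>1 k b + Bd_tilde2 \<epsilon>1 \<epsilon>3 \<delta>1 \<delta>2 k b"

definition threshold :: "real \<Rightarrow> real \<Rightarrow> real \<Rightarrow> real \<Rightarrow> real" where
  "threshold \<tau>0 \<epsilon>1 \<epsilon>3 b =
     a2 b * \<sigma> b * Pi0 \<epsilon>1 \<epsilon>3 (a2 b) b + \<tau>0 * (\<Sum>k=1..K. A k b)"

end

end

(*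
  After the substitution t = sigma(b) y, every transform in the statement is an integral
  osc f w p c m = int f(p + c y) w(y) cis(m y) dy, where f is the signal, a quadratic chirp or
  the residual, and w is a Schwartz function. Differentiation in p, c, m under the integral sign
  together with integration by parts gives all derivatives in a and b. The window being smooth,
  db W + sigma'/sigma (W + W^{g_3}) equals V = (i 2 pi mu / a) W - W^{g'} / (a sigma), and
  integration by parts for the chirps gives
  V = i 2 pi phi_k' W + i 2 pi phi_k'' sigma a W^{g_1} + Res_1.
  Since Res_2 is the derivative of Res_1 in a, dividing by W and differentiating yields
  omega = phi_k' + Res_4 wherever omega is defined. For the reconstruction, Fubini turns the
  integral of T over xi into an integral over the scales against an approximate identity; as
  its width tends to 0 exactly the admissible scales of zone k survive, by (a) and (b).
*)

theory Submission
  imports Defs "HOL-Probability.Sinc_Integral" "HOL-Probability.Characteristic_Functions"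
    "HOL-Real_Asymp.Real_Asymp"
begin

subsection \<open>Schwartz functions\<close>

text \<open>The signal class bounds \<open>\<phi>'' k\<close> but not \<open>\<phi>' k\<close>, so
  the derivative of the signal may grow linearly; differentiation under the integral therefore works
  with functions of linear growth and the weight \<open>(1 + \<bar>y\<bar>)\<^sup>2\<close>.
  \<open>R0\<close> contains a mixed derivative in b and a. It costs no second derivative of the
  signal: once the signal's derivative has been moved to the window, the b-derivative of W is a
  combination of transforms with Schwartz windows, each of which is differentiated in a by one rule.
  The terms with \<open>deriv \<sigma>\<close> cancel. The error identity holds for every k at once;
  the zone only serves to bound the error by \<open>Bd\<close>. That bound keeps a factor
  \<open>\<delta>1 / cmod (W g a b)\<close>, which is less than 1 and makes it strict unless
  everything vanishes. The limit relies on strictness: for admissible scales \<open>omega\<close> is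
  closer than \<open>\<delta>3\<close> to \<open>\<phi>' k b\<close> in zone k and, as the
  frequencies of other components are at least \<open>2 * \<delta>3\<close> away, farther than
  \<open>\<delta>3\<close> in any other zone. So no frequency falls on an endpoint of the interval
  of integration, where the limiting weight would depend on h.\<close>

lemma schwartz_vderiv: "schwartz f \<Longrightarrow> schwartz (vderiv f)"
proof -
  assume f: "schwartz f"
  have e: "(vderiv ^^ n) (vderiv f) = (vderiv ^^ Suc n) f" for n
    by (simp add: funpow_swap1)
  show ?thesis using f unfolding schwartz_def e by blast
qed

lemma schwartz_has_vector_derivative:
  "schwartz f \<Longrightarrow> (f has_vector_derivative vderiv f t) (at t)"
  unfolding schwartz_def vderiv_def
  by (metis funpow_0 vector_derivative_works)

lemma has_vector_derivative_tmul:
  assumes "(f has_vector_derivative f') (at t)"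
  shows "(tmul 1 f has_vector_derivative f t + t * f') (at t)"
proof -
  have "((\<lambda>t. of_real t * f t) has_vector_derivative of_real t * f' + of_real 1 * f t) (at t)"
    by (intro has_vector_derivative_mult has_vector_derivative_of_real assms DERIV_ident)
  then show ?thesis by (simp add: tmul_def add.commute)
qed

lemma vderiv_eqI: "(\<And>t. (f has_vector_derivative f' t) (at t)) \<Longrightarrow> vderiv f = f'"
  by (auto simp: vderiv_def fun_eq_iff intro: vector_derivative_at)

lemma vderiv_tmul: "schwartz f \<Longrightarrow> vderiv (tmul 1 f) = (\<lambda>t. f t + tmul 1 (vderiv f) t)"
  by (rule vderiv_eqI) (use has_vector_derivative_tmul schwartz_has_vector_derivative in \<open>simp add: tmul_def\<close>)

lemma schwartz_funpow_vderiv: "schwartz f \<Longrightarrow> schwartz ((vderiv ^^ n) f)"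
  by (induction n) (auto simp: schwartz_vderiv)

text \<open>The Leibniz rule has only two terms here because the second derivative of t vanishes.
  For \<open>n = 0\<close> the truncated index \<open>n - 1\<close> is harmless, as its coefficient
  is 0.\<close>

lemma funpow_vderiv_tmul:
  assumes f: "schwartz f"
  shows "(vderiv ^^ n) (tmul 1 f) =
    (\<lambda>t. t * (vderiv ^^ n) f t + of_nat n * (vderiv ^^ (n - 1)) f t)"
proof (induction n)
  case 0
  then show ?case by (simp add: tmul_def)
next
  case (Suc n)
  have d: "((vderiv ^^ m) f has_vector_derivative (vderiv ^^ Suc m) f t) (at t)" for m t
    using schwartz_has_vector_derivative[OF schwartz_funpow_vderiv[OF f]] by simp
  have "vderiv (\<lambda>t. t * (vderiv ^^ n) f t + of_nat n * (vderiv ^^ (n - 1)) f t) =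
     (\<lambda>t. t * (vderiv ^^ Suc n) f t + of_nat (Suc n) * (vderiv ^^ n) f t)"
  proof (rule vderiv_eqI)
    fix t
    have 1: "((\<lambda>t. t * (vderiv ^^ n) f t) has_vector_derivative
        (vderiv ^^ n) f t + t * (vderiv ^^ Suc n) f t) (at t)"
      using has_vector_derivative_tmul[OF d, of n t] by (simp add: tmul_def)
    have 2: "((\<lambda>t. of_nat n * (vderiv ^^ (n - 1)) f t) has_vector_derivative
        of_nat n * (vderiv ^^ n) f t) (at t)"
      using has_vector_derivative_mult_right[OF d[of "n - 1" t], of "of_nat n"]
      by (cases n) auto
    show "((\<lambda>t. t * (vderiv ^^ n) f t + of_nat n * (vderiv ^^ (n - 1)) f t) has_vector_derivative
        t * (vderiv ^^ Suc n) f t + of_nat (Suc n) * (vderiv ^^ n) f t) (at t)"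
      using has_vector_derivative_add[OF 1 2] by (simp add: algebra_simps)
  qed
  then show ?case by (simp only: funpow.simps o_apply Suc diff_Suc_1)
qed

lemma bounded_range_add:
  fixes p q :: "real \<Rightarrow> complex"
  assumes "bounded (range p)" "bounded (range q)"
  shows "bounded (range (\<lambda>t. p t + q t))"
proof -
  obtain P Q where "\<And>t. norm (p t) \<le> P" "\<And>t. norm (q t) \<le> Q"
    using assms by (auto simp: bounded_iff)
  then have "norm (p t + q t) \<le> P + Q" for t
    using norm_triangle_mono by blast
  then show ?thesis by (auto simp: bounded_iff)
qed

text \<open>By the Leibniz rule, \<open>t ^ m\<close> times the n-th derivative of the product is
  \<open>t ^ (m + 1)\<close> times the n-th derivative of f plus n times \<open>t ^ m\<close> times
  the previous one, and both are bounded.\<close>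

lemma schwartz_tmul1:
  assumes f: "schwartz f"
  shows "schwartz (tmul 1 f)"
  unfolding schwartz_def
proof (intro conjI allI)
  fix n t
  show "(vderiv ^^ n) (tmul 1 f) differentiable (at t)"
  proof -
    have d: "((vderiv ^^ m) f has_vector_derivative (vderiv ^^ Suc m) f t) (at t)" for m t
      using schwartz_has_vector_derivative[OF schwartz_funpow_vderiv[OF f]] by simp
    have "((\<lambda>t. of_real t * (vderiv ^^ n) f t + of_nat n * (vderiv ^^ (n - 1)) f t)
       has_vector_derivative
         (of_real t * (vderiv ^^ Suc n) f t + of_real 1 * (vderiv ^^ n) f t) +
         of_nat n * (vderiv ^^ Suc (n - 1)) f t) (at t)"
      by (intro has_vector_derivative_add has_vector_derivative_mult has_vector_derivative_of_real
           has_vector_derivative_mult_right d DERIV_ident)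
    then show ?thesis
      unfolding funpow_vderiv_tmul[OF f] by (rule differentiableI_vector)
  qed
next
  fix m n
  have b: "bounded (range (\<lambda>t. t ^ m *\<^sub>R (vderiv ^^ n) f t))" for m n
    using f by (auto simp: schwartz_def)
  have "bounded ((\<lambda>z. of_nat n * z) ` range (\<lambda>t. t ^ m *\<^sub>R (vderiv ^^ (n - 1)) f t))"
    by (intro bounded_linear_image[OF b] bounded_linear_mult_right)
  then have "bounded (range (\<lambda>t. of_nat n * (t ^ m *\<^sub>R (vderiv ^^ (n - 1)) f t)))"
    by (simp add: image_image)
  from bounded_range_add[OF b[of "Suc m" n] this]
  show "bounded (range (\<lambda>t. t ^ m *\<^sub>R (vderiv ^^ n) (tmul 1 f) t))"
    unfolding funpow_vderiv_tmul[OF f] by (simp add: scaleR_conv_of_real algebra_simps)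
qed

lemma tmul_0 [simp]: "tmul 0 f = f"
  by (simp add: tmul_def)

lemma tmul_tmul: "tmul m (tmul n f) = tmul (m + n) f"
  by (simp add: tmul_def power_add mult.assoc fun_eq_iff)

lemma schwartz_tmul: "schwartz f \<Longrightarrow> schwartz (tmul n f)"
proof (induction n)
  case (Suc n)
  then show ?case
    using schwartz_tmul1[of "tmul n f"] by (simp add: tmul_tmul)
qed auto

lemma schwartz_continuous: "schwartz f \<Longrightarrow> continuous_on S f"
  by (meson continuous_at_imp_continuous_on has_vector_derivative_continuous schwartz_has_vector_derivative)

lemma schwartz_measurable [measurable_dest]: "schwartz f \<Longrightarrow> f \<in> borel_measurable borel"
  by (rule borel_measurable_continuous_onI[OF schwartz_continuous])

text \<open>The seminorms with \<open>m = 0\<close> and \<open>m = 2\<close> add up to a bound for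
  \<open>(1 + t\<^sup>2) * cmod (f t)\<close>; the resulting majorant is integrable on the
  line.\<close>

lemma schwartz_decay:
  assumes "schwartz f"
  obtains C where "C \<ge> 0" "\<And>t. cmod (f t) \<le> C * inverse (1 + t\<^sup>2)"
proof -
  have "bounded (range (\<lambda>t. t ^ 0 *\<^sub>R (vderiv ^^ 0) f t))" "bounded (range (\<lambda>t. t ^ 2 *\<^sub>R (vderiv ^^ 0) f t))"
    using assms unfolding schwartz_def by blast+
  then obtain P Q where P: "\<And>t. cmod (f t) \<le> P" and Q: "\<And>t. t\<^sup>2 * cmod (f t) \<le> Q"
    by (auto simp: bounded_iff)
  have "cmod (f t) \<le> (P + Q) * inverse (1 + t\<^sup>2)" for t
  proof -
    have "(1 + t\<^sup>2) * cmod (f t) \<le> P + Q"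
      using P[of t] Q[of t] by (simp add: algebra_simps)
    moreover have "1 + t\<^sup>2 > 0" by (simp add: add_pos_nonneg)
    ultimately show ?thesis by (simp add: field_simps)
  qed
  moreover have "P + Q \<ge> 0"
    using order_trans[OF norm_ge_zero P[of 0]] Q[of 0] by simp
  ultimately show ?thesis using that by blast
qed

lemma integrable_inverse_one_plus_square: "integrable lborel (\<lambda>x::real. inverse (1 + x\<^sup>2))"
  using integrable_inverse_1_plus_square by (simp add: set_integrable_def einterval_eq)

lemma schwartz_integrable:
  assumes "schwartz f"
  shows "integrable lborel f"
proof -
  obtain C where "C \<ge> 0" "\<And>t. cmod (f t) \<le> C * inverse (1 + t\<^sup>2)"
    using schwartz_decay[OF assms] by blast
  then show ?thesis
    by (intro Bochner_Integration.integrable_bound[OF integrable_mult_right[OF integrable_inverse_one_plus_square, of C]])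
       (use schwartz_measurable[OF assms] in auto)
qed

text \<open>The square in the weight pays for two linear factors: the growth of the function at
  \<open>p + c * y\<close>, and the factor y produced by moving c or m.\<close>

lemma schwartz_quadratic_integrable:
  assumes w: "schwartz w"
  shows "integrable lborel (\<lambda>y. (1 + \<bar>y\<bar>)\<^sup>2 * cmod (w y))"
proof (rule Bochner_Integration.integrable_bound)
  show "integrable lborel (\<lambda>y. 2 * (cmod (w y) + cmod (tmul 2 w y)))"
    using w by (intro integrable_mult_right Bochner_Integration.integrable_add integrable_norm schwartz_integrable schwartz_tmul)
  show "(\<lambda>y. (1 + \<bar>y\<bar>)\<^sup>2 * cmod (w y)) \<in> borel_measurable lborel"
    using schwartz_measurable[OF w] by measurable
  have "(1 + \<bar>y\<bar>)\<^sup>2 * cmod (w y) \<le> (2 * (1 + y\<^sup>2)) * cmod (w y)" for y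
  proof (rule mult_right_mono)
    have "0 \<le> (1 - \<bar>y\<bar>)\<^sup>2" by simp
    then show "(1 + \<bar>y\<bar>)\<^sup>2 \<le> 2 * (1 + y\<^sup>2)" by (simp add: power2_eq_square algebra_simps)
  qed simp
  then show "AE y in lborel. norm ((1 + \<bar>y\<bar>)\<^sup>2 * cmod (w y)) \<le> norm (2 * (cmod (w y) + cmod (tmul 2 w y)))"
    by (intro AE_I2) (simp add: tmul_def norm_mult norm_power algebra_simps)
qed

subsection \<open>Differentiation under the integral sign\<close>

text \<open>Dominated convergence for the difference quotients at r. The majorant controls
  increments measured from the single point r, so derivatives of \<open>H\<close> at neighbouring
  parameters never enter.\<close>

lemma has_vector_derivative_integral:
  fixes H :: "real \<Rightarrow> 'a \<Rightarrow> 'b::{banach, second_countable_topology}"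
  assumes "d > 0"
    and int: "\<And>s. \<bar>s - r\<bar> < d \<Longrightarrow> integrable M (H s)"
    and der: "\<And>y. ((\<lambda>s. H s y) has_vector_derivative H' y) (at r)"
    and meas: "H' \<in> borel_measurable M"
    and lip: "\<And>s y. \<bar>s - r\<bar> < d \<Longrightarrow> norm (H s y - H r y) \<le> N y * \<bar>s - r\<bar>"
    and N: "integrable M N"
  shows "((\<lambda>s. \<integral>y. H s y \<partial>M) has_vector_derivative (\<integral>y. H' y \<partial>M)) (at r)"
proof -
  have der': "((\<lambda>s. (H s y - H r y) /\<^sub>R (s - r)) \<longlongrightarrow> H' y) (at r)" for y
  proof -
    have "((\<lambda>s. (H s y - H r y - (s - r) *\<^sub>R H' y) /\<^sub>R norm (s - r)) \<longlongrightarrow> 0) (at r)"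
      using der[of y] by (simp add: has_vector_derivative_def has_derivative_at_within)
    then have "((\<lambda>s. (H s y - H r y) /\<^sub>R (s - r) - H' y) \<longlongrightarrow> 0) (at r)"
    proof (subst (asm) tendsto_norm_zero_iff[symmetric], subst tendsto_norm_zero_iff[symmetric],
        elim Lim_transform_eventually)
      have *: "norm ((H s y - H r y - (s - r) *\<^sub>R H' y) /\<^sub>R norm (s - r)) =
         norm ((H s y - H r y) /\<^sub>R (s - r) - H' y)" if "s \<noteq> r" for s
      proof -
        have "(H s y - H r y) /\<^sub>R (s - r) - H' y = (H s y - H r y - (s - r) *\<^sub>R H' y) /\<^sub>R (s - r)"
          using that by (simp add: scaleR_right_diff_distrib)
        then show ?thesis by simp
      qed
      show "\<forall>\<^sub>F x in at r. norm ((H x y - H r y - (x - r) *\<^sub>R H' y) /\<^sub>R norm (x - r)) =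
            norm ((H x y - H r y) /\<^sub>R (x - r) - H' y)"
        unfolding eventually_at_filter by (intro always_eventually allI impI *) auto
    qed
    then show ?thesis by (rule LIM_zero_cancel)
  qed
  have "((\<lambda>s. ((\<integral>y. H s y \<partial>M) - (\<integral>y. H r y \<partial>M)) /\<^sub>R (s - r)) \<longlongrightarrow> (\<integral>y. H' y \<partial>M)) (at r)"
    unfolding tendsto_at_iff_sequentially comp_def
  proof (intro allI impI)
    fix X assume X: "\<forall>i. X i \<in> UNIV - {r}" "X \<longlonglongrightarrow> r"
    have "\<forall>\<^sub>F n in sequentially. \<bar>X n - r\<bar> < d"
      using X(2) \<open>d > 0\<close> by (auto simp: tendsto_iff dist_real_def)
    then obtain n0 where n0: "\<And>n. n \<ge> n0 \<Longrightarrow> \<bar>X n - r\<bar> < d"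
      by (auto simp: eventually_sequentially)
    \<comment> \<open>Dropping the first \<open>n0\<close> terms keeps every parameter within
      distance d of r, where integrability and the Lipschitz bound are available; a shift of the
      index does not change the limit.\<close>
    define Y where "Y n = X (n + n0)" for n
    have Y: "Y n \<noteq> r" "\<bar>Y n - r\<bar> < d" for n
      using X(1) n0 by (auto simp: Y_def)
    have Yl: "Y \<longlonglongrightarrow> r"
      unfolding Y_def using X(2) by (rule LIMSEQ_ignore_initial_segment)
    have "(\<lambda>n. \<integral>y. (H (Y n) y - H r y) /\<^sub>R (Y n - r) \<partial>M) \<longlonglongrightarrow> (\<integral>y. H' y \<partial>M)"
    proof (rule integral_dominated_convergence[where w = N])
      show "AE y in M. (\<lambda>n. (H (Y n) y - H r y) /\<^sub>R (Y n - r)) \<longlonglongrightarrow> H' y"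
        using der' Y(1) Yl unfolding tendsto_at_iff_sequentially comp_def by auto
      show "AE y in M. norm ((H (Y n) y - H r y) /\<^sub>R (Y n - r)) \<le> N y" for n
      proof (rule AE_I2)
        fix y
        have "norm (H (Y n) y - H r y) \<le> N y * \<bar>Y n - r\<bar>" using lip Y by blast
        then show "norm ((H (Y n) y - H r y) /\<^sub>R (Y n - r)) \<le> N y"
          using Y(1)[of n] by (simp add: divide_inverse[symmetric] pos_divide_le_eq del: scaleR_right_diff_distrib) (simp add: field_simps)
      qed
      have "H (Y n) \<in> borel_measurable M" "H r \<in> borel_measurable M" for n
        using int[OF Y(2)] int[of r] \<open>d > 0\<close> by auto
      then show "(\<lambda>y. (H (Y n) y - H r y) /\<^sub>R (Y n - r)) \<in> borel_measurable M" for n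
        by measurable
    qed (use N meas in auto)
    also have "(\<lambda>n. \<integral>y. (H (Y n) y - H r y) /\<^sub>R (Y n - r) \<partial>M) =
        (\<lambda>n. ((\<integral>y. H (Y n) y \<partial>M) - (\<integral>y. H r y \<partial>M)) /\<^sub>R (Y n - r))"
      using int Y \<open>d > 0\<close> by (simp add: Bochner_Integration.integral_diff)
    finally show "(\<lambda>n. ((\<integral>y. H (X n) y \<partial>M) - (\<integral>y. H r y \<partial>M)) /\<^sub>R (X n - r)) \<longlonglongrightarrow> (\<integral>y. H' y \<partial>M)"
      unfolding Y_def by (rule LIMSEQ_offset)
  qed
  then have "((\<lambda>s. ((\<integral>y. H s y \<partial>M) - (\<integral>y. H r y \<partial>M)) /\<^sub>R (s - r) - (\<integral>y. H' y \<partial>M)) \<longlongrightarrow> 0) (at r)"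
    by (rule LIM_zero)
  then have "((\<lambda>s. norm ((\<integral>y. H s y \<partial>M) - (\<integral>y. H r y \<partial>M) - (s - r) *\<^sub>R (\<integral>y. H' y \<partial>M)) / norm (s - r)) \<longlongrightarrow> 0) (at r)"
  proof (subst (asm) tendsto_norm_zero_iff[symmetric], elim Lim_transform_eventually)
    have *: "norm (((\<integral>y. H s y \<partial>M) - (\<integral>y. H r y \<partial>M)) /\<^sub>R (s - r) - (\<integral>y. H' y \<partial>M)) =
      norm ((\<integral>y. H s y \<partial>M) - (\<integral>y. H r y \<partial>M) - (s - r) *\<^sub>R (\<integral>y. H' y \<partial>M)) / norm (s - r)"
      if "s \<noteq> r" for s
    proof -
      have "((\<integral>y. H s y \<partial>M) - (\<integral>y. H r y \<partial>M)) /\<^sub>R (s - r) - (\<integral>y. H' y \<partial>M) =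
          ((\<integral>y. H s y \<partial>M) - (\<integral>y. H r y \<partial>M) - (s - r) *\<^sub>R (\<integral>y. H' y \<partial>M)) /\<^sub>R (s - r)"
        using that by (simp add: scaleR_right_diff_distrib)
      then show ?thesis by (simp add: divide_inverse mult.commute)
    qed
    show "\<forall>\<^sub>F s in at r. norm (((\<integral>y. H s y \<partial>M) - (\<integral>y. H r y \<partial>M)) /\<^sub>R (s - r) - (\<integral>y. H' y \<partial>M)) =
      norm ((\<integral>y. H s y \<partial>M) - (\<integral>y. H r y \<partial>M) - (s - r) *\<^sub>R (\<integral>y. H' y \<partial>M)) / norm (s - r)"
      unfolding eventually_at_filter by (intro always_eventually allI impI *) auto
  qed
  then show ?thesis
    unfolding has_vector_derivative_def has_derivative_iff_norm by (auto intro: bounded_linear_scaleR_left)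
qed

subsection \<open>Windowed oscillatory integrals\<close>

definition linear_growth :: "(real \<Rightarrow> complex) \<Rightarrow> bool" where
  "linear_growth f \<longleftrightarrow>
     continuous_on UNIV f \<and> (\<exists>C\<ge>0. \<forall>z. cmod (f z) \<le> C * (1 + \<bar>z\<bar>))"

definition C1_growth :: "(real \<Rightarrow> complex) \<Rightarrow> (real \<Rightarrow> complex) \<Rightarrow> bool" where
  "C1_growth f f' \<longleftrightarrow> linear_growth f \<and> linear_growth f' \<and>
     (\<forall>z. (f has_vector_derivative f' z) (at z))"

definition osc :: "(real \<Rightarrow> complex) \<Rightarrow> (real \<Rightarrow> complex) \<Rightarrow> real \<Rightarrow> real \<Rightarrow> real \<Rightarrow> complex" where
  "osc f w p c m = (LINT y|lborel. f (p + c * y) * w y * cis (m * y))"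

lemma linear_growthE:
  assumes "linear_growth f"
  obtains C where "C \<ge> 0" "\<And>z. cmod (f z) \<le> C * (1 + \<bar>z\<bar>)"
  using assms by (auto simp: linear_growth_def)

lemma linear_growth_measurable: "linear_growth f \<Longrightarrow> f \<in> borel_measurable borel"
  by (auto simp: linear_growth_def intro: borel_measurable_continuous_onI)

lemma linear_growth_bounded:
  assumes "continuous_on UNIV f" "\<And>z. cmod (f z) \<le> C"
  shows "linear_growth f"
proof -
  have C: "C \<ge> 0" using order_trans[OF norm_ge_zero assms(2)[of 0]] .
  have "cmod (f z) \<le> C * (1 + \<bar>z\<bar>)" for z
    using assms(2)[of z] mult_nonneg_nonneg[OF C abs_ge_zero[of z]] by (simp add: algebra_simps)
  with C assms(1) show ?thesis by (auto simp: linear_growth_def)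
qed

lemma linear_growth_add:
  assumes "linear_growth f" "linear_growth g"
  shows "linear_growth (\<lambda>z. f z + g z)"
proof -
  obtain C D where "C \<ge> 0" "D \<ge> 0" "\<And>z. cmod (f z) \<le> C * (1 + \<bar>z\<bar>)" "\<And>z. cmod (g z) \<le> D * (1 + \<bar>z\<bar>)"
    using assms by (auto elim!: linear_growthE)
  then have "cmod (f z + g z) \<le> (C + D) * (1 + \<bar>z\<bar>)" for z
    unfolding distrib_right[of C D] by (intro norm_triangle_mono)
  moreover have "continuous_on UNIV (\<lambda>z. f z + g z)"
    using assms by (auto simp: linear_growth_def intro!: continuous_intros)
  ultimately show ?thesis
    using \<open>C \<ge> 0\<close> \<open>D \<ge> 0\<close> unfolding linear_growth_def by (meson add_nonneg_nonneg)
qed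

lemma linear_growth_cmult:
  assumes "linear_growth f"
  shows "linear_growth (\<lambda>z. a * f z)"
proof -
  obtain C where C: "C \<ge> 0" "\<And>z. cmod (f z) \<le> C * (1 + \<bar>z\<bar>)"
    using assms by (auto elim!: linear_growthE)
  have "cmod (a * f z) \<le> (cmod a * C) * (1 + \<bar>z\<bar>)" for z
    using mult_left_mono[OF C(2), of "cmod a"] by (simp add: norm_mult mult.assoc)
  moreover have "continuous_on UNIV (\<lambda>z. a * f z)"
    using assms by (auto simp: linear_growth_def intro!: continuous_intros)
  ultimately show ?thesis
    using C(1) unfolding linear_growth_def by (meson mult_nonneg_nonneg norm_ge_zero)
qed

lemma linear_growth_sum:
  assumes "\<And>i. i \<in> S \<Longrightarrow> linear_growth (f i)"
  shows "linear_growth (\<lambda>z. \<Sum>i\<in>S. f i z)"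
  using assms
proof (induction S rule: infinite_finite_induct)
  case (insert x F)
  then show ?case using linear_growth_add[of "f x" "\<lambda>z. \<Sum>i\<in>F. f i z"] by auto
qed (use linear_growth_bounded[of "\<lambda>z. 0" 0] in auto)

lemma linear_growth_shift:
  assumes "linear_growth f"
  shows "linear_growth (\<lambda>z. f (p + z))"
proof -
  obtain C where C: "C \<ge> 0" "\<And>z. cmod (f z) \<le> C * (1 + \<bar>z\<bar>)"
    using assms by (auto elim!: linear_growthE)
  have "cmod (f (p + z)) \<le> (C * (1 + \<bar>p\<bar>)) * (1 + \<bar>z\<bar>)" for z
  proof -
    have "1 + \<bar>p + z\<bar> \<le> (1 + \<bar>p\<bar>) * (1 + \<bar>z\<bar>)"
      using abs_triangle_ineq[of p z] mult_nonneg_nonneg[OF abs_ge_zero[of p] abs_ge_zero[of z]]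
      unfolding distrib_left distrib_right by linarith
    from mult_left_mono[OF this C(1)] C(2)[of "p + z"] show ?thesis by (simp add: mult.assoc)
  qed
  moreover have "continuous_on UNIV (\<lambda>z. f (p + z))"
    using assms by (auto simp: linear_growth_def intro!: continuous_intros continuous_on_compose2[of UNIV f])
  ultimately show ?thesis
    using C(1) unfolding linear_growth_def by (meson mult_nonneg_nonneg abs_ge_zero add_nonneg_nonneg zero_le_one)
qed

lemma C1_growth_add: "C1_growth f f' \<Longrightarrow> C1_growth g g' \<Longrightarrow> C1_growth (\<lambda>z. f z + g z) (\<lambda>z. f' z + g' z)"
  by (auto simp: C1_growth_def intro: linear_growth_add has_vector_derivative_add)

lemma C1_growth_cmult: "C1_growth f f' \<Longrightarrow> C1_growth (\<lambda>z. a * f z) (\<lambda>z. a * f' z)"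
  by (auto simp: C1_growth_def intro: linear_growth_cmult has_vector_derivative_mult_right)

lemma C1_growth_sum:
  "(\<And>i. i \<in> S \<Longrightarrow> C1_growth (f i) (f' i)) \<Longrightarrow>
    C1_growth (\<lambda>z. \<Sum>i\<in>S. f i z) (\<lambda>z. \<Sum>i\<in>S. f' i z)"
  by (auto simp: C1_growth_def intro: linear_growth_sum has_vector_derivative_sum)

lemma C1_growth_shift:
  assumes "C1_growth f f'"
  shows "C1_growth (\<lambda>z. f (p + z)) (\<lambda>z. f' (p + z))"
proof -
  have "((\<lambda>z. f (p + z)) has_vector_derivative f' (p + z)) (at z)" for z
  proof -
    have "((\<lambda>z. p + z) has_vector_derivative 1) (at z)"
      by (auto intro!: derivative_eq_intros)
    moreover have "(f has_vector_derivative f' (p + z)) (at (p + z))"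
      using assms by (auto simp: C1_growth_def)
    ultimately show ?thesis
      using vector_diff_chain_at[of "\<lambda>z. p + z" 1 z f "f' (p + z)"] by (simp add: o_def)
  qed
  then show ?thesis using assms by (auto simp: C1_growth_def intro: linear_growth_shift)
qed

lemma osc_integrand_integrable:
  assumes f: "linear_growth f" and w: "schwartz w"
  shows "integrable lborel (\<lambda>y. f (p + c * y) * w y * cis (m * y))"
proof -
  obtain C where C: "C \<ge> 0" "\<And>z. cmod (f z) \<le> C * (1 + \<bar>z\<bar>)"
    using f by (auto elim!: linear_growthE)
  show ?thesis
  proof (rule Bochner_Integration.integrable_bound)
    show "integrable lborel (\<lambda>y. (C * (1 + \<bar>p\<bar> + \<bar>c\<bar>)) * ((1 + \<bar>y\<bar>)\<^sup>2 * cmod (w y)))"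
      using schwartz_quadratic_integrable[OF w] by (rule integrable_mult_right)
    show "(\<lambda>y. f (p + c * y) * w y * cis (m * y)) \<in> borel_measurable lborel"
    proof -
      have "(\<lambda>y. cis (m * y)) \<in> borel_measurable borel"
        by (intro borel_measurable_continuous_onI continuous_intros)
      then show ?thesis
        using linear_growth_measurable[OF f] schwartz_measurable[OF w] by measurable
    qed
    have "cmod (f (p + c * y)) \<le> (C * (1 + \<bar>p\<bar> + \<bar>c\<bar>)) * (1 + \<bar>y\<bar>)\<^sup>2" for y
    proof -
      have "1 + \<bar>p + c * y\<bar> \<le> 1 + \<bar>p\<bar> + \<bar>c\<bar> * \<bar>y\<bar>"
        using abs_triangle_ineq[of p "c * y"] by (simp add: abs_mult)
      also have "\<dots> \<le> (1 + \<bar>p\<bar> + \<bar>c\<bar>) * (1 + \<bar>y\<bar>)"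
        by (simp add: algebra_simps)
      also have "\<dots> \<le> (1 + \<bar>p\<bar> + \<bar>c\<bar>) * (1 + \<bar>y\<bar>)\<^sup>2"
        by (intro mult_left_mono) (simp_all add: self_le_power)
      finally show ?thesis
        using order_trans[OF C(2)[of "p + c * y"] mult_left_mono[OF _ C(1)]] by (simp only: mult.assoc)
    qed
    from mult_right_mono[OF this norm_ge_zero[of "w _"]]
    show "AE y in lborel. norm (f (p + c * y) * w y * cis (m * y))
        \<le> norm ((C * (1 + \<bar>p\<bar> + \<bar>c\<bar>)) * ((1 + \<bar>y\<bar>)\<^sup>2 * cmod (w y)))"
      using C(1) by (intro AE_I2) (simp add: norm_mult mult.assoc abs_mult)
  qed
qed

text \<open>On the segment from x to y the derivative is at most
  \<open>D * (1 + \<bar>x\<bar> + \<bar>y\<bar>)\<close>, and the mean value inequality applies. One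
  constant serves both estimates, so that later only one has to be tracked.\<close>

lemma C1_growth_lipschitz:
  assumes "C1_growth f f'"
  obtains C where "C \<ge> 0" "\<And>x. cmod (f x) \<le> C * (1 + \<bar>x\<bar>)"
    "\<And>x y. cmod (f x - f y) \<le> C * (1 + \<bar>x\<bar> + \<bar>y\<bar>) * \<bar>x - y\<bar>"
proof -
  obtain C D where C: "C \<ge> 0" "\<And>z. cmod (f z) \<le> C * (1 + \<bar>z\<bar>)"
    and D: "D \<ge> 0" "\<And>z. cmod (f' z) \<le> D * (1 + \<bar>z\<bar>)"
    using assms unfolding C1_growth_def by (auto elim!: linear_growthE)
  have der: "(f has_derivative (\<lambda>h. h *\<^sub>R f' z)) (at z within S)" for z S
    using assms unfolding C1_growth_def has_vector_derivative_def by (auto intro: has_derivative_at_withinI)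
  have 1: "cmod (f x - f y) \<le> D * (1 + \<bar>x\<bar> + \<bar>y\<bar>) * \<bar>x - y\<bar>" for x y
  proof -
    have "norm (f x - f y) \<le> (D * (1 + \<bar>x\<bar> + \<bar>y\<bar>)) * norm (x - y)"
    proof (rule differentiable_bound[OF convex_closed_segment der])
      fix z assume "z \<in> closed_segment x y"
      then have "\<bar>z\<bar> \<le> \<bar>x\<bar> + \<bar>y\<bar>"
        by (auto simp: closed_segment_eq_real_ivl split: if_splits)
      then have "cmod (f' z) \<le> D * (1 + \<bar>x\<bar> + \<bar>y\<bar>)"
        by (intro order_trans[OF D(2)] mult_left_mono D(1)) auto
      moreover have "onorm (\<lambda>h. h *\<^sub>R f' z) = cmod (f' z)"
        by (simp add: onorm_scaleR_left onorm_id)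
      ultimately show "onorm (\<lambda>h. h *\<^sub>R f' z) \<le> D * (1 + \<bar>x\<bar> + \<bar>y\<bar>)" by simp
    qed auto
    then show ?thesis by simp
  qed
  show ?thesis
  proof
    show "max C D \<ge> 0" using C by simp
    show "cmod (f x) \<le> max C D * (1 + \<bar>x\<bar>)" for x
      by (rule order_trans[OF C(2)], rule mult_right_mono) auto
    show "cmod (f x - f y) \<le> max C D * (1 + \<bar>x\<bar> + \<bar>y\<bar>) * \<bar>x - y\<bar>" for x y
      by (rule order_trans[OF 1], intro mult_right_mono) auto
  qed
qed

text \<open>After division by the unimodular \<open>cis y\<close> this is the Taylor estimate of
  order zero for the exponential on the imaginary axis.\<close>

lemma norm_cis_diff_le: "cmod (cis x - cis y) \<le> \<bar>x - y\<bar>"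
proof -
  have "cis x - cis y = cis y * (exp (\<i> * of_real (x - y)) - 1)"
    by (simp add: cis_conv_exp exp_diff right_diff_distrib field_simps)
  then have "cmod (cis x - cis y) = cmod (exp (\<i> * of_real (x - y)) - 1)"
    by (simp add: norm_mult)
  also have "\<dots> \<le> \<bar>x - y\<bar>"
    using iexp_approx1[of "x - y" 0] by simp
  finally show ?thesis .
qed

text \<open>Near r the difference quotient is within 1 of \<open>f'\<close>, whence the
  \<open>+ 1\<close>. The bound compares with r only and may fail between two other points.\<close>

lemma differentiable_imp_lipschitz_at:
  fixes f :: "real \<Rightarrow> real"
  assumes "(f has_real_derivative f') (at r)"
  obtains d where "d > 0" "\<And>s. \<bar>s - r\<bar> < d \<Longrightarrow> \<bar>f s - f r\<bar> \<le> (\<bar>f'\<bar> + 1) * \<bar>s - r\<bar>"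
proof -
  have "((\<lambda>s. (f s - f r) / (s - r)) \<longlongrightarrow> f') (at r)"
    using assms by (simp add: has_field_derivative_iff)
  then have "\<forall>\<^sub>F s in at r. dist ((f s - f r) / (s - r)) f' < 1"
    by (rule tendstoD) simp
  then obtain d where d: "d > 0" "\<And>s. s \<noteq> r \<Longrightarrow> dist s r < d \<Longrightarrow> dist ((f s - f r) / (s - r)) f' < 1"
    by (auto simp: eventually_at)
  have "\<bar>f s - f r\<bar> \<le> (\<bar>f'\<bar> + 1) * \<bar>s - r\<bar>" if "\<bar>s - r\<bar> < d" for s
  proof (cases "s = r")
    case False
    then have "\<bar>(f s - f r) / (s - r)\<bar> \<le> \<bar>f'\<bar> + 1"
      using d(2)[of s] that unfolding dist_real_def by linarith
    with False show ?thesis by (simp add: abs_divide divide_le_eq)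
  qed simp
  with d(1) that show ?thesis by blast
qed

lemma has_vector_derivative_cis:
  assumes "(m has_real_derivative m') (at r)"
  shows "((\<lambda>s. cis (m s)) has_vector_derivative \<i> * m' * cis (m r)) (at r)"
proof -
  have "((\<lambda>s. exp (\<i> * of_real (m s))) has_vector_derivative (\<i> * of_real m') * exp (\<i> * of_real (m r))) (at r)"
    using field_vector_diff_chain_at[of "\<lambda>s. \<i> * of_real (m s)" "\<i> * of_real m'" r exp "exp (\<i> * of_real (m r))"]
      has_vector_derivative_mult_right[OF has_vector_derivative_of_real[OF assms], of \<i>]
    by (simp add: o_def DERIV_exp)
  then show ?thesis by (simp add: cis_conv_exp)
qed

text \<open>In the application \<open>c\<close> and \<open>m\<close> are multiples of \<open>\<sigma>\<close>, whose derivative need not be continuous.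
  The integrand is therefore dominated through a Lipschitz bound at the single point \<open>r\<close>.\<close>

lemma osc_has_vector_derivative:
  assumes f: "C1_growth f f'" and w: "schwartz w"
    and p: "(p has_real_derivative p') (at r)"
    and c: "(c has_real_derivative c') (at r)"
    and m: "(m has_real_derivative m') (at r)"
  shows "((\<lambda>s. osc f w (p s) (c s) (m s)) has_vector_derivative
     (p' * osc f' w (p r) (c r) (m r) + c' * osc f' (tmul 1 w) (p r) (c r) (m r) +
      \<i> * m' * osc f (tmul 1 w) (p r) (c r) (m r))) (at r)"
proof -
  obtain C where C: "C \<ge> 0" "\<And>x. cmod (f x) \<le> C * (1 + \<bar>x\<bar>)"
      "\<And>x y. cmod (f x - f y) \<le> C * (1 + \<bar>x\<bar> + \<bar>y\<bar>) * \<bar>x - y\<bar>"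
    by (rule C1_growth_lipschitz[OF f]) blast
  have fl: "linear_growth f" "linear_growth f'" and fd: "\<And>z. (f has_vector_derivative f' z) (at z)"
    using f by (auto simp: C1_growth_def)
  obtain d1 where d1: "d1 > 0" "\<And>s. \<bar>s - r\<bar> < d1 \<Longrightarrow> \<bar>p s - p r\<bar> \<le> (\<bar>p'\<bar> + 1) * \<bar>s - r\<bar>"
    using differentiable_imp_lipschitz_at[OF p] by metis
  obtain d2 where d2: "d2 > 0" "\<And>s. \<bar>s - r\<bar> < d2 \<Longrightarrow> \<bar>c s - c r\<bar> \<le> (\<bar>c'\<bar> + 1) * \<bar>s - r\<bar>"
    using differentiable_imp_lipschitz_at[OF c] by metis
  obtain d3 where d3: "d3 > 0" "\<And>s. \<bar>s - r\<bar> < d3 \<Longrightarrow> \<bar>m s - m r\<bar> \<le> (\<bar>m'\<bar> + 1) * \<bar>s - r\<bar>"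
    using differentiable_imp_lipschitz_at[OF m] by metis
  \<comment> \<open>The cap 1 on the radius gives \<open>\<bar>s - r\<bar> \<le> 1\<close>, which
    keeps the moved point \<open>P\<close> within a fixed multiple of
    \<open>1 + \<bar>y\<bar>\<close>.\<close>
  define d where "d = min (min d1 d2) (min d3 1)"
  define B where "B = \<bar>p'\<bar> + \<bar>c'\<bar> + \<bar>m'\<bar> + 1"
  define Q where "Q = \<bar>p r\<bar> + \<bar>c r\<bar>"
  have B: "B \<ge> 0" and Q: "Q \<ge> 0" by (auto simp: B_def Q_def)
  have lip: "\<bar>p s - p r\<bar> \<le> B * \<bar>s - r\<bar>" "\<bar>c s - c r\<bar> \<le> B * \<bar>s - r\<bar>" "\<bar>m s - m r\<bar> \<le> B * \<bar>s - r\<bar>"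
    "\<bar>s - r\<bar> \<le> 1" if "\<bar>s - r\<bar> < d" for s
  proof -
    have *: "x \<le> B * \<bar>s - r\<bar>" if "x \<le> E * \<bar>s - r\<bar>" "E \<le> B" for x E
      using that(1) mult_right_mono[OF that(2) abs_ge_zero[of "s - r"]] by linarith
    show "\<bar>p s - p r\<bar> \<le> B * \<bar>s - r\<bar>"
      by (rule *[OF d1(2)]) (use that in \<open>auto simp: d_def B_def\<close>)
    show "\<bar>c s - c r\<bar> \<le> B * \<bar>s - r\<bar>"
      by (rule *[OF d2(2)]) (use that in \<open>auto simp: d_def B_def\<close>)
    show "\<bar>m s - m r\<bar> \<le> B * \<bar>s - r\<bar>"
      by (rule *[OF d3(2)]) (use that in \<open>auto simp: d_def B_def\<close>)
    show "\<bar>s - r\<bar> \<le> 1" using that by (simp add: d_def)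
  qed
  let ?H = "\<lambda>s y. f (p s + c s * y) * w y * cis (m s * y)"
  let ?H' = "\<lambda>y. p' * (f' (p r + c r * y) * w y * cis (m r * y)) +
     c' * (f' (p r + c r * y) * tmul 1 w y * cis (m r * y)) +
     \<i> * m' * (f (p r + c r * y) * tmul 1 w y * cis (m r * y))"
  \<comment> \<open>The two summands are the two parts of the increment of the product: the change
    of f, estimated by its Lipschitz bound, and the change of \<open>cis\<close>, multiplied by the
    linear growth bound of f.\<close>
  define R where "R = C * (1 + 2 * Q + B) * B + C * (1 + Q) * B"
  have I1: "integrable lborel (?H s)" for s
    by (rule osc_integrand_integrable[OF fl(1) w])
  have I2: "integrable lborel (\<lambda>y. f' (p r + c r * y) * w y * cis (m r * y))"
    "integrable lborel (\<lambda>y. f' (p r + c r * y) * tmul 1 w y * cis (m r * y))"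
    "integrable lborel (\<lambda>y. f (p r + c r * y) * tmul 1 w y * cis (m r * y))"
    by (intro osc_integrand_integrable fl w schwartz_tmul)+
  have I3: "integrable lborel ?H'"
    by (intro Bochner_Integration.integrable_add integrable_mult_right I2)
  have "((\<lambda>s. \<integral>y. ?H s y \<partial>lborel) has_vector_derivative (\<integral>y. ?H' y \<partial>lborel)) (at r)"
  proof (rule has_vector_derivative_integral[where d = d and N = "\<lambda>y. R * ((1 + \<bar>y\<bar>)\<^sup>2 * cmod (w y))"])
    show "d > 0" using d1(1) d2(1) d3(1) by (simp add: d_def)
    show "?H' \<in> borel_measurable lborel" using I3 by (rule borel_measurable_integrable)
    show "integrable lborel (\<lambda>y. R * ((1 + \<bar>y\<bar>)\<^sup>2 * cmod (w y)))"
      by (intro integrable_mult_right schwartz_quadratic_integrable w)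
    show "((\<lambda>s. ?H s y) has_vector_derivative ?H' y) (at r)" for y
    proof -
      have q: "((\<lambda>s. p s + c s * y) has_real_derivative p' + c' * y) (at r)"
        "((\<lambda>s. m s * y) has_real_derivative m' * y) (at r)"
        using p c m by (auto intro!: derivative_eq_intros)
      have "((\<lambda>s. f (p s + c s * y)) has_vector_derivative (p' + c' * y) *\<^sub>R f' (p r + c r * y)) (at r)"
        using vector_diff_chain_at[OF q(1)[unfolded has_real_derivative_iff_has_vector_derivative] fd]
        by (simp add: o_def)
      from has_vector_derivative_mult[OF has_vector_derivative_mult_left[OF this, of "w y"] has_vector_derivative_cis[OF q(2)]]
      show ?thesis
        by (rule has_vector_derivative_eq_rhs) (simp add: tmul_def scaleR_conv_of_real algebra_simps)
    qed
    show "norm (?H s y - ?H r y) \<le> R * ((1 + \<bar>y\<bar>)\<^sup>2 * cmod (w y)) * \<bar>s - r\<bar>"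
      if s: "\<bar>s - r\<bar> < d" for s y
    proof -
      define P where "P = p s + c s * y"
      define P0 where "P0 = p r + c r * y"
      define Y where "Y = 1 + \<bar>y\<bar>"
      define t where "t = \<bar>s - r\<bar>"
      have Y: "Y \<ge> 1" and t: "0 \<le> t" "t \<le> 1" using lip(4)[OF s] by (auto simp: Y_def t_def)
      have PP: "\<bar>P - P0\<bar> \<le> B * t * Y"
      proof -
        have "\<bar>P - P0\<bar> \<le> \<bar>p s - p r\<bar> + \<bar>c s - c r\<bar> * \<bar>y\<bar>"
          by (simp add: P_def P0_def abs_mult[symmetric] algebra_simps)
        also have "\<dots> \<le> B * t + (B * t) * \<bar>y\<bar>"
          using lip[OF s] by (intro add_mono mult_right_mono) (auto simp: t_def)
        finally show ?thesis by (simp add: Y_def algebra_simps)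
      qed
      have P0: "\<bar>P0\<bar> \<le> Q * Y"
      proof -
        have "\<bar>P0\<bar> \<le> \<bar>p r\<bar> + \<bar>c r\<bar> * \<bar>y\<bar>"
          using abs_triangle_ineq[of "p r" "c r * y"] by (simp add: P0_def abs_mult)
        also have "\<dots> \<le> Q * Y" by (simp add: Q_def Y_def algebra_simps)
        finally show ?thesis .
      qed
      have Pb: "\<bar>P\<bar> \<le> (Q + B) * Y"
      proof -
        have "B * t * Y \<le> B * 1 * Y" using B Y t by (intro mult_right_mono mult_left_mono) auto
        then show ?thesis using PP P0 by (simp add: algebra_simps)
      qed
      have "cmod (f P - f P0) \<le> C * (1 + \<bar>P\<bar> + \<bar>P0\<bar>) * \<bar>P - P0\<bar>" by (rule C(3))
      also have "\<dots> \<le> C * ((1 + 2 * Q + B) * Y) * (B * t * Y)"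
        using Pb P0 Y C(1) by (intro mult_mono mult_left_mono mult_nonneg_nonneg PP) (use B Q in \<open>auto simp: algebra_simps\<close>)
      finally have 1: "cmod (f P - f P0) \<le> C * (1 + 2 * Q + B) * B * Y\<^sup>2 * t"
        by (simp add: power2_eq_square algebra_simps)
      have "cmod (f P0) \<le> C * (1 + \<bar>P0\<bar>)" by (rule C(2))
      also have "\<dots> \<le> C * ((1 + Q) * Y)"
        using P0 Y C(1) by (intro mult_left_mono) (auto simp: algebra_simps)
      finally have 2: "cmod (f P0) \<le> C * ((1 + Q) * Y)" .
      have "cmod (cis (m s * y) - cis (m r * y)) \<le> \<bar>m s - m r\<bar> * \<bar>y\<bar>"
        using norm_cis_diff_le[of "m s * y" "m r * y"] by (simp add: abs_mult[symmetric] algebra_simps)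
      also have "\<dots> \<le> B * t * Y"
        using lip[OF s] B t by (intro mult_mono) (auto simp: t_def Y_def)
      finally have 3: "cmod (cis (m s * y) - cis (m r * y)) \<le> B * t * Y" .
      have "?H s y - ?H r y = w y * ((f P - f P0) * cis (m s * y) + f P0 * (cis (m s * y) - cis (m r * y)))"
        by (simp add: P_def P0_def algebra_simps)
      then have "cmod (?H s y - ?H r y) =
          cmod (w y) * cmod ((f P - f P0) * cis (m s * y) + f P0 * (cis (m s * y) - cis (m r * y)))"
        by (simp add: norm_mult)
      also have "\<dots> \<le> cmod (w y) * (C * (1 + 2 * Q + B) * B * Y\<^sup>2 * t + C * ((1 + Q) * Y) * (B * t * Y))"
      proof (rule mult_left_mono)
        have "cmod ((f P - f P0) * cis (m s * y)) \<le> C * (1 + 2 * Q + B) * B * Y\<^sup>2 * t"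
          using 1 by (simp add: norm_mult)
        moreover have "cmod (f P0 * (cis (m s * y) - cis (m r * y))) \<le> C * ((1 + Q) * Y) * (B * t * Y)"
          unfolding norm_mult using C(1) Q Y by (intro mult_mono 2 3) auto
        ultimately show "cmod ((f P - f P0) * cis (m s * y) + f P0 * (cis (m s * y) - cis (m r * y)))
           \<le> C * (1 + 2 * Q + B) * B * Y\<^sup>2 * t + C * ((1 + Q) * Y) * (B * t * Y)"
          by (rule norm_triangle_mono)
      qed simp
      also have "\<dots> = R * ((1 + \<bar>y\<bar>)\<^sup>2 * cmod (w y)) * \<bar>s - r\<bar>"
        by (simp add: R_def Y_def t_def power2_eq_square algebra_simps)
      finally show ?thesis .
    qed
  qed (rule I1)
  moreover have "has_bochner_integral lborel ?H' (p' * osc f' w (p r) (c r) (m r) +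
      c' * osc f' (tmul 1 w) (p r) (c r) (m r) + \<i> * m' * osc f (tmul 1 w) (p r) (c r) (m r))"
    unfolding osc_def
    by (intro has_bochner_integral_add has_bochner_integral_mult_right has_bochner_integral_integrable I2)
  ultimately show ?thesis
    by (simp only: has_bochner_integral_integral_eq osc_def)
qed

lemma lborel_integral_of_derivative_eq_0:
  fixes \<Phi> :: "real \<Rightarrow> complex"
  assumes d: "\<And>x. (\<Phi> has_vector_derivative \<phi> x) (at x)" and c: "continuous_on UNIV \<phi>"
    and i: "integrable lborel \<phi>"
    and l: "(\<Phi> \<longlongrightarrow> 0) at_top" "(\<Phi> \<longlongrightarrow> 0) at_bot"
  shows "(LINT x|lborel. \<phi> x) = 0"
proof -
  have "(LBINT x=-\<infinity>..\<infinity>. \<phi> x) = 0 - 0"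
  proof (rule interval_integral_FTC_integrable[OF _ d])
    show "((\<Phi> \<circ> real_of_ereal) \<longlongrightarrow> 0) (at_right (-\<infinity>))" "((\<Phi> \<circ> real_of_ereal) \<longlongrightarrow> 0) (at_left \<infinity>)"
      using l by (simp_all add: ereal_tendsto_simps)
    show "set_integrable lborel (einterval (- \<infinity>) \<infinity>) \<phi>" using i by (simp add: set_integrable_def einterval_eq)
    show "isCont \<phi> x" for x using c by (simp add: continuous_on_eq_continuous_at)
  qed auto
  then show ?thesis
    by (simp add: interval_lebesgue_integral_def einterval_eq set_lebesgue_integral_def)
qed

text \<open>The left-hand side integrates the derivative of
  \<open>f (p + c * y) * w y * cis (m * y)\<close>, whose limits at both ends are 0 because linear
  growth loses against the decay \<open>1 / (1 + y\<^sup>2)\<close>. The relation trades transforms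
  of \<open>f'\<close> for transforms of f with a differentiated window.\<close>

lemma osc_integration_by_parts:
  assumes f: "C1_growth f f'" and w: "schwartz w"
  shows "c * osc f' w p c m + osc f (vderiv w) p c m + \<i> * m * osc f w p c m = 0"
proof -
  have fl: "linear_growth f" "linear_growth f'" and fd: "\<And>z. (f has_vector_derivative f' z) (at z)"
    using f by (auto simp: C1_growth_def)
  note w' = schwartz_vderiv[OF w]
  have fc: "continuous_on UNIV f" "continuous_on UNIV f'" using fl by (auto simp: linear_growth_def)
  let ?\<Phi> = "\<lambda>y. f (p + c * y) * w y * cis (m * y)"
  let ?\<phi> = "\<lambda>y. c * (f' (p + c * y) * w y * cis (m * y)) + f (p + c * y) * vderiv w y * cis (m * y)
       + \<i> * m * (f (p + c * y) * w y * cis (m * y))"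
  have I: "integrable lborel (\<lambda>y. f' (p + c * y) * w y * cis (m * y))"
    "integrable lborel (\<lambda>y. f (p + c * y) * vderiv w y * cis (m * y))"
    "integrable lborel (\<lambda>y. f (p + c * y) * w y * cis (m * y))"
    by (intro osc_integrand_integrable fl w w')+
  obtain C where C: "C \<ge> 0" "\<And>z. cmod (f z) \<le> C * (1 + \<bar>z\<bar>)"
    using fl(1) by (auto elim!: linear_growthE)
  obtain D where D: "\<And>t. cmod (w t) \<le> D * inverse (1 + t\<^sup>2)" using schwartz_decay[OF w] by blast
  have bound: "norm (?\<Phi> y) \<le> C * (1 + \<bar>p\<bar> + \<bar>c\<bar> * \<bar>y\<bar>) * (D * inverse (1 + y\<^sup>2))" for y
  proof -
    have "cmod (f (p + c * y)) \<le> C * (1 + \<bar>p\<bar> + \<bar>c\<bar> * \<bar>y\<bar>)"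
      by (rule order_trans[OF C(2) mult_left_mono[OF _ C(1)]])
         (use abs_triangle_ineq[of p "c * y"] in \<open>simp add: abs_mult\<close>)
    then show ?thesis unfolding norm_mult norm_cis mult_1_right
      using C(1) by (intro mult_mono D) auto
  qed
  have "(LINT y|lborel. ?\<phi> y) = 0"
  proof (rule lborel_integral_of_derivative_eq_0)
    show "(?\<Phi> has_vector_derivative ?\<phi> y) (at y)" for y
    proof -
      have q: "((\<lambda>y. p + c * y) has_real_derivative c) (at y)"
        "((\<lambda>y. m * y) has_real_derivative m) (at y)"
        by (auto intro!: derivative_eq_intros)
      have "((\<lambda>y. f (p + c * y)) has_vector_derivative c *\<^sub>R f' (p + c * y)) (at y)"
        using vector_diff_chain_at[OF q(1)[unfolded has_real_derivative_iff_has_vector_derivative] fd]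
        by (simp add: o_def)
      from has_vector_derivative_mult[OF has_vector_derivative_mult[OF this schwartz_has_vector_derivative[OF w]] has_vector_derivative_cis[OF q(2)]]
      show ?thesis
        by (rule has_vector_derivative_eq_rhs) (simp add: scaleR_conv_of_real algebra_simps)
    qed
    have "continuous_on UNIV (\<lambda>y. f (p + c * y))" "continuous_on UNIV (\<lambda>y. f' (p + c * y))"
      by (rule continuous_on_compose2[OF fc(1)] continuous_on_compose2[OF fc(2)];
          auto intro!: continuous_intros)+
    then show "continuous_on UNIV ?\<phi>"
      by (intro continuous_intros schwartz_continuous[OF w] schwartz_continuous[OF w'])
    show "integrable lborel ?\<phi>"
      by (intro Bochner_Integration.integrable_add integrable_mult_right I)
    have *: "((\<lambda>y. C * (1 + \<bar>p\<bar> + \<bar>c\<bar> * \<bar>y\<bar>) * (D * inverse (1 + y\<^sup>2))) \<longlongrightarrow> 0) F"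
      if "((\<lambda>y. inverse (1 + y\<^sup>2)) \<longlongrightarrow> 0) F" "((\<lambda>y. \<bar>y\<bar> * inverse (1 + y\<^sup>2)) \<longlongrightarrow> 0) F" for F
    proof -
      have "((\<lambda>y. C * D * (1 + \<bar>p\<bar>) * inverse (1 + y\<^sup>2) + C * D * \<bar>c\<bar> * (\<bar>y\<bar> * inverse (1 + y\<^sup>2))) \<longlongrightarrow> 0) F"
        using tendsto_add[OF tendsto_mult_left[OF that(1), of "C * D * (1 + \<bar>p\<bar>)"]
           tendsto_mult_left[OF that(2), of "C * D * \<bar>c\<bar>"]] by simp
      then show ?thesis by (simp add: algebra_simps)
    qed
    have "((\<lambda>y::real. inverse (1 + y\<^sup>2)) \<longlongrightarrow> 0) at_top" "((\<lambda>y::real. \<bar>y\<bar> * inverse (1 + y\<^sup>2)) \<longlongrightarrow> 0) at_top"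
      "((\<lambda>y::real. inverse (1 + y\<^sup>2)) \<longlongrightarrow> 0) at_bot" "((\<lambda>y::real. \<bar>y\<bar> * inverse (1 + y\<^sup>2)) \<longlongrightarrow> 0) at_bot"
      by real_asymp+
    note lims = *[OF this(1,2)] *[OF this(3,4)]
    show "(?\<Phi> \<longlongrightarrow> 0) at_top"
      by (rule Lim_null_comparison[OF always_eventually lims(1)]) (rule allI, rule bound)
    show "(?\<Phi> \<longlongrightarrow> 0) at_bot"
      by (rule Lim_null_comparison[OF always_eventually lims(2)]) (rule allI, rule bound)
  qed
  moreover have "has_bochner_integral lborel ?\<phi>
      (c * osc f' w p c m + osc f (vderiv w) p c m + \<i> * m * osc f w p c m)"
    unfolding osc_def
    by (intro has_bochner_integral_add has_bochner_integral_mult_right has_bochner_integral_integrable I)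
  ultimately show ?thesis by (simp only: has_bochner_integral_integral_eq)
qed

lemma has_vector_derivative_divide_field:
  fixes f g :: "real \<Rightarrow> 'a::real_normed_field"
  assumes f: "(f has_vector_derivative f') (at x)" and g: "(g has_vector_derivative g') (at x)"
    and "g x \<noteq> 0"
  shows "((\<lambda>x. f x / g x) has_vector_derivative (f' * g x - f x * g') / (g x)\<^sup>2) (at x)"
proof -
  have "((inverse \<circ> g) has_vector_derivative g' * - (inverse (g x) ^ Suc (Suc 0))) (at x)"
    by (rule field_vector_diff_chain_at[OF g DERIV_inverse[OF \<open>g x \<noteq> 0\<close>]])
  from has_vector_derivative_mult[OF f this] show ?thesis
    by (rule has_vector_derivative_eq_rhs[THEN has_vector_derivative_transform_within_open[where S = UNIV]])
       (use \<open>g x \<noteq> 0\<close> in \<open>auto simp: field_simps power2_eq_square\<close>)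
qed

lemma osc_add_window:
  assumes f: "linear_growth f" and v: "schwartz v" and w: "schwartz w"
  shows "osc f (\<lambda>t. v t + w t) p c m = osc f v p c m + osc f w p c m"
  using Bochner_Integration.integral_add[OF osc_integrand_integrable[OF f v] osc_integrand_integrable[OF f w], of p c m p c m]
  by (simp add: osc_def distrib_left distrib_right)

lemma osc_add:
  assumes f: "linear_growth f" and g: "linear_growth g" and w: "schwartz w"
  shows "osc (\<lambda>z. f z + g z) w p c m = osc f w p c m + osc g w p c m"
  using Bochner_Integration.integral_add[OF osc_integrand_integrable[OF f w] osc_integrand_integrable[OF g w], of p c m p c m]
  by (simp add: osc_def distrib_right)

lemma osc_cmult: "osc (\<lambda>z. a * f z) w p c m = a * osc f w p c m"
  unfolding osc_def mult.assoc by (rule integral_mult_right_zero)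

lemma osc_sum:
  assumes f: "\<And>i. i \<in> S \<Longrightarrow> linear_growth (f i)" and w: "schwartz w"
  shows "osc (\<lambda>z. \<Sum>i\<in>S. f i z) w p c m = (\<Sum>i\<in>S. osc (f i) w p c m)"
proof -
  have "osc (\<lambda>z. \<Sum>i\<in>S. f i z) w p c m = (LINT y|lborel. (\<Sum>i\<in>S. f i (p + c * y) * w y * cis (m * y)))"
    by (simp add: osc_def sum_distrib_right)
  also have "\<dots> = (\<Sum>i\<in>S. osc (f i) w p c m)"
    unfolding osc_def using f w by (intro Bochner_Integration.integral_sum osc_integrand_integrable)
  finally show ?thesis .
qed

text \<open>Absorbs the base point into the function, so that the signal around b can be replaced by
  chirps and a residual centred at 0.\<close>

lemma osc_shift: "osc (\<lambda>z. f (p + z)) w 0 c m = osc f w p c m"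
  by (simp add: osc_def)

text \<open>Moving a produces \<open>f'\<close> with window \<open>tmul 1 w\<close>; integration by
  parts with that same window removes \<open>f'\<close>. Since only transforms of f remain, the rule
  can be iterated, which later gives the continuity of these derivatives and the mixed derivative in
  \<open>R0\<close>.\<close>

lemma osc_dilation_derivative:
  assumes f: "C1_growth f f'" and w: "schwartz w" and a: "a \<noteq> 0"
  shows "((\<lambda>a. osc f w p (a * s) m) has_vector_derivative
    - (osc f w p (a * s) m + osc f (tmul 1 (vderiv w)) p (a * s) m
        + \<i> * m * osc f (tmul 1 w) p (a * s) m) / a) (at a)"
proof -
  have "((\<lambda>a. osc f w p (a * s) m) has_vector_derivative
    (complex_of_real 0 * osc f' w p (a * s) m + complex_of_real s * osc f' (tmul 1 w) p (a * s) m
      + \<i> * complex_of_real 0 * osc f (tmul 1 w) p (a * s) m)) (at a)"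
    by (rule osc_has_vector_derivative[OF f w]) (auto intro!: derivative_eq_intros)
  moreover have "s * osc f' (tmul 1 w) p (a * s) m = - (osc f w p (a * s) m +
      osc f (tmul 1 (vderiv w)) p (a * s) m + \<i> * m * osc f (tmul 1 w) p (a * s) m) / a"
  proof -
    have "osc f (vderiv (tmul 1 w)) p (a * s) m = osc f w p (a * s) m + osc f (tmul 1 (vderiv w)) p (a * s) m"
      unfolding vderiv_tmul[OF w]
      by (intro osc_add_window w schwartz_tmul schwartz_vderiv) (use f in \<open>simp add: C1_growth_def\<close>)
    with osc_integration_by_parts[OF f schwartz_tmul[OF w, of 1], of "a * s" p m]
    have "(s * osc f' (tmul 1 w) p (a * s) m) * a = - (osc f w p (a * s) m +
      osc f (tmul 1 (vderiv w)) p (a * s) m + \<i> * m * osc f (tmul 1 w) p (a * s) m)"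
      by (simp only: eq_neg_iff_add_eq_0) (simp add: algebra_simps)
    then show ?thesis using a by (simp only: nonzero_eq_divide_eq of_real_eq_0_iff not_False_eq_True)
  qed
  ultimately show ?thesis by (simp add: algebra_simps)
qed

subsection \<open>Signals, chirps and residuals\<close>

locale wsst_setting = wsst \<mu> g \<sigma> K A \<phi> l u a1 a2 h
  for \<mu> :: real and g :: "real \<Rightarrow> complex" and \<sigma> :: "real \<Rightarrow> real"
    and K :: nat and A \<phi> l u :: "nat \<Rightarrow> real \<Rightarrow> real"
    and a1 a2 :: "real \<Rightarrow> real" and h :: "real \<Rightarrow> complex" +
  fixes \<tau>0 \<epsilon>1 \<epsilon>3 :: real
  assumes schwartz_g: "schwartz g"
    and \<sigma>_diff: "\<And>b. \<sigma> differentiable (at b)" and \<sigma>_pos: "\<And>b. \<sigma> b > 0"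
    and sig: "signal_class \<tau>0 \<epsilon>1 \<epsilon>3"
begin

text \<open>Quadratic Taylor model of the phase of component k at b, with the constant phase and the
  amplitude left to the factor \<open>comp k b\<close>. The variable z stands for
  \<open>a * t\<close>, which makes the model independent of the scale.\<close>

definition chirp :: "nat \<Rightarrow> real \<Rightarrow> real \<Rightarrow> complex" where
  "chirp k b z = cis (2 * pi * (\<phi>' k b * z + 1 / 2 * \<phi>'' k b * z\<^sup>2))"

abbreviation freq :: "real \<Rightarrow> real" where
  "freq b \<equiv> - 2 * pi * \<mu> * \<sigma> b"

section \<open>Regularity and growth of the components\<close>

lemma component:
  assumes "k \<in> {1..K}"
  shows "A k differentiable (at t)" "deriv (A k) differentiable (at t)"
    "\<phi> k differentiable (at t)" "\<phi>' k differentiable (at t)" "\<phi>'' k differentiable (at t)"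
    "bounded (range (A k))" "bounded (range (\<phi>'' k))"
    "A k t > 0" "\<bar>deriv (A k) t\<bar> \<le> \<epsilon>1" "\<bar>deriv (\<phi>'' k) t\<bar> \<le> \<epsilon>3"
proof -
  have "C_n 2 (A k)" "C_n 3 (\<phi> k)" and rest: "bounded (range (A k))" "bounded (range (\<phi>'' k))"
    "A k t > 0" "\<bar>deriv (A k) t\<bar> \<le> \<epsilon>1" "\<bar>(deriv ^^ 3) (\<phi> k) t\<bar> \<le> \<epsilon>3"
    using sig assms unfolding signal_class_def by blast+
  then have "\<forall>j<2. \<forall>t. (deriv ^^ j) (A k) differentiable (at t)"
    "\<forall>j<3. \<forall>t. (deriv ^^ j) (\<phi> k) differentiable (at t)"
    by (auto simp: C_n_def)
  from this(1)[rule_format, of 0 t] this(1)[rule_format, of 1 t]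
    this(2)[rule_format, of 0 t] this(2)[rule_format, of 1 t] this(2)[rule_format, of 2 t] rest
  show "A k differentiable (at t)" "deriv (A k) differentiable (at t)"
    "\<phi> k differentiable (at t)" "\<phi>' k differentiable (at t)" "\<phi>'' k differentiable (at t)"
    "bounded (range (A k))" "bounded (range (\<phi>'' k))"
    "A k t > 0" "\<bar>deriv (A k) t\<bar> \<le> \<epsilon>1" "\<bar>deriv (\<phi>'' k) t\<bar> \<le> \<epsilon>3"
    by (simp_all add: eval_nat_numeral)
qed

lemma component_DERIV:
  assumes "k \<in> {1..K}"
  shows "(A k has_real_derivative deriv (A k) t) (at t)"
    "(\<phi> k has_real_derivative \<phi>' k t) (at t)"
    "(\<phi>' k has_real_derivative \<phi>'' k t) (at t)"
    "(\<phi>'' k has_real_derivative deriv (\<phi>'' k) t) (at t)"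
  using component[OF assms] DERIV_deriv_iff_real_differentiable by blast+

lemma component_continuous:
  assumes k: "k \<in> {1..K}"
  shows "continuous_on S (A k)" "continuous_on S (deriv (A k))" "continuous_on S (\<phi> k)"
    "continuous_on S (\<phi>' k)" "continuous_on S (\<phi>'' k)"
  by (intro continuous_at_imp_continuous_on ballI differentiable_imp_continuous_within component[OF k])+

text \<open>Mean value inequality from 0 with the bounded second derivative; no bound on
  \<open>\<phi>' k\<close> itself is assumed.\<close>

lemma phase_derivative_growth:
  assumes k: "k \<in> {1..K}"
  obtains C where "C \<ge> 0" "\<And>z. \<bar>\<phi>' k z\<bar> \<le> C * (1 + \<bar>z\<bar>)"
proof -
  obtain C where C: "\<And>z. \<bar>\<phi>'' k z\<bar> \<le> C"
    using component(7)[OF k] by (auto simp: bounded_iff)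
  then have C0: "C \<ge> 0" using abs_ge_zero order_trans by blast
  have "\<bar>\<phi>' k z\<bar> \<le> (\<bar>\<phi>' k 0\<bar> + C) * (1 + \<bar>z\<bar>)" for z
  proof -
    have "norm (\<phi>' k z - \<phi>' k 0) \<le> C * norm (z - 0)"
      by (rule field_differentiable_bound[where S = UNIV and f' = "\<phi>'' k"])
         (use component_DERIV[OF k] C in \<open>auto intro: has_field_derivative_at_within\<close>)
    then have "\<bar>\<phi>' k z\<bar> \<le> \<bar>\<phi>' k 0\<bar> + C * \<bar>z\<bar>" by simp
    also have "\<dots> \<le> (\<bar>\<phi>' k 0\<bar> + C) * (1 + \<bar>z\<bar>)" using C0 by (simp add: algebra_simps)
    finally show ?thesis .
  qed
  then show ?thesis using C0 that by (meson abs_ge_zero add_nonneg_nonneg)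
qed

definition comp_deriv :: "nat \<Rightarrow> real \<Rightarrow> complex" where
  "comp_deriv k t = (deriv (A k) t + \<i> * (2 * pi * \<phi>' k t) * A k t) * cis (2 * pi * \<phi> k t)"

lemma norm_comp: "k \<in> {1..K} \<Longrightarrow> cmod (comp k t) = A k t"
  using component(8)[of k t] by (simp add: comp_def norm_mult)

lemma C1_growth_comp:
  assumes k: "k \<in> {1..K}"
  shows "C1_growth (comp k) (comp_deriv k)"
  unfolding C1_growth_def
proof (intro conjI allI)
  have cont: "continuous_on UNIV (\<lambda>t. cis (2 * pi * \<phi> k t))"
    by (intro continuous_intros component_continuous k)
  obtain B where B: "\<And>t. \<bar>A k t\<bar> \<le> B"
    using component(6)[OF k] by (auto simp: bounded_iff)
  show "linear_growth (comp k)"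
  proof (rule linear_growth_bounded)
    show "continuous_on UNIV (comp k)"
      unfolding comp_def by (intro continuous_intros component_continuous k)
    show "cmod (comp k z) \<le> B" for z using B[of z] by (simp add: comp_def norm_mult)
  qed
  obtain C where C: "C \<ge> 0" "\<And>z. \<bar>\<phi>' k z\<bar> \<le> C * (1 + \<bar>z\<bar>)"
    using phase_derivative_growth[OF k] by blast
  have B0: "B \<ge> 0" using B abs_ge_zero order_trans by blast
  have "cmod (comp_deriv k z) \<le> (\<bar>\<epsilon>1\<bar> + 2 * pi * C * B) * (1 + \<bar>z\<bar>)" for z
  proof -
    have "cmod (comp_deriv k z) \<le> \<bar>deriv (A k) z\<bar> + 2 * pi * (\<bar>\<phi>' k z\<bar> * \<bar>A k z\<bar>)"
      unfolding comp_deriv_def norm_mult norm_cis mult_1_right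
      by (rule order_trans[OF norm_triangle_ineq]) (simp add: norm_mult)
    also have "\<dots> \<le> \<bar>\<epsilon>1\<bar> * (1 + \<bar>z\<bar>) + 2 * pi * ((C * (1 + \<bar>z\<bar>)) * B)"
    proof (intro add_mono mult_left_mono mult_mono C B)
      have "\<bar>deriv (A k) z\<bar> \<le> \<bar>\<epsilon>1\<bar>" using component(9)[OF k, of z] by linarith
      also have "\<dots> \<le> \<bar>\<epsilon>1\<bar> * (1 + \<bar>z\<bar>)" by (simp add: algebra_simps)
      finally show "\<bar>deriv (A k) z\<bar> \<le> \<bar>\<epsilon>1\<bar> * (1 + \<bar>z\<bar>)" .
    qed (use C(1) in auto)
    finally show ?thesis by (simp add: algebra_simps)
  qed
  moreover have "continuous_on UNIV (comp_deriv k)"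
    unfolding comp_deriv_def by (intro continuous_intros component_continuous k)
  moreover have "0 \<le> \<bar>\<epsilon>1\<bar> + 2 * pi * C * B" using C(1) B0 by simp
  ultimately show "linear_growth (comp_deriv k)" unfolding linear_growth_def by blast
  fix z
  have "((\<lambda>t. of_real (A k t) * cis (2 * pi * \<phi> k t)) has_vector_derivative
    of_real (A k z) * (\<i> * of_real (2 * pi * \<phi>' k z) * cis (2 * pi * \<phi> k z)) +
    of_real (deriv (A k) z) * cis (2 * pi * \<phi> k z)) (at z)"
    by (intro has_vector_derivative_mult has_vector_derivative_of_real has_vector_derivative_cis
        DERIV_cmult component_DERIV k)
  then show "(comp k has_vector_derivative comp_deriv k z) (at z)"
    unfolding comp_def[abs_def] comp_deriv_def
    by (rule has_vector_derivative_eq_rhs) (simp add: algebra_simps)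
qed

definition signal_deriv :: "real \<Rightarrow> complex" where
  "signal_deriv t = (\<Sum>k=1..K. comp_deriv k t)"

lemma C1_growth_signal: "C1_growth signal signal_deriv"
  unfolding signal_def[abs_def] signal_deriv_def[abs_def] by (intro C1_growth_sum C1_growth_comp)

lemma continuous_on_chirp: "continuous_on S (chirp k b)"
  unfolding chirp_def[abs_def] by (intro continuous_intros)

lemma C1_growth_chirp:
  "C1_growth (chirp k b) (\<lambda>z. \<i> * 2 * pi * (\<phi>' k b + \<phi>'' k b * z) * chirp k b z)"
  unfolding C1_growth_def
proof (intro conjI allI)
  show "linear_growth (chirp k b)"
    by (rule linear_growth_bounded[OF continuous_on_chirp, of _ _ 1]) (simp add: chirp_def)
  have "cmod (\<i> * 2 * pi * (\<phi>' k b + \<phi>'' k b * z) * chirp k b z) \<le>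
      (2 * pi * (\<bar>\<phi>' k b\<bar> + \<bar>\<phi>'' k b\<bar>)) * (1 + \<bar>z\<bar>)" for z
  proof -
    have "cmod (\<i> * 2 * pi * (\<phi>' k b + \<phi>'' k b * z) * chirp k b z) = 2 * pi * cmod (of_real (\<phi>' k b + \<phi>'' k b * z))"
      by (simp add: norm_mult chirp_def)
    also have "\<dots> = 2 * pi * \<bar>\<phi>' k b + \<phi>'' k b * z\<bar>" by (simp only: norm_of_real)
    also have "\<dots> \<le> 2 * pi * ((\<bar>\<phi>' k b\<bar> + \<bar>\<phi>'' k b\<bar>) * (1 + \<bar>z\<bar>))"
    proof (rule mult_left_mono)
      have "\<bar>\<phi>' k b + \<phi>'' k b * z\<bar> \<le> \<bar>\<phi>' k b\<bar> + \<bar>\<phi>'' k b\<bar> * \<bar>z\<bar>"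
        using abs_triangle_ineq[of "\<phi>' k b" "\<phi>'' k b * z"] by (simp add: abs_mult)
      also have "\<dots> \<le> (\<bar>\<phi>' k b\<bar> + \<bar>\<phi>'' k b\<bar>) * (1 + \<bar>z\<bar>)" by (simp add: algebra_simps)
      finally show "\<bar>\<phi>' k b + \<phi>'' k b * z\<bar> \<le> (\<bar>\<phi>' k b\<bar> + \<bar>\<phi>'' k b\<bar>) * (1 + \<bar>z\<bar>)" .
    qed simp
    finally show ?thesis by (simp add: mult.assoc)
  qed
  moreover have "continuous_on UNIV (\<lambda>z. \<i> * 2 * pi * (\<phi>' k b + \<phi>'' k b * z) * chirp k b z)"
    by (intro continuous_intros continuous_on_chirp)
  moreover have "0 \<le> 2 * pi * (\<bar>\<phi>' k b\<bar> + \<bar>\<phi>'' k b\<bar>)" by simp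
  ultimately show "linear_growth (\<lambda>z. \<i> * 2 * pi * (\<phi>' k b + \<phi>'' k b * z) * chirp k b z)"
    unfolding linear_growth_def by blast
  fix z
  have "((\<lambda>z. 2 * pi * (\<phi>' k b * z + 1 / 2 * \<phi>'' k b * z\<^sup>2)) has_real_derivative
      2 * pi * (\<phi>' k b + \<phi>'' k b * z)) (at z)"
    by (auto intro!: derivative_eq_intros)
  from has_vector_derivative_cis[OF this]
  show "(chirp k b has_vector_derivative \<i> * 2 * pi * (\<phi>' k b + \<phi>'' k b * z) * chirp k b z) (at z)"
    unfolding chirp_def[abs_def] by (rule has_vector_derivative_eq_rhs) (simp add: algebra_simps)
qed

section \<open>The transforms after rescaling by the window width\<close>

lemma osc_substitution:
  fixes f w :: "real \<Rightarrow> complex"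
  shows "(LINT t|lborel. f t * (1 / \<sigma> b) * w (t / \<sigma> b) * cis (- 2 * pi * \<mu> * t)) =
    (LINT y|lborel. f (\<sigma> b * y) * w y * cis (freq b * y))"
proof -
  have [simp]: "\<bar>\<sigma> b\<bar> = \<sigma> b" "\<sigma> b \<noteq> 0" using \<sigma>_pos[of b] by auto
  have "(LINT t|lborel. f t * (1 / \<sigma> b) * w (t / \<sigma> b) * cis (- 2 * pi * \<mu> * t)) =
    \<bar>\<sigma> b\<bar> *\<^sub>R (LINT y|lborel. f (0 + \<sigma> b * y) * (1 / \<sigma> b) * w ((0 + \<sigma> b * y) / \<sigma> b) * cis (- 2 * pi * \<mu> * (0 + \<sigma> b * y)))"
    by (rule lborel_integral_real_affine) simp
  also have "\<dots> = (LINT y|lborel. \<bar>\<sigma> b\<bar> *\<^sub>R (f (0 + \<sigma> b * y) * (1 / \<sigma> b) * w ((0 + \<sigma> b * y) / \<sigma> b) * cis (- 2 * pi * \<mu> * (0 + \<sigma> b * y))))"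
    by (rule integral_scaleR_right[symmetric]) 
  also have "\<dots> = (LINT y|lborel. f (\<sigma> b * y) * w y * cis (freq b * y))"
    by (rule Bochner_Integration.integral_cong) (simp_all add: scaleR_conv_of_real mult_ac)
  finally show ?thesis .
qed

lemma W_osc: "W w a b = osc signal w b (a * \<sigma> b) (freq b)"
  unfolding W_def osc_substitution[of "\<lambda>t. signal (b + a * t)"] by (simp add: osc_def mult.assoc)

text \<open>The power \<open>\<sigma> b ^ (j + 1)\<close> in \<open>G\<close> normalises the window
  to \<open>(1 / \<sigma> b) * tmul j g (t / \<sigma> b)\<close>, the form that the windows in
  \<open>W\<close> and \<open>res\<close> have as well.\<close>

lemma G_osc: "G j k a b = osc (chirp k b) (tmul j g) 0 (a * \<sigma> b) (freq b)"
proof -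
  have *: "complex_of_real (t ^ j / \<sigma> b ^ (j + 1)) * g (t / \<sigma> b) = (1 / \<sigma> b) * tmul j g (t / \<sigma> b)" for t
    using \<sigma>_pos[of b] by (simp add: tmul_def power_divide)
  have "G j k a b = (LINT t|lborel. chirp k b (a * t) * (1 / \<sigma> b) * tmul j g (t / \<sigma> b) * cis (- 2 * pi * \<mu> * t))"
    unfolding G_def by (rule Bochner_Integration.integral_cong)
      (simp_all only: mult.assoc * flip: mult.assoc[of _ _ "cis (- 2 * pi * \<mu> * _)"],
       simp_all add: chirp_def power_mult_distrib mult.assoc)
  also have "\<dots> = osc (chirp k b) (tmul j g) 0 (a * \<sigma> b) (freq b)"
    unfolding osc_substitution[of "\<lambda>t. chirp k b (a * t)"] by (simp add: osc_def mult.assoc)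
  finally show ?thesis .
qed

text \<open>The residual depends on a and t only through \<open>a * t\<close>; hence the fixed
  function \<open>x_r 1 b\<close> serves all scales, and a enters only as a dilation.\<close>

lemma x_r_eq: "x_r a b t = x_r 1 b (a * t)"
  by (simp add: x_r_def power_mult_distrib mult.assoc)

lemma C1_growth_x_r: "C1_growth (x_r 1 b) (\<lambda>z. signal_deriv (b + z) +
   (\<Sum>k=1..K. - comp k b * (\<i> * 2 * pi * (\<phi>' k b + \<phi>'' k b * z) * chirp k b z)))"
proof -
  have "x_r 1 b = (\<lambda>z. signal (b + z) + (\<Sum>k=1..K. - comp k b * chirp k b z))"
    by (simp add: fun_eq_iff x_r_def chirp_def sum_negf)
  then show ?thesis
    by (simp only:) (intro C1_growth_add C1_growth_sum C1_growth_cmult C1_growth_chirp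
         C1_growth_shift[OF C1_growth_signal])
qed

lemma res_osc: "res w a b = osc (x_r 1 b) w 0 (a * \<sigma> b) (freq b)"
  unfolding res_def x_r_eq[of a] osc_substitution[of "\<lambda>t. x_r 1 b (a * t)"] by (simp add: osc_def mult.assoc)

lemma W_decomposition:
  assumes w: "schwartz w"
  shows "W w a b = (\<Sum>k=1..K. comp k b * osc (chirp k b) w 0 (a * \<sigma> b) (freq b)) + res w a b"
proof -
  have lg: "linear_growth (chirp k b)" "linear_growth (x_r 1 b)" for k
    using C1_growth_chirp C1_growth_x_r by (auto simp: C1_growth_def)
  have "(\<lambda>z. signal (b + z)) = (\<lambda>z. (\<Sum>k=1..K. comp k b * chirp k b z) + x_r 1 b z)"
    by (simp add: fun_eq_iff x_r_def chirp_def)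
  then have "W w a b = osc (\<lambda>z. (\<Sum>k=1..K. comp k b * chirp k b z) + x_r 1 b z) w 0 (a * \<sigma> b) (freq b)"
    unfolding W_osc osc_shift[symmetric, of signal] by simp
  then show ?thesis
    by (simp add: osc_add osc_sum osc_cmult res_osc lg w linear_growth_sum linear_growth_cmult)
qed

end

subsection \<open>The phase transformation\<close>

text \<open>The derivative of a chirp is an affine function times the chirp. At
  \<open>z = c * y\<close> the linear part turns into a factor y on the window, that is into
  \<open>tmul 1 w\<close>.\<close>

lemma osc_chirp_deriv:
  assumes f: "linear_growth f" and w: "schwartz w"
  shows "osc (\<lambda>z. k * (r + s * of_real z) * f z) w 0 c m =
    k * (r * osc f w 0 c m + s * c * osc f (tmul 1 w) 0 c m)"
proof -
  have "has_bochner_integral lborel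
      (\<lambda>y. k * (r * (f (0 + c * y) * w y * cis (m * y)) + s * c * (f (0 + c * y) * tmul 1 w y * cis (m * y))))
      (k * (r * osc f w 0 c m + s * c * osc f (tmul 1 w) 0 c m))"
    unfolding osc_def
    by (intro has_bochner_integral_mult_right has_bochner_integral_add has_bochner_integral_integrable
        osc_integrand_integrable f w schwartz_tmul)
  moreover have "(\<lambda>y. k * (r * (f (0 + c * y) * w y * cis (m * y)) + s * c * (f (0 + c * y) * tmul 1 w y * cis (m * y)))) =
      (\<lambda>y. k * (r + s * of_real (0 + c * y)) * f (0 + c * y) * w y * cis (m * y))"
    by (simp add: fun_eq_iff tmul_def algebra_simps)
  ultimately show ?thesis
    unfolding osc_def by (simp only: has_bochner_integral_integral_eq)
qed

text \<open>P, \<open>P'\<close> and R stand for the transforms with windows \<open>g\<close>,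
  \<open>vderiv g\<close> and \<open>tmul 1 g\<close>, S for the sum of those with \<open>g\<close>
  and \<open>tmul 1 (vderiv g)\<close>, y for the value of \<sigma>, d for its derivative. The two
  contributions of R, from the dilation and from the modulation, cancel.\<close>

lemma Db_algebra:
  fixes a y t d P P' R S :: complex
  assumes "a \<noteq> 0" "y \<noteq> 0"
  shows "(t * y * P - P') / (a * y) + a * d * ((t * y * R - S) / (a * y)) - t * d * R =
    t / a * P - P' / (a * y) - d / y * S"
  using assms by (simp add: field_simps)

text \<open>The left-hand side is what the product rule gives for \<open>Res1\<close>, the
  right-hand side is \<open>Res2\<close>. J is \<open>\<i> * 2 * pi\<close>, x the scale, y the
  value of \<sigma>, m is \<mu>, p and q are \<open>\<phi>' k b\<close> and
  \<open>\<phi>'' k b\<close>. The letters \<open>r0\<close>, \<open>r1\<close>, \<open>r2\<close>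
  and \<open>s0\<close>, \<open>s1\<close>, \<open>s2\<close> are residuals for powers of t times
  \<open>g\<close> and times \<open>vderiv g\<close>, \<open>ss\<close> is the one for t times the
  second derivative; e, d, f are \<open>E\<close>, \<open>D\<close>, \<open>F\<close>.\<close>

lemma Res2_algebra:
  fixes J x y m p q e d f r0 r1 r2 s0 s1 s2 ss :: complex
  assumes x: "x \<noteq> 0" and y: "y \<noteq> 0"
  shows "J * (J * y * e) + J * y * (x * (J * y * f) + d) +
      J * ((m / x - p) * (- (r0 + s1 - J * m * y * r1) / x) + (- m / x\<^sup>2) * r0) -
      (1 / (x * y) * (- (s0 + ss - J * m * y * s1) / x) + (- 1 / (x\<^sup>2 * y)) * s0) -
      J * q * y * (x * (- (2 * r1 + s2 - J * m * y * r2) / x) + r1) =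
    J * J * y * e + J * y * d + J * J * x * y\<^sup>2 * f + J / x\<^sup>2 * (x * p - 2 * m) * (r0 + s1) +
      J * y * (q - J * m / x\<^sup>2 * (x * p - m)) * r1 - J * y * q * (J * m * y * r2 - s2) +
      1 / (x\<^sup>2 * y) * (2 * s0 + ss)"
proof -
  have 1: "x * (- (2 * r1 + s2 - J * m * y * r2) / x) = - (2 * r1 + s2 - J * m * y * r2)"
    using x by simp
  \<comment> \<open>With reciprocals as variables the claim becomes a polynomial identity modulo
    \<open>x * z = 1\<close> and \<open>y * v = 1\<close>.\<close>
  define z where "z = inverse x"
  define v where "v = inverse y"
  have zv: "1 / (x * y) = z * v" "- 1 / (x\<^sup>2 * y) = - (z * z * v)" "1 / (x\<^sup>2 * y) = z * z * v"
    "- m / x\<^sup>2 = - (m * z * z)" "J / x\<^sup>2 = J * z * z" "J * m / x\<^sup>2 = J * m * z * z" "m / x = m * z"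
    "c / x = c * z" for c
    using x y by (simp_all add: z_def v_def field_simps power2_eq_square)
  have xz: "x * z = 1" "y * v = 1" using x y by (simp_all add: z_def v_def)
  show ?thesis
    unfolding 1 zv unfolding power2_eq_square using xz by algebra
qed

text \<open>With v for \<open>V\<close>, n for \<open>W g\<close> and s for the quotient of
  \<open>deriv \<sigma>\<close> by \<sigma>, the subtracted term divided by n is
  \<open>s + s * n3 / n\<close>. Its first part is constant in the scale and the second cancels the
  explicit correction in \<open>R0\<close>, so only the derivative of \<open>v / n\<close> is
  left.\<close>

lemma R0_algebra:
  fixes q n n3 dn dn3 v dv s :: complex
  assumes "q \<noteq> 0" "n \<noteq> 0"
  shows "1 / (q / n\<^sup>2) * (((dv - s * (dn + dn3)) * n - (v - s * (n + n3)) * dn) / n\<^sup>2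
       + s * ((dn3 * n - n3 * dn) / n\<^sup>2)) = (dv * n - v * dn) / q"
proof -
  have *: "((dv - s * (dn + dn3)) * n - (v - s * (n + n3)) * dn) + s * (dn3 * n - n3 * dn) = dv * n - v * dn"
    by (simp add: algebra_simps)
  have "1 / (q / n\<^sup>2) * (X / n\<^sup>2 + s * (Y / n\<^sup>2)) = (X + s * Y) / q" for X Y
    using assms by (simp add: field_simps)
  from this[of "(dv - s * (dn + dn3)) * n - (v - s * (n + n3)) * dn" "dn3 * n - n3 * dn"]
  show ?thesis unfolding * .
qed

text \<open>The correction with \<open>deriv \<sigma>\<close> in \<open>omega_c\<close> is the one
  that occurs in \<open>Db (W g)\<close>, with the opposite sign.\<close>

lemma omega_algebra:
  fixes J n n1 n3 x v d y r :: complex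
  assumes "n \<noteq> 0" "y \<noteq> 0" "J \<noteq> 0"
  shows "(v - d / y * (n + n3)) / (J * n) + d / (J * y) * (1 + n3 / n) - x * (n1 / (J * n)) * r =
    (v - x * n1 * r) / (J * n)"
proof -
  have "d / (J * y) * (1 + n3 / n) = (d / y * (n + n3)) / (J * n)"
    using assms by (simp add: field_simps)
  then show ?thesis by (simp only:) (simp add: diff_divide_distrib)
qed

context wsst_setting
begin

lemma osc_chirp:
  assumes w: "schwartz w"
  shows "osc (\<lambda>z. \<i> * 2 * pi * (\<phi>' k b + \<phi>'' k b * z) * chirp k b z) w 0 c m =
    \<i> * 2 * pi * (\<phi>' k b * osc (chirp k b) w 0 c m + \<phi>'' k b * c * osc (chirp k b) (tmul 1 w) 0 c m)"
proof -
  have "linear_growth (chirp k b)" using C1_growth_chirp by (auto simp: C1_growth_def)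
  from osc_chirp_deriv[OF this w, of "\<i> * 2 * pi" "complex_of_real (\<phi>' k b)" "complex_of_real (\<phi>'' k b)" c m]
  show ?thesis by (simp only: of_real_add of_real_mult)
qed

section \<open>Derivatives in scale and in time\<close>

lemma W_has_deriv:
  assumes w: "schwartz w" and a: "a > 0"
  shows "((\<lambda>a. W w a b) has_vector_derivative
    - (W w a b + W (tmul 1 (vderiv w)) a b - \<i> * (2 * pi * \<mu> * \<sigma> b) * W (tmul 1 w) a b) / a) (at a)"
  unfolding W_osc using osc_dilation_derivative[OF C1_growth_signal w, of a b "\<sigma> b" "freq b"] a
  by simp

lemma res_has_deriv:
  assumes w: "schwartz w" and a: "a > 0"
  shows "((\<lambda>a. res w a b) has_vector_derivative
    - (res w a b + res (tmul 1 (vderiv w)) a b - \<i> * (2 * pi * \<mu> * \<sigma> b) * res (tmul 1 w) a b) / a) (at a)"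
  unfolding res_osc using osc_dilation_derivative[OF C1_growth_x_r w, of a b 0 "\<sigma> b" "freq b"] a
  by simp

text \<open>The derivative of the chirp is explicit, so it is kept instead of being integrated by
  parts; it raises the window power by one and by two. This is how \<open>E\<close> and
  \<open>F\<close> come to contain \<open>G 1\<close>, \<open>G 2\<close> and
  \<open>G 3\<close>.\<close>

lemma G_has_deriv:
  "((\<lambda>a. G j k a b) has_vector_derivative
     \<i> * 2 * pi * \<sigma> b * (\<phi>' k b * G (j + 1) k a b + \<phi>'' k b * a * \<sigma> b * G (j + 2) k a b)) (at a)"
proof -
  have w: "schwartz (tmul j g)" by (rule schwartz_tmul[OF schwartz_g])
  have "((\<lambda>a. osc (chirp k b) (tmul j g) 0 (a * \<sigma> b) (freq b)) has_vector_derivative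
     complex_of_real 0 * osc (\<lambda>z. \<i> * 2 * pi * (\<phi>' k b + \<phi>'' k b * z) * chirp k b z) (tmul j g) 0 (a * \<sigma> b) (freq b)
    + complex_of_real (\<sigma> b) * osc (\<lambda>z. \<i> * 2 * pi * (\<phi>' k b + \<phi>'' k b * z) * chirp k b z) (tmul 1 (tmul j g)) 0 (a * \<sigma> b) (freq b)
    + \<i> * complex_of_real 0 * osc (chirp k b) (tmul 1 (tmul j g)) 0 (a * \<sigma> b) (freq b)) (at a)"
    by (rule osc_has_vector_derivative[OF C1_growth_chirp w]) (auto intro!: derivative_eq_intros)
  then show ?thesis
    unfolding G_osc
    by (rule has_vector_derivative_eq_rhs)
       (simp only: osc_chirp[OF schwartz_tmul[OF schwartz_g]] tmul_tmul, simp add: algebra_simps)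
qed

text \<open>For \<open>a > 0\<close> this is the transform with window g of the derivative of the
  signal, equivalently the b-derivative of W with the width held fixed, but written without that
  derivative. In this form it can be differentiated in a.\<close>

definition V :: "real \<Rightarrow> real \<Rightarrow> complex" where
  "V a b = \<i> * (2 * pi * \<mu>) / a * W g a b - W (vderiv g) a b / (a * \<sigma> b)"

text \<open>The variable b enters W as the centre, through the dilation
  \<open>a * \<sigma> b\<close> and through \<open>freq b\<close>. The first gives \<open>V\<close>;
  the other two bring in \<open>deriv \<sigma> b\<close>, and after integration by parts their terms
  with \<open>W (tmul 1 g)\<close> cancel.\<close>

lemma Db_W:
  assumes a: "a > 0"
  shows "Db (W g) a b = V a b - deriv \<sigma> b / \<sigma> b * (W g a b + W (tmul 1 (vderiv g)) a b)"
proof -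
  have s: "\<sigma> b \<noteq> 0" using \<sigma>_pos[of b] by simp
  have ds: "(\<sigma> has_real_derivative deriv \<sigma> b) (at b)"
    using \<sigma>_diff DERIV_deriv_iff_real_differentiable by blast
  define c where "c = a * \<sigma> b"
  define X where "X w = osc signal_deriv w b c (freq b)" for w
  note gw = schwartz_g schwartz_tmul[OF schwartz_g] schwartz_vderiv[OF schwartz_g]
  have lg: "linear_growth signal" using C1_growth_signal by (simp add: C1_growth_def)
  have "((\<lambda>b. osc signal g b (a * \<sigma> b) (freq b)) has_vector_derivative
     complex_of_real 1 * osc signal_deriv g b (a * \<sigma> b) (freq b)
     + complex_of_real (a * deriv \<sigma> b) * osc signal_deriv (tmul 1 g) b (a * \<sigma> b) (freq b)
     + \<i> * complex_of_real (- 2 * pi * \<mu> * deriv \<sigma> b) * osc signal (tmul 1 g) b (a * \<sigma> b) (freq b)) (at b)"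
    by (rule osc_has_vector_derivative[OF C1_growth_signal schwartz_g])
       (use ds in \<open>auto intro!: derivative_eq_intros\<close>)
  then have 1: "Db (W g) a b = X g + a * deriv \<sigma> b * X (tmul 1 g) - \<i> * (2 * pi * \<mu> * deriv \<sigma> b) * W (tmul 1 g) a b"
    unfolding Db_def W_osc X_def c_def using vector_derivative_at by force
  have 2: "c * X g + W (vderiv g) a b - \<i> * (2 * pi * \<mu> * \<sigma> b) * W g a b = 0"
    using osc_integration_by_parts[OF C1_growth_signal schwartz_g, of c b "freq b"]
    by (simp add: X_def W_osc c_def)
  have "W (vderiv (tmul 1 g)) a b = W g a b + W (tmul 1 (vderiv g)) a b"
    unfolding vderiv_tmul[OF schwartz_g] W_osc
    by (intro osc_add_window lg gw schwartz_tmul)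
  then have 3: "c * X (tmul 1 g) + (W g a b + W (tmul 1 (vderiv g)) a b) - \<i> * (2 * pi * \<mu> * \<sigma> b) * W (tmul 1 g) a b = 0"
    using osc_integration_by_parts[OF C1_growth_signal schwartz_tmul[OF schwartz_g, of 1], of c b "freq b"]
    by (simp add: X_def W_osc c_def)
  have c: "complex_of_real c \<noteq> 0" using a s by (simp add: c_def)
  have X0: "X g = (\<i> * (2 * pi * \<mu>) * \<sigma> b * W g a b - W (vderiv g) a b) / c"
    using 2 c by (simp only: eq_divide_eq) (simp add: algebra_simps)
  have X1: "X (tmul 1 g) = (\<i> * (2 * pi * \<mu>) * \<sigma> b * W (tmul 1 g) a b - (W g a b + W (tmul 1 (vderiv g)) a b)) / c"
    using 3 c by (simp only: eq_divide_eq) (simp add: algebra_simps)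
  show ?thesis
    using Db_algebra[of a "\<sigma> b" "\<i> * (2 * pi * \<mu>)" "W g a b" "W (vderiv g) a b" "deriv \<sigma> b" "W (tmul 1 g) a b"] a s
    unfolding 1 V_def X0 X1 c_def by (simp add: mult.assoc)
qed

text \<open>The chirp has the exactly affine frequency
  \<open>\<phi>' k b + \<phi>'' k b * z\<close>, so the combination that defines \<open>V\<close>
  evaluates to its two frequency terms without remainder.\<close>

lemma chirp_by_parts:
  assumes a: "a > 0"
  shows "\<i> * (2 * pi * \<mu>) / a * G 0 k a b - osc (chirp k b) (vderiv g) 0 (a * \<sigma> b) (freq b) / (a * \<sigma> b) =
    \<i> * 2 * pi * (\<phi>' k b * G 0 k a b + \<phi>'' k b * a * \<sigma> b * G 1 k a b)"
proof -
  have s: "\<sigma> b \<noteq> 0" using \<sigma>_pos[of b] by simp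
  have "(a * \<sigma> b) * (\<i> * 2 * pi * (\<phi>' k b * G 0 k a b + \<phi>'' k b * (a * \<sigma> b) * G 1 k a b)) +
    osc (chirp k b) (vderiv g) 0 (a * \<sigma> b) (freq b) + \<i> * (- 2 * pi * \<mu> * \<sigma> b) * G 0 k a b = 0"
    using osc_integration_by_parts[OF C1_growth_chirp schwartz_g, of "a * \<sigma> b" k b 0 "freq b"]
    unfolding G_osc tmul_0 osc_chirp[OF schwartz_g] by simp
  then have "osc (chirp k b) (vderiv g) 0 (a * \<sigma> b) (freq b) = \<i> * (2 * pi * \<mu> * \<sigma> b) * G 0 k a b -
    (a * \<sigma> b) * (\<i> * 2 * pi * (\<phi>' k b * G 0 k a b + \<phi>'' k b * (a * \<sigma> b) * G 1 k a b))"
    by (simp add: algebra_simps add_eq_0_iff2)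
  then show ?thesis using a s by (simp add: field_simps)
qed

text \<open>The summand for k carries a zero factor, so the full range may be used; the sum then
  splits into a weighted sum minus \<open>\<phi>' k b\<close> times the sum of the main
  terms.\<close>

lemma B_eq: "B k a b = (\<Sum>j=1..K. comp j b * (\<phi>' j b - \<phi>' k b) * G 0 j a b)"
  unfolding B_def by (rule sum.mono_neutral_left) auto

lemma D_eq: "D k a b = (\<Sum>j=1..K. comp j b * (\<phi>'' j b - \<phi>'' k b) * G 1 j a b)"
  unfolding D_def by (rule sum.mono_neutral_left) auto

lemma W_g_eq: "W g a b = (\<Sum>k=1..K. comp k b * G 0 k a b) + res g a b"
  using W_decomposition[OF schwartz_g] by (simp add: G_osc)

lemma W_tmul_eq: "W (tmul 1 g) a b = (\<Sum>k=1..K. comp k b * G 1 k a b) + res (tmul 1 g) a b"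
  using W_decomposition[OF schwartz_tmul[OF schwartz_g]] by (simp add: G_osc)

text \<open>Every component contributes with its own frequencies, written as those of k plus a
  difference. The parts with the frequencies of k reassemble to transforms of the signal once
  residual transforms are added; \<open>Res1\<close> collects the differences, in \<open>B\<close>
  and \<open>D\<close>, and the residual terms.\<close>

lemma V_eq:
  assumes a: "a > 0"
  shows "V a b = \<i> * 2 * pi * \<phi>' k b * W g a b + \<i> * 2 * pi * \<phi>'' k b * \<sigma> b * (a * W (tmul 1 g) a b) + Res1 k a b"
proof -
  define q where "q j = osc (chirp j b) (vderiv g) 0 (a * \<sigma> b) (freq b)" for j
  define S0 where "S0 = (\<Sum>j=1..K. comp j b * G 0 j a b)"
  define S1 where "S1 = (\<Sum>j=1..K. comp j b * \<phi>' j b * G 0 j a b)"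
  define T0 where "T0 = (\<Sum>j=1..K. comp j b * G 1 j a b)"
  define T1 where "T1 = (\<Sum>j=1..K. comp j b * \<phi>'' j b * G 1 j a b)"
  have "V a b = (\<Sum>j=1..K. comp j b * (\<i> * (2 * pi * \<mu>) / a * G 0 j a b - q j / (a * \<sigma> b)))
      + (\<i> * (2 * pi * \<mu>) / a * res g a b - res (vderiv g) a b / (a * \<sigma> b))"
    unfolding V_def W_g_eq W_decomposition[OF schwartz_vderiv[OF schwartz_g]] q_def
    by (simp add: sum_subtractf sum_distrib_left sum_divide_distrib right_diff_distrib distrib_left
        add_divide_distrib mult_ac)
  also have "(\<Sum>j=1..K. comp j b * (\<i> * (2 * pi * \<mu>) / a * G 0 j a b - q j / (a * \<sigma> b))) =
      (\<Sum>j=1..K. comp j b * (\<i> * 2 * pi * (\<phi>' j b * G 0 j a b + \<phi>'' j b * a * \<sigma> b * G 1 j a b)))"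
    unfolding q_def chirp_by_parts[OF a] ..
  also have "\<dots> = \<i> * 2 * pi * S1 + \<i> * 2 * pi * a * \<sigma> b * T1"
    by (simp add: S1_def T1_def sum_distrib_left sum.distrib algebra_simps)
  finally have V: "V a b = \<i> * 2 * pi * S1 + \<i> * 2 * pi * a * \<sigma> b * T1
      + (\<i> * (2 * pi * \<mu>) / a * res g a b - res (vderiv g) a b / (a * \<sigma> b))" .
  have B: "B k a b = S1 - \<phi>' k b * S0" and D: "D k a b = T1 - \<phi>'' k b * T0"
    by (simp_all add: B_eq D_eq S0_def S1_def T0_def T1_def sum_subtractf sum_distrib_left algebra_simps)
  show ?thesis
    unfolding V Res1_def B D W_g_eq W_tmul_eq S0_def[symmetric] T0_def[symmetric]
    by (simp add: algebra_simps)
qed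

lemma B_has_deriv: "((\<lambda>a. B k a b) has_vector_derivative \<i> * 2 * pi * \<sigma> b * E k a b) (at a)"
proof -
  have e: "(0::nat) + 1 = 1" "(0::nat) + 2 = 2" by simp_all
  have "((\<lambda>a. B k a b) has_vector_derivative (\<Sum>j\<in>{1..K} - {k}. comp j b * (\<phi>' j b - \<phi>' k b) *
     (\<i> * 2 * pi * \<sigma> b * (\<phi>' j b * G 1 j a b + \<phi>'' j b * a * \<sigma> b * G 2 j a b)))) (at a)"
    unfolding B_def
    by (intro has_vector_derivative_sum has_vector_derivative_mult_right G_has_deriv[of 0, unfolded e])
  then show ?thesis
    by (rule has_vector_derivative_eq_rhs)
       (unfold E_def sum_distrib_left, rule sum.cong, simp_all add: algebra_simps)
qed

lemma D_has_deriv: "((\<lambda>a. D k a b) has_vector_derivative \<i> * 2 * pi * \<sigma> b * F k a b) (at a)"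
proof -
  have e: "(1::nat) + 1 = 2" "(1::nat) + 2 = 3" by simp_all
  have "((\<lambda>a. D k a b) has_vector_derivative (\<Sum>j\<in>{1..K} - {k}. comp j b * (\<phi>'' j b - \<phi>'' k b) *
     (\<i> * 2 * pi * \<sigma> b * (\<phi>' j b * G 2 j a b + \<phi>'' j b * a * \<sigma> b * G 3 j a b)))) (at a)"
    unfolding D_def
    by (intro has_vector_derivative_sum has_vector_derivative_mult_right G_has_deriv[of 1, unfolded e])
  then show ?thesis
    by (rule has_vector_derivative_eq_rhs)
       (unfold F_def sum_distrib_left, rule sum.cong, simp_all add: algebra_simps)
qed

lemma vderiv_tmul_mult:
  "schwartz w \<Longrightarrow> tmul 1 (vderiv (tmul 1 w)) = (\<lambda>t. tmul 1 w t + tmul 2 (vderiv w) t)"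
  by (subst vderiv_tmul) (auto simp: tmul_def fun_eq_iff power2_eq_square algebra_simps)

lemma Res1_has_deriv:
  assumes a: "a > 0"
  shows "((\<lambda>a. Res1 k a b) has_vector_derivative Res2 k a b) (at a)"
proof -
  have s: "\<sigma> b \<noteq> 0" using \<sigma>_pos[of b] by simp
  note g1 = schwartz_tmul[OF schwartz_g, of 1] and g' = schwartz_vderiv[OF schwartz_g]
  have r0: "((\<lambda>a. res g a b) has_vector_derivative
    - (res g a b + res (tmul 1 (vderiv g)) a b - \<i> * (2 * pi * \<mu> * \<sigma> b) * res (tmul 1 g) a b) / a) (at a)"
    by (rule res_has_deriv[OF schwartz_g a])
  have r0': "((\<lambda>a. res (vderiv g) a b) has_vector_derivative
    - (res (vderiv g) a b + res (tmul 1 (vderiv (vderiv g))) a b - \<i> * (2 * pi * \<mu> * \<sigma> b) * res (tmul 1 (vderiv g)) a b) / a) (at a)"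
    by (rule res_has_deriv[OF g' a])
  \<comment> \<open>Since \<open>t * (t * g)' = t * g + t\<^sup>2 * g'\<close>, the first term joins
    the one already present in the dilation rule and produces the coefficient 2.\<close>
  have "res (tmul 1 (vderiv (tmul 1 g))) a b = res (tmul 1 g) a b + res (tmul 2 (vderiv g)) a b"
    unfolding vderiv_tmul_mult[OF schwartz_g] res_osc
    by (intro osc_add_window g1 schwartz_tmul g') (use C1_growth_x_r in \<open>auto simp: C1_growth_def\<close>)
  then have r1: "((\<lambda>a. res (tmul 1 g) a b) has_vector_derivative
    - (2 * res (tmul 1 g) a b + res (tmul 2 (vderiv g)) a b - \<i> * (2 * pi * \<mu> * \<sigma> b) * res (tmul 2 g) a b) / a) (at a)"
    using res_has_deriv[OF g1 a, of b] by (simp add: tmul_tmul numeral_2_eq_2 algebra_simps)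
  have d1: "((\<lambda>a. complex_of_real (\<mu> / a - \<phi>' k b)) has_vector_derivative complex_of_real (- \<mu> / a\<^sup>2)) (at a)"
    using a by (intro has_vector_derivative_of_real) (auto intro!: derivative_eq_intros simp: power2_eq_square)
  have d2: "((\<lambda>a. complex_of_real (1 / (a * \<sigma> b))) has_vector_derivative complex_of_real (- 1 / (a\<^sup>2 * \<sigma> b))) (at a)"
    using a s by (intro has_vector_derivative_of_real) (auto intro!: derivative_eq_intros simp: power2_eq_square)
  have d3: "((\<lambda>a. complex_of_real a) has_vector_derivative complex_of_real 1) (at a)"
    by (intro has_vector_derivative_of_real) (auto intro!: derivative_eq_intros)
  let ?dr0 = "- (res g a b + res (tmul 1 (vderiv g)) a b - \<i> * (2 * pi * \<mu> * \<sigma> b) * res (tmul 1 g) a b) / a"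
  let ?dr0' = "- (res (vderiv g) a b + res (tmul 1 (vderiv (vderiv g))) a b - \<i> * (2 * pi * \<mu> * \<sigma> b) * res (tmul 1 (vderiv g)) a b) / a"
  let ?dr1 = "- (2 * res (tmul 1 g) a b + res (tmul 2 (vderiv g)) a b - \<i> * (2 * pi * \<mu> * \<sigma> b) * res (tmul 2 g) a b) / a"
  \<comment> \<open>Each scale-dependent coefficient is isolated as one real factor with known
    derivative, so that the product rule matches term by term.\<close>
  have eq: "Res1 k a b = \<i> * 2 * pi * B k a b + \<i> * 2 * pi * \<sigma> b * (complex_of_real a * D k a b) +
     \<i> * 2 * pi * (complex_of_real (\<mu> / a - \<phi>' k b) * res g a b) -
     complex_of_real (1 / (a * \<sigma> b)) * res (vderiv g) a b -
     \<i> * 2 * pi * \<phi>'' k b * \<sigma> b * (complex_of_real a * res (tmul 1 g) a b)" for a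
    by (simp add: Res1_def mult_ac)
  have "((\<lambda>a. Res1 k a b) has_vector_derivative
      \<i> * 2 * pi * (\<i> * 2 * pi * \<sigma> b * E k a b) +
      \<i> * 2 * pi * \<sigma> b * (complex_of_real a * (\<i> * 2 * pi * \<sigma> b * F k a b) + complex_of_real 1 * D k a b) +
      \<i> * 2 * pi * (complex_of_real (\<mu> / a - \<phi>' k b) * ?dr0 + complex_of_real (- \<mu> / a\<^sup>2) * res g a b) -
      (complex_of_real (1 / (a * \<sigma> b)) * ?dr0' + complex_of_real (- 1 / (a\<^sup>2 * \<sigma> b)) * res (vderiv g) a b) -
      \<i> * 2 * pi * \<phi>'' k b * \<sigma> b * (complex_of_real a * ?dr1 + complex_of_real 1 * res (tmul 1 g) a b)) (at a)"
    unfolding eq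
    by (intro has_vector_derivative_add has_vector_derivative_diff has_vector_derivative_mult_right
        has_vector_derivative_mult B_has_deriv D_has_deriv r0 r0' r1 d1 d2 d3)
  then show ?thesis
  proof (rule has_vector_derivative_eq_rhs)
    define J where "J = \<i> * 2 * complex_of_real pi"
    have J: "complex_of_real (- 4 * pi\<^sup>2 * c) = J * J * c" "complex_of_real (4 * pi\<^sup>2 * c) = - (J * J * c)" for c
      by (simp_all add: J_def power2_eq_square)
    have J': "\<i> * complex_of_real (2 * pi * \<mu> * \<sigma> b) = J * \<mu> * \<sigma> b"
      by (simp add: J_def)
    have Res2: "Res2 k a b = J * J * \<sigma> b * E k a b + J * \<sigma> b * D k a b + J * J * a * (complex_of_real (\<sigma> b))\<^sup>2 * F k a b +
        J / (complex_of_real a)\<^sup>2 * (a * complex_of_real (\<phi>' k b) - 2 * \<mu>) * (res g a b + res (tmul 1 (vderiv g)) a b) +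
        J * \<sigma> b * (\<phi>'' k b - J * \<mu> / (complex_of_real a)\<^sup>2 * (a * complex_of_real (\<phi>' k b) - \<mu>)) * res (tmul 1 g) a b -
        J * \<sigma> b * \<phi>'' k b * (J * \<mu> * \<sigma> b * res (tmul 2 g) a b - res (tmul 2 (vderiv g)) a b) +
        1 / ((complex_of_real a)\<^sup>2 * \<sigma> b) * (2 * res (vderiv g) a b + res (tmul 1 (vderiv (vderiv g))) a b)"
      unfolding Res2_def mult.assoc[of "4 * pi\<^sup>2" a] J J_def[symmetric] by (simp del: One_nat_def add: mult.assoc)
    show "\<i> * 2 * pi * (\<i> * 2 * pi * \<sigma> b * E k a b) +
      \<i> * 2 * pi * \<sigma> b * (complex_of_real a * (\<i> * 2 * pi * \<sigma> b * F k a b) + complex_of_real 1 * D k a b) +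
      \<i> * 2 * pi * (complex_of_real (\<mu> / a - \<phi>' k b) * ?dr0 + complex_of_real (- \<mu> / a\<^sup>2) * res g a b) -
      (complex_of_real (1 / (a * \<sigma> b)) * ?dr0' + complex_of_real (- 1 / (a\<^sup>2 * \<sigma> b)) * res (vderiv g) a b) -
      \<i> * 2 * pi * \<phi>'' k b * \<sigma> b * (complex_of_real a * ?dr1 + complex_of_real 1 * res (tmul 1 g) a b) = Res2 k a b"
      unfolding Res2 J' unfolding J_def[symmetric] of_real_mult of_real_divide of_real_diff of_real_minus of_real_power
        of_real_1 of_real_numeral mult_1
      by (rule Res2_algebra) (use a s in auto)
  qed
qed

section \<open>The second-order correction and the error identity\<close>

lemma W_has_Da: "a > 0 \<Longrightarrow> schwartz w \<Longrightarrow> ((\<lambda>a. W w a b) has_vector_derivative Da (W w) a b) (at a)"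
  unfolding Da_def using W_has_deriv vector_derivative_works differentiableI_vector by blast

text \<open>The numerator in the quotient rule for \<open>ratio\<close>; the same expression is the
  denominator of \<open>Res3\<close>, which is why a lower bound on \<open>Da ratio\<close> controls
  \<open>Res3\<close>.\<close>

definition ratio_num :: "real \<Rightarrow> real \<Rightarrow> complex" where
  "ratio_num a b = W g a b * W (tmul 1 g) a b + a * W g a b * Da (W (tmul 1 g)) a b -
      a * W (tmul 1 g) a b * Da (W g) a b"

lemma Da_ratio:
  assumes a: "a > 0" and W: "W g a b \<noteq> 0"
  shows "Da ratio a b = ratio_num a b / (W g a b)\<^sup>2"
proof -
  have d3: "((\<lambda>a. complex_of_real a) has_vector_derivative complex_of_real 1) (at a)"
    by (intro has_vector_derivative_of_real) (auto intro!: derivative_eq_intros)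
  have "((\<lambda>a. a * W (tmul 1 g) a b / W g a b) has_vector_derivative
      ((a * Da (W (tmul 1 g)) a b + complex_of_real 1 * W (tmul 1 g) a b) * W g a b - a * W (tmul 1 g) a b * Da (W g) a b) / (W g a b)\<^sup>2) (at a)"
    by (intro has_vector_derivative_divide_field has_vector_derivative_mult d3 W_has_Da a schwartz_tmul schwartz_g W)
  then have "Da ratio a b = ((a * Da (W (tmul 1 g)) a b + complex_of_real 1 * W (tmul 1 g) a b) * W g a b - a * W (tmul 1 g) a b * Da (W g) a b) / (W g a b)\<^sup>2"
    unfolding Da_def[of ratio] ratio_def by (rule vector_derivative_at)
  then show ?thesis by (simp add: ratio_num_def algebra_simps)
qed

text \<open>Dividing \<open>V_eq\<close> by W gives \<open>\<i> * 2 * pi * \<phi>' k b\<close> plus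
  a scale-independent multiple c of \<open>ratio\<close> plus \<open>Res1\<close> over W.
  Differentiating in a and dividing by \<open>Da ratio\<close> recovers c up to \<open>Res3\<close>,
  and subtracting \<open>ratio\<close> times this value removes the chirp term.\<close>

lemma omega_c_eq:
  assumes a: "a > 0" and W: "W g a b \<noteq> 0" and R: "Da ratio a b \<noteq> 0"
  shows "omega_c a b = \<phi>' k b + Res4 k a b"
proof -
  define N where "N = W g a b"
  define N1 where "N1 = W (tmul 1 g) a b"
  define N3 where "N3 = W (tmul 1 (vderiv g)) a b"
  define s where "s = complex_of_real (deriv \<sigma> b / \<sigma> b)"
  define dN where "dN = Da (W g) a b"
  define dN1 where "dN1 = Da (W (tmul 1 g)) a b"
  define dN3 where "dN3 = Da (W (tmul 1 (vderiv g))) a b"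
  define c where "c = \<i> * 2 * pi * \<phi>'' k b * \<sigma> b"
  define p where "p = \<i> * 2 * pi * \<phi>' k b"
  define dV where "dV = p * dN + c * (N1 + a * dN1) + Res2 k a b"
  have Q: "Da ratio a b = ratio_num a b / N\<^sup>2" using Da_ratio[OF a W] by (simp add: N_def)
  then have Q0: "ratio_num a b \<noteq> 0" using R by auto
  have N0: "N \<noteq> 0" using W by (simp add: N_def)
  note g1 = schwartz_tmul[OF schwartz_g, of 1] and g3 = schwartz_tmul[OF schwartz_vderiv[OF schwartz_g], of 1]
  have d3: "((\<lambda>a. complex_of_real a) has_vector_derivative complex_of_real 1) (at a)"
    by (intro has_vector_derivative_of_real) (auto intro!: derivative_eq_intros)
  have hN: "((\<lambda>a. W g a b) has_vector_derivative dN) (at a)"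
    and hN1: "((\<lambda>a. W (tmul 1 g) a b) has_vector_derivative dN1) (at a)"
    and hN3: "((\<lambda>a. W (tmul 1 (vderiv g)) a b) has_vector_derivative dN3) (at a)"
    unfolding dN_def dN1_def dN3_def by (intro W_has_Da a schwartz_g g1 g3)+
  \<comment> \<open>Stated for all positive scales, because the identity is differentiated in the
    scale.\<close>
  have Veq: "V x b = p * W g x b + c * (x * W (tmul 1 g) x b) + Res1 k x b" if "x > 0" for x
    using V_eq[OF that, of b k] by (simp only: p_def c_def)
  have "((\<lambda>a. p * W g a b + c * (a * W (tmul 1 g) a b) + Res1 k a b) has_vector_derivative
      p * dN + c * (a * dN1 + complex_of_real 1 * N1) + Res2 k a b) (at a)"
    unfolding N1_def
    by (rule has_vector_derivative_add[OF has_vector_derivative_add[OF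
          has_vector_derivative_mult_right[OF hN]
          has_vector_derivative_mult_right[OF has_vector_derivative_mult[OF d3 hN1]]]
          Res1_has_deriv[OF a]])
  then have "((\<lambda>a. V a b) has_vector_derivative
      p * dN + c * (a * dN1 + complex_of_real 1 * N1) + Res2 k a b) (at a)"
    by (rule has_vector_derivative_transform_within_open[where S = "{0<..}"]) (simp_all add: a Veq)
  then have hV: "((\<lambda>a. V a b) has_vector_derivative dV) (at a)"
    by (rule has_vector_derivative_eq_rhs) (simp add: dV_def)
  have hN3N: "((\<lambda>a. W (tmul 1 (vderiv g)) a b / W g a b) has_vector_derivative (dN3 * N - N3 * dN) / N\<^sup>2) (at a)"
    unfolding N_def N3_def by (intro has_vector_derivative_divide_field hN hN3 W)
  have "((\<lambda>a. (V a b - s * (W g a b + W (tmul 1 (vderiv g)) a b)) / W g a b) has_vector_derivative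
      ((dV - s * (dN + dN3)) * N - (V a b - s * (N + N3)) * dN) / N\<^sup>2) (at a)"
    unfolding N_def N3_def
    by (intro has_vector_derivative_divide_field has_vector_derivative_diff has_vector_derivative_add
        has_vector_derivative_mult_right hN hN3 hV W)
  \<comment> \<open>The formula for \<open>Db (W g)\<close> holds on an open set of scales, so the
    mixed derivative is the scale derivative of that formula.\<close>
  then have "((\<lambda>a. Db (W g) a b / W g a b) has_vector_derivative
      ((dV - s * (dN + dN3)) * N - (V a b - s * (N + N3)) * dN) / N\<^sup>2) (at a)"
    by (rule has_vector_derivative_transform_within_open[where S = "{0<..}"])
       (use a in \<open>auto simp: Db_W s_def\<close>)
  then have 1: "Da (\<lambda>a b. Db (W g) a b / W g a b) a b = ((dV - s * (dN + dN3)) * N - (V a b - s * (N + N3)) * dN) / N\<^sup>2"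
    unfolding Da_def by (rule vector_derivative_at)
  have 2: "Da (\<lambda>a b. W (tmul 1 (vderiv g)) a b / W g a b) a b = (dN3 * N - N3 * dN) / N\<^sup>2"
    unfolding Da_def using hN3N by (rule vector_derivative_at)
  have "R0 a b = (dV * N - V a b * dN) / ratio_num a b"
    unfolding R0_def 1 2 Q s_def[symmetric] by (rule R0_algebra[OF Q0 N0])
  \<comment> \<open>The terms with p cancel because \<open>\<phi>' k b\<close> does not depend on
    the scale; those with c combine to the numerator of \<open>Da ratio\<close>.\<close>
  also have "dV * N - V a b * dN = c * ratio_num a b + (N * Res2 k a b - dN * Res1 k a b)"
    unfolding dV_def Veq[OF a] ratio_num_def N_def N1_def dN_def dN1_def by (simp add: algebra_simps)
  also have "\<dots> / ratio_num a b = c + Res3 k a b"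
    using Q0 by (simp add: add_divide_distrib Res3_def ratio_num_def N_def dN_def)
  finally have R0: "R0 a b = c + Res3 k a b" .
  have "omega_c a b = (V a b - a * N1 * (c + Res3 k a b)) / (\<i> * 2 * pi * N)"
    unfolding omega_c_def R0 Db_W[OF a] N_def[symmetric] N1_def[symmetric] N3_def[symmetric] of_real_divide
    by (rule omega_algebra) (use N0 \<sigma>_pos[of b] in auto)
  also have "\<dots> = (p * N + (Res1 k a b - a * N1 * Res3 k a b)) / (\<i> * 2 * pi * N)"
    unfolding Veq[OF a] by (simp add: N_def N1_def algebra_simps)
  also have "\<dots> = \<phi>' k b + Res4 k a b"
    using N0 by (simp add: Res4_def p_def N_def N1_def add_divide_distrib)
  finally show ?thesis .
qed

end

subsection \<open>Residual estimates\<close>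

text \<open>Maclaurin's theorem of order 3 for the function translated to b; 6 is
  \<open>fact 3\<close>.\<close>

lemma taylor_quadratic_remainder:
  fixes f f' f'' f''' :: "real \<Rightarrow> real"
  assumes "\<And>t. (f has_real_derivative f' t) (at t)" "\<And>t. (f' has_real_derivative f'' t) (at t)"
    "\<And>t. (f'' has_real_derivative f''' t) (at t)" "\<And>t. \<bar>f''' t\<bar> \<le> e"
  shows "\<bar>f (b + z) - (f b + f' b * z + 1 / 2 * f'' b * z\<^sup>2)\<bar> \<le> e * \<bar>z\<bar> ^ 3 / 6"
proof -
  define d where "d m = (\<lambda>z. (if m = 0 then f else if m = 1 then f' else if m = 2 then f'' else f''') (b + z))" for m :: nat
  have sh: "((\<lambda>z. F (b + z)) has_real_derivative F' (b + t)) (at t)"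
    if "\<And>t. (F has_real_derivative F' t) (at t)" for F F' t
    using DERIV_shift[of F "F' (b + t)" t b] that[of "b + t"] by (simp add: add.commute)
  have "\<forall>m t. m < 3 \<and> \<bar>t\<bar> \<le> \<bar>z\<bar> \<longrightarrow> (d m has_real_derivative d (Suc m) t) (at t)"
    using sh assms(1-3) by (auto simp: d_def less_Suc_eq numeral_3_eq_3)
  then obtain t where "\<bar>t\<bar> \<le> \<bar>z\<bar>" and
    t: "f (b + z) = (\<Sum>m<3. d m 0 / fact m * z ^ m) + d 3 t / fact 3 * z ^ 3"
    using Maclaurin_bi_le[of d "\<lambda>z. f (b + z)" 3 z] by (auto simp: d_def)
  have "(\<Sum>m<3. d m 0 / fact m * z ^ m) = f b + f' b * z + 1 / 2 * f'' b * z\<^sup>2"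
    by (simp add: d_def eval_nat_numeral)
  then have eq: "f (b + z) - (f b + f' b * z + 1 / 2 * f'' b * z\<^sup>2) = f''' (b + t) * z ^ 3 / 6"
    using t by (simp add: d_def fact_numeral)
  have "\<bar>f''' (b + t)\<bar> * \<bar>z\<bar> ^ 3 \<le> e * \<bar>z\<bar> ^ 3"
    by (intro mult_right_mono assms(4)) auto
  then show ?thesis unfolding eq by (simp add: abs_mult power_abs)
qed

context wsst_setting
begin

lemma K_ge: "K \<ge> 1"
  using sig by (simp add: signal_class_def)

text \<open>Both are forced by the bounds on absolute values of derivatives of component 1, which
  exists because \<open>K \<ge> 1\<close>.\<close>

lemma \<epsilon>_nonneg: "\<epsilon>1 \<ge> 0" "\<epsilon>3 \<ge> 0"
  using K_ge order_trans[OF abs_ge_zero component(9)[of 1 0]] order_trans[OF abs_ge_zero component(10)[of 1 0]]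
  by simp_all

text \<open>The amplitude is exchanged first and the phase second. The mean value inequality gives
  the part with \<open>\<epsilon>1\<close>; the phase error is at most \<open>2 * pi\<close> times
  the cubic Taylor remainder, and \<open>2 * pi / 6\<close> is the \<open>pi / 3\<close> of the
  statement.\<close>

lemma component_residual:
  assumes k: "k \<in> {1..K}"
  shows "cmod (comp k (b + z) - comp k b * chirp k b z) \<le> \<epsilon>1 * \<bar>z\<bar> + pi / 3 * \<epsilon>3 * A k b * \<bar>z\<bar> ^ 3"
proof -
  define p where "p = \<phi> k b + \<phi>' k b * z + 1 / 2 * \<phi>'' k b * z\<^sup>2"
  have chirp: "comp k b * chirp k b z = A k b * cis (2 * pi * p)"
    by (simp add: comp_def chirp_def p_def mult.assoc cis_mult distrib_left add.assoc)
  have eq: "comp k (b + z) - comp k b * chirp k b z =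
      (A k (b + z) - A k b) * cis (2 * pi * \<phi> k (b + z)) + A k b * (cis (2 * pi * \<phi> k (b + z)) - cis (2 * pi * p))"
    unfolding chirp by (simp add: comp_def algebra_simps)
  have b1: "cmod ((A k (b + z) - A k b) * cis (2 * pi * \<phi> k (b + z))) \<le> \<epsilon>1 * \<bar>z\<bar>"
  proof -
    have "norm (A k (b + z) - A k b) \<le> \<epsilon>1 * norm ((b + z) - b)"
      by (rule field_differentiable_bound[where S = UNIV and f' = "deriv (A k)"])
         (use component_DERIV[OF k] component[OF k] in \<open>auto intro: has_field_derivative_at_within\<close>)
    then show ?thesis by (simp add: norm_mult flip: of_real_diff)
  qed
  have b2: "cmod (A k b * (cis (2 * pi * \<phi> k (b + z)) - cis (2 * pi * p))) \<le> pi / 3 * \<epsilon>3 * A k b * \<bar>z\<bar> ^ 3"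
  proof -
    have "cmod (cis (2 * pi * \<phi> k (b + z)) - cis (2 * pi * p)) \<le> \<bar>2 * pi * \<phi> k (b + z) - 2 * pi * p\<bar>"
      by (rule norm_cis_diff_le)
    also have "\<dots> = 2 * pi * \<bar>\<phi> k (b + z) - p\<bar>"
      by (simp add: abs_mult flip: right_diff_distrib)
    also have "\<dots> \<le> 2 * pi * (\<epsilon>3 * \<bar>z\<bar> ^ 3 / 6)"
      unfolding p_def
      by (intro mult_left_mono taylor_quadratic_remainder[where f''' = "deriv (\<phi>'' k)"])
         (use component_DERIV[OF k] component[OF k] in auto)
    finally have "A k b * cmod (cis (2 * pi * \<phi> k (b + z)) - cis (2 * pi * p)) \<le> A k b * (2 * pi * (\<epsilon>3 * \<bar>z\<bar> ^ 3 / 6))"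
      using component(8)[OF k, of b] by (intro mult_left_mono) auto
    then show ?thesis using component(8)[OF k, of b] by (simp add: norm_mult)
  qed
  show ?thesis unfolding eq by (rule norm_triangle_mono[OF b1 b2])
qed

lemma x_r_bound: "cmod (x_r 1 b z) \<le> real K * \<epsilon>1 * \<bar>z\<bar> + pi / 3 * \<epsilon>3 * (\<Sum>k=1..K. A k b) * \<bar>z\<bar> ^ 3"
proof -
  have "x_r 1 b z = (\<Sum>k=1..K. comp k (b + z) - comp k b * chirp k b z)"
    by (simp add: x_r_def signal_def chirp_def sum_subtractf)
  then have "cmod (x_r 1 b z) \<le> (\<Sum>k=1..K. cmod (comp k (b + z) - comp k b * chirp k b z))"
    by (simp add: norm_sum)
  also have "\<dots> \<le> (\<Sum>k=1..K. \<epsilon>1 * \<bar>z\<bar> + pi / 3 * \<epsilon>3 * A k b * \<bar>z\<bar> ^ 3)"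
    by (intro sum_mono component_residual)
  also have "\<dots> = real K * \<epsilon>1 * \<bar>z\<bar> + pi / 3 * \<epsilon>3 * (\<Sum>k=1..K. A k b) * \<bar>z\<bar> ^ 3"
    by (simp add: sum.distrib sum_distrib_left sum_distrib_right mult_ac)
  finally show ?thesis .
qed

text \<open>With \<open>c = a * \<sigma> b\<close> the pointwise bound at \<open>c * y\<close>
  splits into c times the first and \<open>c ^ 3\<close> times the third absolute moment of g.
  Taking out one factor c leaves \<open>Pi0\<close>.\<close>

lemma res_bound:
  assumes a: "a > 0"
  shows "cmod (res g a b) \<le> a * \<sigma> b * Pi0 \<epsilon>1 \<epsilon>3 a b"
proof -
  define c where "c = a * \<sigma> b"
  have c: "c > 0" using a \<sigma>_pos[of b] by (simp add: c_def)
  define S where "S = (\<Sum>k=1..K. A k b)"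
  have int: "integrable lborel (\<lambda>y. cmod (y ^ n * g y))" for n
    using integrable_norm[OF schwartz_integrable[OF schwartz_tmul[OF schwartz_g, of n]]] by (simp add: tmul_def)
  have "cmod (res g a b) \<le> (LINT y|lborel. real K * \<epsilon>1 * c * cmod (complex_of_real y ^ 1 * g y) + pi / 3 * \<epsilon>3 * S * c ^ 3 * cmod (complex_of_real y ^ 3 * g y))"
    unfolding res_osc osc_def
  proof (rule Bochner_Integration.integral_norm_bound_integral)
    show "integrable lborel (\<lambda>y. x_r 1 b (0 + a * \<sigma> b * y) * g y * cis (freq b * y))"
      by (rule osc_integrand_integrable[OF _ schwartz_g]) (use C1_growth_x_r in \<open>auto simp: C1_growth_def\<close>)
    show "integrable lborel (\<lambda>y. real K * \<epsilon>1 * c * cmod (complex_of_real y ^ 1 * g y) + pi / 3 * \<epsilon>3 * S * c ^ 3 * cmod (complex_of_real y ^ 3 * g y))"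
      by (intro Bochner_Integration.integrable_add integrable_mult_right int)
    fix y
    have "cmod (x_r 1 b (c * y)) * cmod (g y) \<le> (real K * \<epsilon>1 * \<bar>c * y\<bar> + pi / 3 * \<epsilon>3 * S * \<bar>c * y\<bar> ^ 3) * cmod (g y)"
      unfolding S_def by (intro mult_right_mono x_r_bound) auto
    then show "norm (x_r 1 b (0 + a * \<sigma> b * y) * g y * cis (freq b * y)) \<le> real K * \<epsilon>1 * c * cmod (complex_of_real y ^ 1 * g y) + pi / 3 * \<epsilon>3 * S * c ^ 3 * cmod (complex_of_real y ^ 3 * g y)"
      using c by (simp add: c_def[symmetric] norm_mult norm_power abs_mult power_mult_distrib algebra_simps)
  qed
  also have "\<dots> = real K * \<epsilon>1 * c * I 1 + pi / 3 * \<epsilon>3 * S * c ^ 3 * I 3"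
    unfolding I_def
    by (simp only: Bochner_Integration.integral_add[OF integrable_mult_right[OF int] integrable_mult_right[OF int]]
        integral_mult_right_zero)
  also have "\<dots> = a * \<sigma> b * Pi0 \<epsilon>1 \<epsilon>3 a b"
    by (simp add: Pi0_def c_def S_def eval_nat_numeral algebra_simps)
  finally show ?thesis .
qed

lemma I_nonneg: "I n \<ge> 0"
  by (simp add: I_def)

lemma A_sum_nonneg: "0 \<le> (\<Sum>k\<in>X. A k b)" if "X \<subseteq> {1..K}"
  using component(8) that by (intro sum_nonneg less_imp_le) auto

lemma Pi0_mono:
  assumes "0 \<le> a" "a \<le> c"
  shows "0 \<le> Pi0 \<epsilon>1 \<epsilon>3 a b" "Pi0 \<epsilon>1 \<epsilon>3 a b \<le> Pi0 \<epsilon>1 \<epsilon>3 c b"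
proof -
  show "0 \<le> Pi0 \<epsilon>1 \<epsilon>3 a b"
    unfolding Pi0_def using \<epsilon>_nonneg I_nonneg A_sum_nonneg by (intro add_nonneg_nonneg mult_nonneg_nonneg) auto
  have "a\<^sup>2 \<le> c\<^sup>2" using assms by (intro power_mono) auto
  then show "Pi0 \<epsilon>1 \<epsilon>3 a b \<le> Pi0 \<epsilon>1 \<epsilon>3 c b"
    unfolding Pi0_def using \<epsilon>_nonneg I_nonneg A_sum_nonneg
    by (intro add_left_mono mult_right_mono mult_left_mono mult_nonneg_nonneg) auto
qed

lemma W_g_bound: "cmod (W g a b) \<le> (\<Sum>k=1..K. A k b * cmod (G 0 k a b)) + cmod (res g a b)"
proof -
  have "cmod (\<Sum>k=1..K. comp k b * G 0 k a b) \<le> (\<Sum>k=1..K. cmod (comp k b * G 0 k a b))"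
    by (rule norm_sum)
  also have "\<dots> = (\<Sum>k=1..K. A k b * cmod (G 0 k a b))"
    by (intro sum.cong refl) (auto simp: norm_mult norm_comp)
  finally show ?thesis unfolding W_g_eq by (intro norm_triangle_mono) auto
qed

text \<open>Outside all zones each \<open>G 0 k\<close> is at most \<open>\<tau>0\<close> in
  modulus, so W is bounded by \<open>threshold\<close>; the residual bound increases with a and may
  be evaluated at \<open>a2 b\<close>.\<close>

lemma zones_cover:
  assumes thr: "\<delta>1 \<ge> threshold \<tau>0 \<epsilon>1 \<epsilon>3 b" and a: "0 < a" "a \<le> a2 b" and W: "cmod (W g a b) > \<delta>1"
  shows "\<exists>k\<in>{1..K}. (a, b) \<in> zone k"
proof (rule ccontr)
  assume *: "\<not> ?thesis"
  have G: "cmod (G 0 k a b) \<le> \<tau>0" if "k \<in> {1..K}" for k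
    using sig * that a(1) unfolding signal_class_def by blast
  have "cmod (W g a b) \<le> (\<Sum>k=1..K. A k b * cmod (G 0 k a b)) + cmod (res g a b)"
    by (rule W_g_bound)
  also have "\<dots> \<le> (\<Sum>k=1..K. A k b * \<tau>0) + a2 b * \<sigma> b * Pi0 \<epsilon>1 \<epsilon>3 (a2 b) b"
  proof (intro add_mono sum_mono mult_left_mono G)
    have "cmod (res g a b) \<le> a * \<sigma> b * Pi0 \<epsilon>1 \<epsilon>3 a b" by (rule res_bound[OF a(1)])
    also have "\<dots> \<le> a2 b * \<sigma> b * Pi0 \<epsilon>1 \<epsilon>3 (a2 b) b"
      using a \<sigma>_pos[of b] Pi0_mono[of a "a2 b" b] by (intro mult_mono) auto
    finally show "cmod (res g a b) \<le> a2 b * \<sigma> b * Pi0 \<epsilon>1 \<epsilon>3 (a2 b) b" .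
  qed (use component(8) less_imp_le in auto)
  also have "\<dots> = threshold \<tau>0 \<epsilon>1 \<epsilon>3 b"
    by (simp add: threshold_def sum_distrib_left mult.commute)
  finally show False using thr W by linarith
qed

section \<open>Continuity in the scale and the frequency error\<close>

lemma continuous_at_vector_derivative:
  "(\<And>a. a > 0 \<Longrightarrow> (f has_vector_derivative f' a) (at a)) \<Longrightarrow> continuous_on {0<..} f"
  by (auto intro!: continuous_at_imp_continuous_on intro: has_vector_derivative_continuous)

lemma continuous_on_W: "schwartz w \<Longrightarrow> continuous_on {0<..} (\<lambda>a. W w a b)"
  by (rule continuous_at_vector_derivative[OF W_has_deriv])

lemma continuous_on_res: "schwartz w \<Longrightarrow> continuous_on {0<..} (\<lambda>a. res w a b)"
  by (rule continuous_at_vector_derivative[OF res_has_deriv])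

lemma continuous_on_G: "continuous_on X (\<lambda>a. G j k a b)"
  by (intro continuous_at_imp_continuous_on ballI has_vector_derivative_continuous[OF G_has_deriv])

lemma continuous_on_Da_W:
  assumes w: "schwartz w"
  shows "continuous_on {0<..} (\<lambda>a. Da (W w) a b)"
proof -
  have "continuous_on {0<..} (\<lambda>a. - (W w a b + W (tmul 1 (vderiv w)) a b - \<i> * (2 * pi * \<mu> * \<sigma> b) * W (tmul 1 w) a b) / a)"
    by (intro continuous_intros continuous_on_W w schwartz_tmul schwartz_vderiv) auto
  moreover have "- (W w a b + W (tmul 1 (vderiv w)) a b - \<i> * (2 * pi * \<mu> * \<sigma> b) * W (tmul 1 w) a b) / a = Da (W w) a b"
    if "a > 0" for a
    unfolding Da_def by (rule vector_derivative_at[symmetric], rule W_has_deriv[OF w that])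
  ultimately show ?thesis
    by (rule continuous_on_eq) simp
qed

lemma continuous_on_Res1: "continuous_on {0<..} (\<lambda>a. Res1 k a b)"
  by (rule continuous_at_vector_derivative[OF Res1_has_deriv])

lemma continuous_on_Res2: "continuous_on {0<..} (\<lambda>a. Res2 k a b)"
  unfolding Res2_def B_def D_def E_def F_def
  by (intro continuous_intros continuous_on_G continuous_on_res schwartz_tmul schwartz_vderiv schwartz_g)
     (use \<sigma>_pos[of b] in auto)

lemma continuous_on_ratio_num: "continuous_on {0<..} (\<lambda>a. ratio_num a b)"
  unfolding ratio_num_def
  by (intro continuous_intros continuous_on_W continuous_on_Da_W schwartz_tmul schwartz_g)

definition bound_at :: "real \<Rightarrow> real \<Rightarrow> nat \<Rightarrow> real \<Rightarrow> real \<Rightarrow> real" where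
  "bound_at \<delta>1 \<delta>2 k a b = cmod (Res1 k a b) / (2 * pi * \<delta>1) +
     1 / (2 * pi * \<delta>1 ^ 3 * \<delta>2) * a * cmod (W (tmul 1 g) a b) *
       (\<delta>1 * cmod (Res2 k a b) + cmod (Da (W g) a b) * cmod (Res1 k a b))"

lemma l_u_pos: "k \<in> {1..K} \<Longrightarrow> 0 < l k b" "k \<in> {1..K} \<Longrightarrow> l k b < u k b"
  using sig unfolding signal_class_def by blast+

lemma bound_at_le_Bd:
  assumes k: "k \<in> {1..K}" and a: "(a, b) \<in> zone k" and \<delta>: "\<delta>1 > 0" "\<delta>2 > 0"
  shows "bound_at \<delta>1 \<delta>2 k a b \<le> Bd \<delta>1 \<delta>2 k b"
proof -
  have "continuous_on {0<..} (\<lambda>a. bound_at \<delta>1 \<delta>2 k a b)"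
    unfolding bound_at_def
    by (intro continuous_intros continuous_on_Res1 continuous_on_Res2 continuous_on_W continuous_on_Da_W
        schwartz_g schwartz_tmul) (use \<delta> in auto)
  then have "continuous_on {l k b..u k b} (\<lambda>a. bound_at \<delta>1 \<delta>2 k a b)"
    by (rule continuous_on_subset) (use l_u_pos[OF k, of b] in auto)
  then have "compact ((\<lambda>a. bound_at \<delta>1 \<delta>2 k a b) ` {l k b..u k b})"
    by (rule compact_continuous_image) auto
  then have "bdd_above ((\<lambda>a. bound_at \<delta>1 \<delta>2 k a b) ` {l k b..u k b})"
    by (intro bounded_imp_bdd_above compact_imp_bounded)
  then have "bdd_above ((\<lambda>a. bound_at \<delta>1 \<delta>2 k a b) ` {l k b<..<u k b})"
    by (rule bdd_above_mono) auto
  then show ?thesis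
    unfolding Bd_def bound_at_def[symmetric] using a by (intro cSUP_upper) (auto simp: zone_def)
qed

text \<open>\<open>Res3\<close> is bounded through its denominator, whose modulus exceeds
  \<open>\<delta>2 * (cmod (W g a b))\<^sup>2\<close>. Inside, W is then replaced by
  \<open>\<delta>1\<close>, but one quotient \<open>\<delta>1 / cmod (W g a b)\<close> is kept in
  front: it is less than 1 and supplies strictness later.\<close>

lemma Res4_bound:
  assumes a: "a > 0" and \<delta>: "\<delta>1 > 0" "\<delta>2 > 0"
    and W: "cmod (W g a b) > \<delta>1" and R: "cmod (Da ratio a b) > \<delta>2"
  shows "cmod (Res4 k a b) \<le> \<delta>1 / cmod (W g a b) * bound_at \<delta>1 \<delta>2 k a b"
proof -
  define w where "w = cmod (W g a b)"
  define p where "p = cmod (Res1 k a b)"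
  define q where "q = a * cmod (W (tmul 1 g) a b)"
  define r where "r = cmod (Res2 k a b)"
  define d where "d = cmod (Da (W g) a b)"
  have w: "w > \<delta>1" "w > 0" using W \<delta> by (auto simp: w_def)
  have nn: "p \<ge> 0" "q \<ge> 0" "r \<ge> 0" "d \<ge> 0" using a by (auto simp: p_def q_def r_def d_def)
  have W0: "W g a b \<noteq> 0" using w by (auto simp: w_def)
  have "cmod (ratio_num a b) / w\<^sup>2 > \<delta>2"
    using R Da_ratio[OF a W0] by (simp add: w_def norm_divide norm_power)
  then have Q: "cmod (ratio_num a b) > \<delta>2 * w\<^sup>2" using w(2) by (simp add: pos_less_divide_eq)
  have "cmod (Res3 k a b) \<le> (w * r + d * p) / (\<delta>2 * w\<^sup>2)"
    unfolding Res3_def ratio_num_def[symmetric] norm_divide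
  proof (rule frac_le)
    show "cmod (W g a b * Res2 k a b - Da (W g) a b * Res1 k a b) \<le> w * r + d * p"
      by (rule order_trans[OF norm_triangle_ineq4]) (simp add: norm_mult w_def r_def d_def p_def)
  qed (use Q w \<delta> nn in auto)
  then have "q * cmod (Res3 k a b) \<le> q * ((w * r + d * p) / (\<delta>2 * w\<^sup>2))"
    using nn by (intro mult_left_mono)
  moreover have "cmod (Res4 k a b) \<le> (p + q * cmod (Res3 k a b)) / (2 * pi * w)"
  proof -
    have "cmod (Res1 k a b - a * W (tmul 1 g) a b * Res3 k a b) \<le> p + q * cmod (Res3 k a b)"
      by (rule order_trans[OF norm_triangle_ineq4]) (use a in \<open>simp add: norm_mult p_def q_def\<close>)
    then show ?thesis using w(2) by (simp add: Res4_def norm_mult norm_divide w_def divide_right_mono)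
  qed
  ultimately have "cmod (Res4 k a b) \<le> (p + q * ((w * r + d * p) / (\<delta>2 * w\<^sup>2))) / (2 * pi * w)"
    using w(2) by (elim order_trans) (intro divide_right_mono, auto)
  also have "\<dots> = (p + q / \<delta>2 * (r / w + d * p / w\<^sup>2)) / (2 * pi * w)"
    using w \<delta> by (simp add: field_simps power2_eq_square)
  also have "\<dots> \<le> (p + q / \<delta>2 * (r / \<delta>1 + d * p / \<delta>1\<^sup>2)) / (2 * pi * w)"
    using w \<delta> nn by (intro divide_right_mono add_left_mono mult_left_mono add_mono divide_left_mono power_mono mult_pos_pos) auto
  also have "\<dots> = \<delta>1 / w * (p / (2 * pi * \<delta>1) + 1 / (2 * pi * \<delta>1 ^ 3 * \<delta>2) * q * (\<delta>1 * r + d * p))"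
    using w \<delta> by (simp add: field_simps power2_eq_square power3_eq_cube)
  finally show ?thesis
    unfolding bound_at_def w_def p_def q_def r_def d_def by (simp add: mult.assoc)
qed

text \<open>The factor left in front by \<open>Res4_bound\<close> makes the estimate strict unless
  \<open>bound_at\<close> vanishes at this scale. In that case the error is 0, and the second
  alternative remains if the supremum is 0 too.\<close>

lemma omega_error:
  assumes k: "k \<in> {1..K}" and a: "(a, b) \<in> zone k" and \<delta>: "\<delta>1 > 0" "\<delta>2 > 0"
    and W: "cmod (W g a b) > \<delta>1" and R: "cmod (Da ratio a b) > \<delta>2"
  shows "omega_c a b - \<phi>' k b = Res4 k a b"
    and "\<bar>omega a b - \<phi>' k b\<bar> < Bd \<delta>1 \<delta>2 k b \<or> \<bar>omega a b - \<phi>' k b\<bar> = 0 \<and> Bd \<delta>1 \<delta>2 k b = 0"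
proof -
  have a0: "a > 0" using a l_u_pos(1)[OF k, of b] by (auto simp: zone_def)
  have nz: "W g a b \<noteq> 0" "Da ratio a b \<noteq> 0" using W R \<delta> by auto
  show 1: "omega_c a b - \<phi>' k b = Res4 k a b"
    using omega_c_eq[OF a0 nz, of k] by simp
  define v where "v = bound_at \<delta>1 \<delta>2 k a b"
  have "omega a b - \<phi>' k b = Re (Res4 k a b)" by (simp add: omega_def flip: 1)
  then have "\<bar>omega a b - \<phi>' k b\<bar> \<le> cmod (Res4 k a b)" using abs_Re_le_cmod by simp
  also have "\<dots> \<le> \<delta>1 / cmod (W g a b) * v" unfolding v_def by (rule Res4_bound[OF a0 \<delta> W R])
  finally have e: "\<bar>omega a b - \<phi>' k b\<bar> \<le> \<delta>1 / cmod (W g a b) * v" .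
  have v: "v \<ge> 0" unfolding v_def bound_at_def using a0 \<delta> by (intro add_nonneg_nonneg mult_nonneg_nonneg) auto
  have vB: "v \<le> Bd \<delta>1 \<delta>2 k b" unfolding v_def by (rule bound_at_le_Bd[OF k a \<delta>])
  have t: "\<delta>1 / cmod (W g a b) < 1" using W \<delta> by (simp add: divide_less_eq)
  show "\<bar>omega a b - \<phi>' k b\<bar> < Bd \<delta>1 \<delta>2 k b \<or> \<bar>omega a b - \<phi>' k b\<bar> = 0 \<and> Bd \<delta>1 \<delta>2 k b = 0"
  proof (cases "v = 0")
    case True
    then show ?thesis using e vB by auto
  next
    case False
    then have "\<delta>1 / cmod (W g a b) * v < 1 * v" using v t by (intro mult_strict_right_mono) auto
    then show ?thesis using e vB by linarith
  qed
qed

end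

subsection \<open>Reconstruction\<close>

lemma integrable_compact_support:
  fixes h :: "real \<Rightarrow> complex"
  assumes h: "continuous_on UNIV h" and c: "compact (closure {x. h x \<noteq> 0})"
  shows "integrable lborel h" "bounded (range h)"
proof -
  have e: "(\<lambda>x. indicator (closure {x. h x \<noteq> 0}) x *\<^sub>R h x) = h"
    using closure_subset[of "{x. h x \<noteq> 0}"] by (auto simp: fun_eq_iff indicator_def)
  have hc: "continuous_on (closure {x. h x \<noteq> 0}) h"
    using h by (rule continuous_on_subset) simp
  show "integrable lborel h"
    using borel_integrable_compact[OF c hc] by (simp only: e)
  have "bounded (insert 0 (h ` closure {x. h x \<noteq> 0}))"
    using compact_imp_bounded[OF compact_continuous_image[OF hc c]] by simp
  then show "bounded (range h)"
    by (rule bounded_subset) (use closure_subset[of "{x. h x \<noteq> 0}"] in auto)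
qed

text \<open>Exchanging the integrals produces the weight \<open>q s a\<close>, the part of the
  integral of h, scaled to width s and centred at \<open>w a\<close>, that falls into the interval
  around c. On P the centre lies in the open interval, on \<open>S - P\<close> in the open exterior,
  so the weight tends to 1 or 0.\<close>

lemma approximate_identity_limit:
  fixes v h :: "real \<Rightarrow> complex" and w :: "real \<Rightarrow> real"
  assumes h: "integrable lborel h" "bounded (range h)" "(LINT x|lborel. h x) = 1"
    and S: "S \<in> sets borel" "emeasure lborel S < \<infinity>"
    and v [measurable]: "v \<in> borel_measurable borel" and vb: "\<And>a. a \<in> S \<Longrightarrow> cmod (v a) \<le> C"
    and w [measurable]: "w \<in> borel_measurable borel"
    and P: "P \<in> sets borel" "P \<subseteq> S"
    and inside: "\<And>a. a \<in> P \<Longrightarrow> \<bar>w a - c\<bar> < d"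
    and outside: "\<And>a. a \<in> S - P \<Longrightarrow> \<bar>w a - c\<bar> > d"
  shows "((\<lambda>s. LINT \<xi>:{\<xi>. \<bar>\<xi> - c\<bar> < d}|lborel. LINT a:S|lborel. v a * (complex_of_real (1 / s) * h ((\<xi> - w a) / s)))
     \<longlongrightarrow> (LINT a:P|lborel. v a)) (at_right 0)"
proof -
  define J where "J = {\<xi>. \<bar>\<xi> - c\<bar> < d}"
  have Jeq: "J = {c - d<..<c + d}" by (auto simp: J_def abs_less_iff)
  have Jopen: "open J" and Jm [measurable]: "J \<in> sets borel" by (simp_all add: Jeq)
  note [measurable] = S(1) P(1)
  have hm [measurable]: "h \<in> borel_measurable borel" using h(1) by auto
  obtain H where H: "\<And>x. cmod (h x) \<le> H" using h(2) by (auto simp: bounded_iff)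
  have H0: "H \<ge> 0" using order_trans[OF norm_ge_zero H[of 0]] .
  define C' where "C' = \<bar>C\<bar>"
  have vb': "cmod (v a) \<le> C'" "C' \<ge> 0" if "a \<in> S" for a using vb[OF that] by (auto simp: C'_def)
  define q where "q s a = (LINT y|lborel. indicator J (w a + s * y) *\<^sub>R h y)" for s a
  have qm [measurable]: "q s \<in> borel_measurable borel" for s
    unfolding q_def by measurable
  have qb: "cmod (q s a) \<le> (LINT y|lborel. cmod (h y))" for s a
  proof -
    have "cmod (q s a) \<le> (LINT y|lborel. cmod (indicator J (w a + s * y) *\<^sub>R h y))"
      unfolding q_def by (rule integral_norm_bound)
    also have "\<dots> \<le> (LINT y|lborel. cmod (h y))"
    proof (rule integral_mono)
      show "integrable lborel (\<lambda>y. cmod (indicator J (w a + s * y) *\<^sub>R h y))"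
        by (rule Bochner_Integration.integrable_bound[OF h(1)]) (auto simp: indicator_def)
    qed (use h(1) in \<open>auto simp: indicator_def\<close>)
    finally show ?thesis .
  qed
  \<comment> \<open>For fixed s the integrand is bounded by a constant on
    \<open>J \<times> S\<close>, a set of finite measure. The constant blows up like
    \<open>1 / s\<close>, so it serves Fubini only; the limit has its own majorant, with the L1 norm
    of h.\<close>
  have fub: "(LINT \<xi>:J|lborel. LINT a:S|lborel. v a * (complex_of_real (1 / s) * h ((\<xi> - w a) / s))) =
      (LINT a|lborel. indicator S a *\<^sub>R (v a * q s a))" if s: "s > 0" for s
  proof -
    let ?f = "\<lambda>\<xi> a. indicator J \<xi> *\<^sub>R (indicator S a *\<^sub>R (v a * (complex_of_real (1 / s) * h ((\<xi> - w a) / s))))"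
    have "integrable (lborel \<Otimes>\<^sub>M lborel) (\<lambda>(\<xi>, a). ?f \<xi> a)"
    proof (rule Bochner_Integration.integrable_bound)
      have "emeasure (lborel \<Otimes>\<^sub>M lborel) (J \<times> S) = emeasure lborel J * emeasure lborel S"
        by (rule lborel.emeasure_pair_measure_Times) auto
      also have "\<dots> < \<infinity>"
        using S(2) emeasure_bounded_finite[of J] by (auto simp: Jeq ennreal_mult_less_top)
      finally show "integrable (lborel \<Otimes>\<^sub>M lborel) (\<lambda>z. (C' * (1 / s * H)) * indicator (J \<times> S) z)"
        by (intro integrable_mult_right integrable_real_indicator) auto
      show "(\<lambda>(\<xi>, a). ?f \<xi> a) \<in> borel_measurable (lborel \<Otimes>\<^sub>M lborel)" by measurable
      have "cmod (v a * (complex_of_real (1 / s) * h ((\<xi> - w a) / s))) \<le> C' * (1 / s * H)" if "a \<in> S" for \<xi> a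
        unfolding norm_mult using vb'[OF that] H H0 s
        by (intro mult_mono mult_nonneg_nonneg) (auto simp: norm_divide)
      then have *: "norm (v a * (complex_of_real (1 / s) * h ((\<xi> - w a) / s))) \<le> norm (C' * (1 / s * H))" if "a \<in> S" for \<xi> a
        using that unfolding real_norm_def by (meson abs_ge_self order_trans)
      show "AE z in lborel \<Otimes>\<^sub>M lborel. norm (case z of (\<xi>, a) \<Rightarrow> ?f \<xi> a) \<le> norm (C' * (1 / s * H) * indicator (J \<times> S) z)"
      proof (rule AE_I2)
        fix z :: "real \<times> real"
        obtain \<xi> a where z: "z = (\<xi>, a)" by fastforce
        show "norm (case z of (\<xi>, a) \<Rightarrow> ?f \<xi> a) \<le> norm (C' * (1 / s * H) * indicator (J \<times> S) z)"
          using * by (cases "\<xi> \<in> J"; cases "a \<in> S"; simp add: z)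
      qed
    qed
    then have f1: "(LINT a|lborel. LINT \<xi>|lborel. ?f \<xi> a) = (LINT \<xi>|lborel. LINT a|lborel. ?f \<xi> a)"
      by (rule lborel_pair.Fubini_integral)
    have f2: "(LINT \<xi>|lborel. ?f \<xi> a) = indicator S a *\<^sub>R (v a * q s a)" for a
    proof -
      have "(LINT \<xi>|lborel. indicator J \<xi> *\<^sub>R (complex_of_real (1 / s) * h ((\<xi> - w a) / s))) =
        \<bar>s\<bar> *\<^sub>R (LINT y|lborel. indicator J (w a + s * y) *\<^sub>R (complex_of_real (1 / s) * h ((w a + s * y - w a) / s)))"
        by (rule lborel_integral_real_affine) (use s in auto)
      also have "\<dots> = (LINT y|lborel. \<bar>s\<bar> *\<^sub>R (indicator J (w a + s * y) *\<^sub>R (complex_of_real (1 / s) * h ((w a + s * y - w a) / s))))"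
        by (rule integral_scaleR_right[symmetric])
      also have "\<dots> = q s a"
        unfolding q_def by (rule Bochner_Integration.integral_cong) (use s in \<open>auto simp: scaleR_conv_of_real\<close>)
      finally have *: "(LINT \<xi>|lborel. indicator J \<xi> *\<^sub>R (complex_of_real (1 / s) * h ((\<xi> - w a) / s))) = q s a" .
      have "(LINT \<xi>|lborel. ?f \<xi> a) = (LINT \<xi>|lborel. (indicator S a *\<^sub>R v a) * (indicator J \<xi> *\<^sub>R (complex_of_real (1 / s) * h ((\<xi> - w a) / s))))"
        by (rule Bochner_Integration.integral_cong) (auto simp: indicator_def)
      also have "\<dots> = (indicator S a *\<^sub>R v a) * q s a"
        by (simp only: integral_mult_right_zero *)
      finally show ?thesis by simp
    qed
    have f3: "(LINT a|lborel. ?f \<xi> a) = indicator J \<xi> *\<^sub>R (LINT a:S|lborel. v a * (complex_of_real (1 / s) * h ((\<xi> - w a) / s)))" for \<xi>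
      unfolding set_lebesgue_integral_def by (rule integral_scaleR_right)
    show ?thesis using f1 unfolding f2 f3 by (simp only: set_lebesgue_integral_def)
  qed
  have qlim: "(\<lambda>n. q (X n) a) \<longlonglongrightarrow> indicator P a" if X: "X \<longlonglongrightarrow> 0" and a: "a \<in> S" for X a
  proof -
    have "(\<lambda>n. q (X n) a) \<longlonglongrightarrow> (LINT y|lborel. indicator P a *\<^sub>R h y)"
      unfolding q_def
    proof (rule integral_dominated_convergence[where w = "\<lambda>y. cmod (h y)"])
      show "AE y in lborel. (\<lambda>n. indicator J (w a + X n * y) *\<^sub>R h y) \<longlonglongrightarrow> indicator P a *\<^sub>R h y"
      proof (rule AE_I2)
        \<comment> \<open>For fixed y the indicator is eventually constant, as \<open>w a\<close>
          lies in an open set on which it is constant.\<close>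
        fix y
        have lim: "(\<lambda>n. w a + X n * y) \<longlonglongrightarrow> w a"
          using tendsto_add[OF tendsto_const tendsto_mult_left_zero[OF X], of "w a" y] by simp
        have "\<forall>\<^sub>F n in sequentially. indicator J (w a + X n * y) *\<^sub>R h y = indicator P a *\<^sub>R h y"
        proof (cases "a \<in> P")
          case True
          then have "w a \<in> J" using inside by (auto simp: J_def)
          from topological_tendstoD[OF lim Jopen this] show ?thesis
            by eventually_elim (use True in auto)
        next
          case False
          then have "w a \<in> {x. \<bar>x - c\<bar> > d}" using outside a by auto
          moreover have "open {x. \<bar>x - c\<bar> > d}" by (intro open_Collect_less continuous_intros)
          ultimately have "\<forall>\<^sub>F n in sequentially. w a + X n * y \<in> {x. \<bar>x - c\<bar> > d}"
            using topological_tendstoD[OF lim] by blast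
          then show ?thesis by eventually_elim (use False in \<open>auto simp: J_def\<close>)
        qed
        then show "(\<lambda>n. indicator J (w a + X n * y) *\<^sub>R h y) \<longlonglongrightarrow> indicator P a *\<^sub>R h y"
          by (rule tendsto_eventually)
      qed
    qed (use h(1) in \<open>auto simp: indicator_def\<close>)
    also have "(LINT y|lborel. indicator P a *\<^sub>R h y) = indicator P a"
      using h(3) by (simp add: indicator_def)
    finally show ?thesis .
  qed
  have "((\<lambda>s. LINT a|lborel. indicator S a *\<^sub>R (v a * q s a)) \<longlongrightarrow> (LINT a:P|lborel. v a)) (at_right 0)"
    unfolding tendsto_at_iff_sequentially comp_def
  proof (intro allI impI)
    fix X assume X: "\<forall>i. X i \<in> {0<..} - {0::real}" "X \<longlonglongrightarrow> 0"
    have "(\<lambda>n. LINT a|lborel. indicator S a *\<^sub>R (v a * q (X n) a)) \<longlonglongrightarrow> (LINT a|lborel. indicator P a *\<^sub>R v a)"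
    proof (rule integral_dominated_convergence[where w = "\<lambda>a. (C' * (LINT y|lborel. cmod (h y))) * indicator S a"])
      show "integrable lborel (\<lambda>a. (C' * (LINT y|lborel. cmod (h y))) * indicator S a)"
        using S by (intro integrable_mult_right integrable_real_indicator) auto
      show "AE a in lborel. (\<lambda>n. indicator S a *\<^sub>R (v a * q (X n) a)) \<longlonglongrightarrow> indicator P a *\<^sub>R v a"
      proof (rule AE_I2)
        fix a
        show "(\<lambda>n. indicator S a *\<^sub>R (v a * q (X n) a)) \<longlonglongrightarrow> indicator P a *\<^sub>R v a"
        proof (cases "a \<in> S")
          case True
          have "(\<lambda>n. v a * q (X n) a) \<longlonglongrightarrow> v a * indicator P a"
            by (intro tendsto_mult_left qlim X(2) True)
          with True show ?thesis by (auto simp: indicator_def split: if_splits)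
        next
          case False
          with P(2) have "a \<notin> P" by auto
          with False show ?thesis by simp
        qed
      qed
      show "AE a in lborel. norm (indicator S a *\<^sub>R (v a * q (X n) a)) \<le> (C' * (LINT y|lborel. cmod (h y))) * indicator S a" for n
        using vb' qb by (intro AE_I2) (auto simp: indicator_def norm_mult intro!: mult_mono)
    qed auto
    then show "(\<lambda>n. LINT a|lborel. indicator S a *\<^sub>R (v a * q (X n) a)) \<longlonglongrightarrow> (LINT a:P|lborel. v a)"
      by (simp add: set_lebesgue_integral_def)
  qed
  then show ?thesis
    unfolding J_def[symmetric]
  proof (rule Lim_transform_eventually)
    show "\<forall>\<^sub>F s in at_right 0. (LINT a|lborel. indicator S a *\<^sub>R (v a * q s a)) =
        (LINT \<xi>:J|lborel. LINT a:S|lborel. v a * (complex_of_real (1 / s) * h ((\<xi> - w a) / s)))"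
      unfolding eventually_at_filter
      by (intro always_eventually allI impI fub[symmetric]) simp
  qed
qed

section \<open>Integrals over intervals of scales\<close>

lemma set_integral_Icc_Ioo:
  fixes f :: "real \<Rightarrow> 'a::{banach, second_countable_topology}"
  shows "(LINT x:{a..b}|lborel. f x) = (LINT x:{a<..<b}|lborel. f x)"
  by (rule set_integral_discrete_difference[where X = "{a, b}"]) auto

lemma continuous_set_integrable_Icc:
  fixes f :: "real \<Rightarrow> 'a::{banach, second_countable_topology}"
  shows "continuous_on {a..b} f \<Longrightarrow> set_integrable lborel {a..b} f"
  unfolding set_integrable_def by (rule borel_integrable_compact) auto

lemma set_integral_sum:
  fixes f :: "'i \<Rightarrow> 'a \<Rightarrow> 'b::{banach, second_countable_topology}"
  assumes "\<And>i. set_integrable M S (f i)"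
  shows "(LINT x:S|M. (\<Sum>i\<in>X. f i x)) = (\<Sum>i\<in>X. LINT x:S|M. f i x)"
  using assms by (simp add: set_lebesgue_integral_def set_integrable_def scaleR_sum_right)

lemma set_integrable_sum:
  fixes f :: "'i \<Rightarrow> 'a \<Rightarrow> 'b::{banach, second_countable_topology}"
  assumes "\<And>i. set_integrable M S (f i)"
  shows "set_integrable M S (\<lambda>x. \<Sum>i\<in>X. f i x)"
  using assms by (simp add: set_integrable_def scaleR_sum_right)

lemma set_integral_Ioo_FTC:
  fixes F f :: "real \<Rightarrow> real"
  assumes "a \<le> b" "\<And>x. a \<le> x \<Longrightarrow> x \<le> b \<Longrightarrow> (F has_real_derivative f x) (at x)"
    "\<And>x. a \<le> x \<Longrightarrow> x \<le> b \<Longrightarrow> isCont f x"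
  shows "(LINT x:{a<..<b}|lborel. f x) = F b - F a"
  using integral_FTC_Icc_real[OF assms] unfolding set_integral_Icc_Ioo[symmetric]
  by (simp add: set_lebesgue_integral_def mult.commute)

section \<open>Order of the zones, frequency gaps, and the error of the limiting integral\<close>

context wsst_setting
begin

text \<open>Each step passes through \<open>u (Suc n) b \<le> l n b\<close>: a component of higher
  frequency sits at smaller scales. Hence all zones lie between \<open>l K b\<close> and
  \<open>u 1 b\<close>.\<close>

lemma zone_bounds_antimono:
  assumes "i \<in> {1..K}" "j \<in> {i..K}"
  shows "l j b \<le> l i b" "u j b \<le> u i b"
proof -
  have "i \<le> j" using assms by simp
  then have "j \<le> K \<longrightarrow> l j b \<le> l i b \<and> u j b \<le> u i b"
  proof (induction j rule: dec_induct)
    case (step n)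
    have "Suc n \<le> K \<longrightarrow> u (Suc n) b \<le> l n b"
    proof
      assume "Suc n \<le> K"
      then have "Suc n \<in> {2..K}" using step(1) assms(1) by auto
      then have "u (Suc n) b \<le> l (Suc n - 1) b" using sig unfolding signal_class_def by blast
      then show "u (Suc n) b \<le> l n b" by simp
    qed
    moreover have "Suc n \<le> K \<longrightarrow> l (Suc n) b < u (Suc n) b" "Suc n \<le> K \<longrightarrow> l n b < u n b"
      using l_u_pos(2) step(1) assms(1) by auto
    ultimately show ?case using step.IH by auto
  qed auto
  with assms show "l j b \<le> l i b" "u j b \<le> u i b" by auto
qed

lemma phase_derivative_mono:
  assumes "i \<in> {1..K}" "j \<in> {i..K}"
  shows "\<phi>' i b \<le> \<phi>' j b"
proof -
  have "i \<le> j" using assms by simp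
  then have "j \<le> K \<longrightarrow> \<phi>' i b \<le> \<phi>' j b"
  proof (induction j rule: dec_induct)
    case (step n)
    have "Suc n \<le> K \<longrightarrow> \<phi>' n b < \<phi>' (Suc n) b"
    proof
      assume "Suc n \<le> K"
      then have "Suc n \<in> {2..K}" using step(1) assms(1) by auto
      then have "\<phi>' (Suc n - 1) b < \<phi>' (Suc n) b" using sig unfolding signal_class_def by blast
      then show "\<phi>' n b < \<phi>' (Suc n) b" by simp
    qed
    then show ?case using step.IH by auto
  qed auto
  with assms show ?thesis by auto
qed

text \<open>\<open>L\<close> sees only the two neighbouring gaps; since the frequencies increase
  with the index, the neighbour on the side of j is at least as close to k as j is. That neighbour
  exists because j itself lies on its side.\<close>

lemma L_half_le_gap:
  assumes k: "k \<in> {1..K}" and j: "j \<in> {1..K}" "j \<noteq> k" and d: "ereal d \<le> L k b / 2"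
  shows "2 * d \<le> \<bar>\<phi>' j b - \<phi>' k b\<bar>"
proof -
  have *: "2 * d \<le> \<phi>' (i + 1) b - \<phi>' i b" if "i \<in> {k - 1, k} \<inter> {1..<K}" for i
  proof -
    have "L k b \<le> ereal (\<phi>' (i + 1) b - \<phi>' i b)" unfolding L_def using that by (rule INF_lower)
    then have "L k b / 2 \<le> ereal (\<phi>' (i + 1) b - \<phi>' i b) / 2" by (rule ereal_divide_right_mono) simp
    from order_trans[OF d this] show ?thesis by simp
  qed
  show ?thesis
  proof (cases "j < k")
    case True
    then have "2 * d \<le> \<phi>' (k - 1 + 1) b - \<phi>' (k - 1) b" using k j by (intro *) auto
    moreover have "\<phi>' j b \<le> \<phi>' (k - 1) b" using True k j by (intro phase_derivative_mono) auto
    ultimately show ?thesis using k by auto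
  next
    case False
    then have "2 * d \<le> \<phi>' (k + 1) b - \<phi>' k b" using k j by (intro *) auto
    moreover have "\<phi>' (k + 1) b \<le> \<phi>' j b" using False k j by (intro phase_derivative_mono) auto
    ultimately show ?thesis by auto
  qed
qed

lemma G0_bound: "cmod (G 0 k a b) \<le> (LINT t|lborel. cmod (g t))"
proof -
  have "cmod (G 0 k a b) \<le> (LINT t|lborel. cmod (chirp k b (0 + a * \<sigma> b * t) * g t * cis (freq b * t)))"
    unfolding G_osc osc_def tmul_0 by (rule integral_norm_bound)
  then show ?thesis by (simp add: norm_mult chirp_def)
qed

text \<open>Bounds the pointwise error of replacing \<open>W g a b / a\<close> by the main term of
  component k: residual and foreign components, already divided by a. Its integral over the zone is
  the part common to \<open>Bd_tilde1\<close> and \<open>Bd_tilde2\<close>.\<close>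

definition interference :: "nat \<Rightarrow> real \<Rightarrow> real \<Rightarrow> real" where
  "interference k a b = \<sigma> b * real K * \<epsilon>1 * I 1 + pi / 3 * \<epsilon>3 * I 3 * \<sigma> b ^ 3 * (\<Sum>j=1..K. A j b) * a\<^sup>2 +
     (\<Sum>j\<in>{1..K} - {k}. A j b * (cmod (G 0 j a b) / a))"

lemma W_minus_main_term:
  assumes k: "k \<in> {1..K}" and a: "a > 0"
  shows "cmod (W g a b / a - comp k b * (G 0 k a b / a)) \<le> interference k a b"
proof -
  have "W g a b - comp k b * G 0 k a b = (\<Sum>j\<in>{1..K} - {k}. comp j b * G 0 j a b) + res g a b"
    unfolding W_g_eq using k sum.remove[of "{1..K}" k "\<lambda>j. comp j b * G 0 j a b"] by simp
  then have "cmod (W g a b - comp k b * G 0 k a b) \<le> (\<Sum>j\<in>{1..K} - {k}. A j b * cmod (G 0 j a b)) + a * \<sigma> b * Pi0 \<epsilon>1 \<epsilon>3 a b"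
  proof (simp only:, intro norm_triangle_mono res_bound a)
    have "cmod (\<Sum>j\<in>{1..K} - {k}. comp j b * G 0 j a b) \<le> (\<Sum>j\<in>{1..K} - {k}. cmod (comp j b * G 0 j a b))"
      by (rule norm_sum)
    also have "\<dots> = (\<Sum>j\<in>{1..K} - {k}. A j b * cmod (G 0 j a b))"
      by (intro sum.cong refl) (auto simp: norm_mult norm_comp)
    finally show "cmod (\<Sum>j\<in>{1..K} - {k}. comp j b * G 0 j a b) \<le> (\<Sum>j\<in>{1..K} - {k}. A j b * cmod (G 0 j a b))" .
  qed
  then have "cmod (W g a b - comp k b * G 0 k a b) / a \<le>
      ((\<Sum>j\<in>{1..K} - {k}. A j b * cmod (G 0 j a b)) + a * \<sigma> b * Pi0 \<epsilon>1 \<epsilon>3 a b) / a"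
    using a by (intro divide_right_mono) auto
  also have "\<dots> = interference k a b"
    using a by (simp add: interference_def Pi0_def add_divide_distrib sum_divide_distrib algebra_simps power2_eq_square power3_eq_cube)
  also have "cmod (W g a b - comp k b * G 0 k a b) / a = cmod (W g a b / a - comp k b * (G 0 k a b / a))"
    using a by (simp add: norm_divide flip: diff_divide_distrib)
  finally show ?thesis .
qed


lemma interference_nonneg: "a > 0 \<Longrightarrow> 0 \<le> interference k a b"
  unfolding interference_def
  using \<epsilon>_nonneg I_nonneg A_sum_nonneg \<sigma>_pos[of b] component(8)
  by (intro add_nonneg_nonneg mult_nonneg_nonneg sum_nonneg) (auto intro: less_imp_le)

lemma continuous_on_interference: "X \<subseteq> {0<..} \<Longrightarrow> continuous_on X (\<lambda>a. interference k a b)"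
  unfolding interference_def by (intro continuous_intros continuous_on_G) auto

lemma integral_interference:
  assumes k: "k \<in> {1..K}"
  shows "(LINT a:{l k b<..<u k b}|lborel. interference k a b) =
    \<sigma> b * real K * \<epsilon>1 * I 1 * (u k b - l k b) +
     pi / 9 * \<epsilon>3 * I 3 * (u k b ^ 3 - l k b ^ 3) * \<sigma> b ^ 3 * (\<Sum>j=1..K. A j b) +
     (\<Sum>j\<in>{1..K} - {k}. A j b * M j k b)"
proof -
  define p where "p = \<sigma> b * real K * \<epsilon>1 * I 1"
  define q where "q = pi / 3 * \<epsilon>3 * I 3 * \<sigma> b ^ 3 * (\<Sum>j=1..K. A j b)"
  note lu = l_u_pos[OF k, of b]
  have Gint: "set_integrable lborel {l k b<..<u k b} (\<lambda>a. A j b * (cmod (G 0 j a b) / a))" for j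
  proof (rule set_integrable_subset[OF continuous_set_integrable_Icc])
    show "continuous_on {l k b..u k b} (\<lambda>a. A j b * (cmod (G 0 j a b) / a))"
      using lu by (intro continuous_intros continuous_on_G) auto
  qed auto
  have pint: "set_integrable lborel {l k b<..<u k b} (\<lambda>a. p + q * a\<^sup>2)"
    by (rule set_integrable_subset[OF continuous_set_integrable_Icc[of "l k b" "u k b"]]) (auto intro!: continuous_intros)
  \<comment> \<open>The antiderivative of the square contributes \<open>1 / 3\<close>, which turns
    \<open>pi / 3\<close> into \<open>pi / 9\<close>.\<close>
  have "(LINT a:{l k b<..<u k b}|lborel. p + q * a\<^sup>2) = (p * u k b + q * (u k b ^ 3 / 3)) - (p * l k b + q * (l k b ^ 3 / 3))"
    using lu by (intro set_integral_Ioo_FTC) (auto intro!: derivative_eq_intros continuous_intros)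
  moreover have "(LINT a:{l k b<..<u k b}|lborel. (\<Sum>j\<in>{1..K} - {k}. A j b * (cmod (G 0 j a b) / a))) =
      (\<Sum>j\<in>{1..K} - {k}. A j b * M j k b)"
    unfolding set_integral_sum[OF Gint] set_integral_mult_right M_def set_integral_Icc_Ioo ..
  moreover have "(LINT a:{l k b<..<u k b}|lborel. interference k a b) =
      (LINT a:{l k b<..<u k b}|lborel. p + q * a\<^sup>2) + (LINT a:{l k b<..<u k b}|lborel. (\<Sum>j\<in>{1..K} - {k}. A j b * (cmod (G 0 j a b) / a)))"
    unfolding interference_def p_def[symmetric] q_def[symmetric]
    by (intro set_integral_add(2) pint) (rule set_integrable_sum[OF Gint])
  ultimately show ?thesis by (simp add: p_def q_def field_simps)
qed

text \<open>The zone splits into the set \<open>Q\<close> that survives the limit, the set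
  \<open>U'\<close> where \<open>Da ratio\<close> is too small, and the set \<open>N\<close> where W
  is too small. Completing \<open>Q\<close> to the whole zone allows comparison with
  \<open>c_psi\<close> at the cost of \<open>interference\<close>; what was added is subtracted
  again. The integral over \<open>N\<close> gives the logarithm, that over \<open>U'\<close> costs
  \<open>interference\<close> once more, as W is bounded there by its main term plus the
  error.\<close>

lemma reconstruction_error:
  assumes k: "k \<in> {1..K}" and \<delta>: "\<delta>1 > 0"
    and meas: "{a \<in> {l k b<..<u k b}. cmod (W g a b) > \<delta>1} \<in> sets borel"
      "{a \<in> {l k b<..<u k b}. cmod (W g a b) > \<delta>1 \<and> cmod (Da ratio a b) > \<delta>2} \<in> sets borel"
    and Q: "Q = {a \<in> {l k b<..<u k b}. cmod (W g a b) > \<delta>1 \<and> cmod (Da ratio a b) > \<delta>2}"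
  shows "cmod ((LINT a:Q|lborel. W g a b / a) - comp k b * c_psi k b) \<le> Bd_tilde \<epsilon>1 \<epsilon>3 \<delta>1 \<delta>2 k b"
proof -
  note lu = l_u_pos[OF k, of b]
  define Z where "Z = {l k b<..<u k b}"
  define N where "N = {a \<in> Z. cmod (W g a b) \<le> \<delta>1}"
  define U' where "U' = U \<delta>1 \<delta>2 k b"
  define r where "r a = interference k a b" for a
  define f where "f a = W g a b / a" for a
  define m where "m a = comp k b * (G 0 k a b / a)" for a
  have U': "U' = {a \<in> Z. cmod (W g a b) > \<delta>1} - Q"
    by (auto simp: U'_def U_def zone_def Z_def Q not_less)
  have N: "N = Z - {a \<in> Z. cmod (W g a b) > \<delta>1}" by (auto simp: N_def not_less)
  have Zpos: "a > 0" "l k b \<le> a" if "a \<in> Z" for a using that lu by (auto simp: Z_def)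
  have sets: "Z \<in> sets lborel" "Q \<in> sets lborel" "U' \<in> sets lborel" "N \<in> sets lborel"
    using meas unfolding U' N by (auto simp: Q Z_def)
  have sub: "Q \<subseteq> Z" "U' \<subseteq> Z" "N \<subseteq> Z" by (auto simp: Q Z_def U' N)
  have split: "Q \<union> (U' \<union> N) = Z" "Q \<inter> (U' \<union> N) = {}" "U' \<inter> N = {}"
    by (auto simp: U' N) (auto simp: Q Z_def)
  have fin: "emeasure lborel U' \<noteq> \<infinity>"
  proof -
    have "bounded U'" using sub by (intro bounded_subset[OF bounded_closed_interval[of "l k b" "u k b"]]) (auto simp: Z_def)
    then show ?thesis using emeasure_bounded_finite by (auto simp: less_top)
  qed
  have int: "set_integrable lborel Z F" if "continuous_on {0<..} F" for F :: "real \<Rightarrow> 'a::{banach, second_countable_topology}"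
    unfolding Z_def
    by (rule set_integrable_subset[OF continuous_set_integrable_Icc[of "l k b" "u k b", OF continuous_on_subset[OF that]]])
       (use lu in auto)
  have fint: "set_integrable lborel Z f"
    unfolding f_def by (intro int continuous_intros continuous_on_W schwartz_g) auto
  have mint: "set_integrable lborel Z m"
    unfolding m_def by (intro int continuous_intros continuous_on_G) auto
  have rint: "set_integrable lborel Z r"
    unfolding r_def by (intro int continuous_on_interference) auto
  have dint: "set_integrable lborel Z (\<lambda>a. \<delta>1 / a)" by (intro int continuous_intros) auto
  note onset = set_integrable_subset
  have "(LINT a:Z|lborel. f a) = (LINT a:Q|lborel. f a) + ((LINT a:U'|lborel. f a) + (LINT a:N|lborel. f a))"
  proof -
    have UN: "set_integrable lborel (U' \<union> N) f"
      by (rule onset[OF fint]) (use sets sub in auto)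
    have "(LINT a:Z|lborel. f a) = (LINT a:Q \<union> (U' \<union> N)|lborel. f a)" by (simp only: split(1))
    also have "\<dots> = (LINT a:Q|lborel. f a) + (LINT a:U' \<union> N|lborel. f a)"
      by (rule set_integral_Un[OF split(2) onset[OF fint sets(2) sub(1)] UN])
    also have "(LINT a:U' \<union> N|lborel. f a) = (LINT a:U'|lborel. f a) + (LINT a:N|lborel. f a)"
      by (rule set_integral_Un[OF split(3) onset[OF fint sets(3) sub(2)] onset[OF fint sets(4) sub(3)]])
    finally show ?thesis .
  qed
  moreover have "comp k b * c_psi k b = (LINT a:Z|lborel. m a)"
    unfolding m_def c_psi_def set_integral_Icc_Ioo Z_def by (rule set_integral_mult_right[symmetric])
  ultimately have eq: "(LINT a:Q|lborel. f a) - comp k b * c_psi k b =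
      (LINT a:Z|lborel. f a - m a) - ((LINT a:U'|lborel. f a) + (LINT a:N|lborel. f a))"
    using set_integral_diff(2)[OF fint mint] by simp
  have err: "cmod (f a - m a) \<le> r a" if "a \<in> Z" for a
    unfolding f_def m_def r_def by (rule W_minus_main_term[OF k Zpos(1)[OF that]])
  have 1: "cmod (LINT a:Z|lborel. f a - m a) \<le> (LINT a:Z|lborel. r a)"
  proof -
    have i: "set_integrable lborel Z (\<lambda>a. f a - m a)" by (intro set_integral_diff fint mint)
    have "cmod (LINT a:Z|lborel. f a - m a) \<le> (LINT a:Z|lborel. cmod (f a - m a))"
      by (rule set_integral_norm_bound[OF i])
    also have "\<dots> \<le> (LINT a:Z|lborel. r a)"
      by (intro set_integral_mono set_integrable_norm i rint err)
    finally show ?thesis .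
  qed
  \<comment> \<open>Bound of the main term: \<open>G 0 k\<close> is at most the L1 norm of g in
    modulus, and a is at least \<open>l k b\<close> on the zone.\<close>
  define H where "H = A k b / l k b * (LINT t|lborel. cmod (g t))"
  have fU: "cmod (f a) \<le> H + r a" if "a \<in> Z" for a
  proof -
    have "cmod (m a) = A k b * cmod (G 0 k a b) / a"
      using Zpos[OF that] by (simp add: m_def norm_mult norm_divide norm_comp[OF k])
    also have "\<dots> \<le> A k b * (LINT t|lborel. cmod (g t)) / l k b"
      using Zpos[OF that] lu component(8)[OF k, of b] G0_bound
      by (intro frac_le mult_left_mono mult_nonneg_nonneg) auto
    finally have "cmod (m a) \<le> H" by (simp add: H_def)
    moreover have "cmod (f a) \<le> cmod (m a) + cmod (f a - m a)"
      using norm_triangle_ineq[of "m a" "f a - m a"] by simp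
    ultimately show ?thesis using err[OF that] by linarith
  qed
  have 2: "cmod (LINT a:U'|lborel. f a) \<le> H * measure lebesgue U' + (LINT a:Z|lborel. r a)"
  proof -
    have Hi: "set_integrable lborel U' (\<lambda>a. H)"
      using fin sets unfolding set_integrable_def by (auto simp: less_top)
    have ri: "set_integrable lborel U' r" by (rule onset[OF rint sets(3) sub(2)])
    have fi: "set_integrable lborel U' f" by (rule onset[OF fint sets(3) sub(2)])
    have "cmod (LINT a:U'|lborel. f a) \<le> (LINT a:U'|lborel. cmod (f a))"
      by (rule set_integral_norm_bound[OF fi])
    also have "\<dots> \<le> (LINT a:U'|lborel. H + r a)"
      using sub by (intro set_integral_mono set_integrable_norm fi set_integral_add Hi ri fU) auto
    also have "\<dots> = (LINT a:U'|lborel. H) + (LINT a:U'|lborel. r a)"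
      by (rule set_integral_add(2)[OF Hi ri])
    \<comment> \<open>The Lebesgue measure in \<open>Bd_tilde2\<close> agrees with that of
      \<open>lborel\<close> because the set is Borel.\<close>
    also have "(LINT a:U'|lborel. H) = H * measure lebesgue U'"
      using set_integral_const[OF sets(3) fin, of H] sets(3) by (simp add: measure_completion mult.commute)
    also have "(LINT a:U'|lborel. r a) \<le> (LINT a:Z|lborel. r a)"
    proof -
      have "(LINT a:U'|lborel. r a) \<le> (LINT a:U'|lborel. r a) + (LINT a:Z - U'|lborel. r a)"
        using Zpos interference_nonneg sets
        by (auto simp: r_def set_lebesgue_integral_def intro!: integral_nonneg_AE AE_I2 split: split_indicator)
      also have "\<dots> = (LINT a:U' \<union> (Z - U')|lborel. r a)"
        by (rule set_integral_Un[OF _ onset[OF rint sets(3) sub(2)] onset[OF rint], symmetric])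
           (use sets in auto)
      also have "U' \<union> (Z - U') = Z" using sub by auto
      finally show ?thesis .
    qed
    finally show ?thesis by simp
  qed
  have 3: "cmod (LINT a:N|lborel. f a) \<le> \<delta>1 * ln (u k b / l k b)"
  proof -
    have fi: "set_integrable lborel N f" and di: "set_integrable lborel N (\<lambda>a. \<delta>1 / a)"
      by (rule onset[OF fint sets(4) sub(3)] onset[OF dint sets(4) sub(3)])+
    have "cmod (LINT a:N|lborel. f a) \<le> (LINT a:N|lborel. cmod (f a))"
      by (rule set_integral_norm_bound[OF fi])
    also have "\<dots> \<le> (LINT a:N|lborel. \<delta>1 / a)"
    proof (intro set_integral_mono set_integrable_norm fi di)
      fix a assume a: "a \<in> N"
      then have "a > 0" using sub Zpos by blast
      then show "cmod (f a) \<le> \<delta>1 / a"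
        using a by (auto simp: f_def N_def norm_divide intro: divide_right_mono)
    qed
    also have "\<dots> \<le> (LINT a:N|lborel. \<delta>1 / a) + (LINT a:Z - N|lborel. \<delta>1 / a)"
      using Zpos sets \<delta>
      by (auto simp: set_lebesgue_integral_def less_imp_le intro!: integral_nonneg_AE AE_I2 split: split_indicator)
    also have "\<dots> = (LINT a:N \<union> (Z - N)|lborel. \<delta>1 / a)"
      by (rule set_integral_Un[OF _ onset[OF dint sets(4) sub(3)] onset[OF dint], symmetric])
         (use sets in auto)
    also have "N \<union> (Z - N) = Z" using sub by auto
    also have "(LINT a:Z|lborel. \<delta>1 / a) = \<delta>1 * ln (u k b) - \<delta>1 * ln (l k b)"
      unfolding Z_def using lu
      by (intro set_integral_Ioo_FTC) (auto intro!: derivative_eq_intros continuous_intros)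
    also have "\<dots> = \<delta>1 * ln (u k b / l k b)" using lu by (simp add: ln_div right_diff_distrib)
    finally show ?thesis .
  qed
  have "cmod ((LINT a:Q|lborel. f a) - comp k b * c_psi k b) \<le>
      (LINT a:Z|lborel. r a) + ((H * measure lebesgue U' + (LINT a:Z|lborel. r a)) + \<delta>1 * ln (u k b / l k b))"
    unfolding eq
    by (intro order_trans[OF norm_triangle_ineq4] add_mono 1 order_trans[OF norm_triangle_ineq] 2 3)
  also have "\<dots> = Bd_tilde \<epsilon>1 \<epsilon>3 \<delta>1 \<delta>2 k b"
    unfolding Bd_tilde_def Bd_tilde1_def Bd_tilde2_def Z_def r_def integral_interference[OF k] H_def U'_def by simp
  finally show ?thesis unfolding f_def .
qed

end

section \<open>Measurability and the limit of small width\<close>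

lemma borel_measurable_indicator_continuous:
  fixes f :: "real \<Rightarrow> complex"
  shows "continuous_on {0<..} f \<Longrightarrow> (\<lambda>a. indicator {0<..} a *\<^sub>R f a) \<in> borel_measurable borel"
  by (rule borel_measurable_continuous_on_indicator) auto

context wsst_setting
begin

text \<open>Where W is nonzero, \<open>Da ratio\<close> equals
  \<open>ratio_num a b / (W g a b)\<^sup>2\<close>, a quotient of functions continuous on the
  positive scales. These are extended by zero to the line.\<close>

lemma scale_set_measurable:
  assumes X: "X \<in> sets borel" "X \<subseteq> {0<..}" and \<delta>: "\<delta>1 > 0"
  shows "{a \<in> X. cmod (W g a b) > \<delta>1} \<in> sets borel"
    and "{a \<in> X. cmod (W g a b) > \<delta>1 \<and> cmod (Da ratio a b) > \<delta>2} \<in> sets borel"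
proof -
  define w where "w a = indicator {0<..} a *\<^sub>R W g a b" for a
  define n where "n a = indicator {0<..} a *\<^sub>R ratio_num a b" for a
  have [measurable]: "w \<in> borel_measurable borel" "n \<in> borel_measurable borel"
    unfolding w_def[abs_def] n_def[abs_def]
    by (intro borel_measurable_indicator_continuous continuous_on_W continuous_on_ratio_num schwartz_g)+
  have "{a \<in> X. cmod (W g a b) > \<delta>1} = X \<inter> {a. cmod (w a) > \<delta>1}"
    using X(2) by (auto simp: w_def)
  then show "{a \<in> X. cmod (W g a b) > \<delta>1} \<in> sets borel"
    using X(1) by simp
  have "Da ratio a b = n a / (w a)\<^sup>2" if "a \<in> X" "cmod (W g a b) > \<delta>1" for a
  proof -
    have "a > 0" using X(2) that(1) by auto
    moreover have "W g a b \<noteq> 0" using that(2) \<delta> by auto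
    ultimately show ?thesis using Da_ratio[of a b] by (simp add: w_def n_def)
  qed
  then have "{a \<in> X. cmod (W g a b) > \<delta>1 \<and> cmod (Da ratio a b) > \<delta>2} =
      X \<inter> {a. cmod (w a) > \<delta>1 \<and> cmod (n a / (w a)\<^sup>2) > \<delta>2}"
    using X(2) by (auto simp: w_def)
  then show "{a \<in> X. cmod (W g a b) > \<delta>1 \<and> cmod (Da ratio a b) > \<delta>2} \<in> sets borel"
    using X(1) by simp
qed

text \<open>Measurability is not read off from the derivatives that define \<open>omega\<close>:
  where these make sense, \<open>omega\<close> is \<open>\<phi>' 1 b\<close> plus the real part of
  \<open>Res4 1 a b\<close>, a rational expression in continuous functions. The index 1 is an
  arbitrary choice, since the error identity holds for all indices.\<close>

lemma omega_measurable_extension: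
  obtains w where "w \<in> borel_measurable borel"
    "\<And>a. a > 0 \<Longrightarrow> W g a b \<noteq> 0 \<Longrightarrow> Da ratio a b \<noteq> 0 \<Longrightarrow> omega a b = w a"
proof -
  define e :: "(real \<Rightarrow> complex) \<Rightarrow> real \<Rightarrow> complex" where "e f a = indicator {0<..} a *\<^sub>R f a" for f a
  have e [measurable]: "e f \<in> borel_measurable borel" if "continuous_on {0<..} f" for f
    using borel_measurable_indicator_continuous[OF that] by (simp add: e_def[abs_def])
  note [measurable] = e[OF continuous_on_W[OF schwartz_g, of b]]
    e[OF continuous_on_W[OF schwartz_tmul[OF schwartz_g, of 1], of b]] e[OF continuous_on_Da_W[OF schwartz_g, of b]]
    e[OF continuous_on_Res1[of 1 b]] e[OF continuous_on_Res2[of 1 b]] e[OF continuous_on_ratio_num[of b]]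
  define w where "w a = Re (\<phi>' 1 b + 1 / (\<i> * 2 * pi * e (\<lambda>a. W g a b) a) *
     (e (\<lambda>a. Res1 1 a b) a - a * e (\<lambda>a. W (tmul 1 g) a b) a *
      ((e (\<lambda>a. W g a b) a * e (\<lambda>a. Res2 1 a b) a - e (\<lambda>a. Da (W g) a b) a * e (\<lambda>a. Res1 1 a b) a) / e (\<lambda>a. ratio_num a b) a)))" for a
  have "w \<in> borel_measurable borel"
    unfolding w_def[abs_def] by measurable
  moreover have "omega a b = w a" if "a > 0" "W g a b \<noteq> 0" "Da ratio a b \<noteq> 0" for a
    using that(1) unfolding omega_def omega_c_eq[OF that, of 1] w_def Res4_def Res3_def ratio_num_def[symmetric]
    by (simp add: e_def)
  ultimately show ?thesis using that by blast
qed

text \<open>An instance of \<open>approximate_identity_limit\<close> centred at the frequency of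
  component k. The integrand and \<open>omega\<close> are replaced by Borel functions v and w on the
  line that agree with them on the admissible scales.\<close>

lemma reconstruction_limit:
  assumes scales: "0 < a1 b" "a1 b \<le> l K b" "u 1 b \<le> a2 b"
    and h: "continuous_on UNIV h" "compact (closure {\<xi>. h \<xi> \<noteq> 0})" "(LINT \<xi>|lborel. h \<xi>) = 1"
    and \<delta>: "\<delta>1 > 0" "\<delta>2 > 0" "\<delta>3 > 0"
    and k: "k \<in> {1..K}"
    and thr: "\<delta>1 \<ge> threshold \<tau>0 \<epsilon>1 \<epsilon>3 b"
    and Bd: "\<And>j. j \<in> {1..K} \<Longrightarrow> Bd \<delta>1 \<delta>2 j b \<le> \<delta>3" and L: "ereal \<delta>3 \<le> L k b / 2"
  shows "((\<lambda>s. LINT \<xi>:{\<xi>. \<bar>\<xi> - \<phi>' k b\<bar> < \<delta>3}|lborel. T \<delta>1 \<delta>2 s \<xi> b) \<longlongrightarrow>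
    (LINT a:{a \<in> {l k b<..<u k b}. cmod (W g a b) > \<delta>1 \<and> cmod (Da ratio a b) > \<delta>2}|lborel. W g a b / a)) (at_right 0)"
proof -
  define S where "S = {a \<in> {a1 b..a2 b}. cmod (W g a b) > \<delta>1 \<and> cmod (Da ratio a b) > \<delta>2}"
  define Q where "Q = {a \<in> {l k b<..<u k b}. cmod (W g a b) > \<delta>1 \<and> cmod (Da ratio a b) > \<delta>2}"
  define v where "v a = indicator {0<..} a *\<^sub>R (W g a b / a)" for a
  obtain w where w: "w \<in> borel_measurable borel"
    "\<And>a. a > 0 \<Longrightarrow> W g a b \<noteq> 0 \<Longrightarrow> Da ratio a b \<noteq> 0 \<Longrightarrow> omega a b = w a"
    using omega_measurable_extension by blast
  have lu: "0 < l k b" "l k b < u k b" using l_u_pos[OF k] by auto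
  have "l K b \<le> l k b" using zone_bounds_antimono(1)[OF k, of K] k by simp
  moreover have "u k b \<le> u 1 b" using zone_bounds_antimono(2)[of 1 k] k by simp
  ultimately have sub: "{l k b<..<u k b} \<subseteq> {a1 b..a2 b}" using scales by auto
  have S_props: "a > 0" "W g a b \<noteq> 0" "Da ratio a b \<noteq> 0" "omega a b = w a" if "a \<in> S" for a
  proof -
    show "a > 0" "W g a b \<noteq> 0" "Da ratio a b \<noteq> 0" using that scales(1) \<delta> by (auto simp: S_def)
    then show "omega a b = w a" by (rule w(2))
  qed
  have Sm: "S \<in> sets borel" unfolding S_def by (rule scale_set_measurable) (use scales \<delta> in auto)
  have Qm: "Q \<in> sets borel" unfolding Q_def by (rule scale_set_measurable) (use lu \<delta> in auto)
  have QS: "Q \<subseteq> S" using sub by (auto simp: Q_def S_def)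
  have cv: "continuous_on {0<..} (\<lambda>a. W g a b / a)"
    by (intro continuous_intros continuous_on_W schwartz_g) auto
  have vm: "v \<in> borel_measurable borel"
    unfolding v_def[abs_def] by (rule borel_measurable_indicator_continuous[OF cv])
  have "compact ((\<lambda>a. W g a b / a) ` {a1 b..a2 b})"
    by (intro compact_continuous_image continuous_on_subset[OF cv]) (use scales in auto)
  then obtain C where C: "\<And>a. a \<in> {a1 b..a2 b} \<Longrightarrow> cmod (W g a b / a) \<le> C"
    using compact_imp_bounded by (fastforce simp: bounded_iff)
  have vb: "cmod (v a) \<le> C" if "a \<in> S" for a
    using C[of a] that S_props(1)[OF that] by (simp add: v_def S_def)
  \<comment> \<open>Positivity of \<open>\<delta>3\<close> makes the bound strict also in the
    degenerate alternative of \<open>omega_error\<close>.\<close>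
  have near: "\<bar>w a - \<phi>' j b\<bar> < \<delta>3" if "a \<in> S" "(a, b) \<in> zone j" "j \<in> {1..K}" for a j
  proof -
    have "\<bar>omega a b - \<phi>' j b\<bar> < Bd \<delta>1 \<delta>2 j b \<or> \<bar>omega a b - \<phi>' j b\<bar> = 0 \<and> Bd \<delta>1 \<delta>2 j b = 0"
      using that(1) by (intro omega_error(2) that \<delta>) (auto simp: S_def)
    then show ?thesis using Bd[OF that(3)] S_props(4)[OF that(1)] \<delta>(3) by auto
  qed
  have inside: "\<bar>w a - \<phi>' k b\<bar> < \<delta>3" if "a \<in> Q" for a
    by (rule near) (use that QS k in \<open>auto simp: Q_def zone_def\<close>)
  \<comment> \<open>By the covering property such a scale lies in another zone j. Its frequency is
    less than \<open>\<delta>3\<close> away from \<open>\<phi>' j b\<close>, which is at least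
    \<open>2 * \<delta>3\<close> away from \<open>\<phi>' k b\<close>.\<close>
  have outside: "\<bar>w a - \<phi>' k b\<bar> > \<delta>3" if a: "a \<in> S - Q" for a
  proof -
    obtain j where j: "j \<in> {1..K}" "(a, b) \<in> zone j"
      using zones_cover[OF thr S_props(1), of a] a by (auto simp: S_def)
    have "(a, b) \<notin> zone k" using a by (auto simp: Q_def S_def zone_def)
    then have "j \<noteq> k" using j by auto
    then have "2 * \<delta>3 \<le> \<bar>\<phi>' j b - \<phi>' k b\<bar>" by (rule L_half_le_gap[OF k j(1) _ L])
    moreover have "\<bar>w a - \<phi>' j b\<bar> < \<delta>3" using a j by (intro near) auto
    ultimately show ?thesis by linarith
  qed
  have "emeasure lborel S < \<infinity>"
    by (intro emeasure_bounded_finite bounded_subset[OF bounded_closed_interval[of "a1 b" "a2 b"]]) (auto simp: S_def)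
  from approximate_identity_limit[OF integrable_compact_support[OF h(1,2)] h(3) Sm this vm vb w(1) Qm QS inside outside]
  have lim: "((\<lambda>s. LINT \<xi>:{\<xi>. \<bar>\<xi> - \<phi>' k b\<bar> < \<delta>3}|lborel. LINT a:S|lborel. v a * (complex_of_real (1 / s) * h ((\<xi> - w a) / s)))
     \<longlongrightarrow> (LINT a:Q|lborel. v a)) (at_right 0)" .
  have T_eq: "(LINT a:S|lborel. v a * (complex_of_real (1 / s) * h ((\<xi> - w a) / s))) = T \<delta>1 \<delta>2 s \<xi> b" for s \<xi>
    unfolding T_def S_def[symmetric]
    by (rule set_lebesgue_integral_cong) (use Sm S_props in \<open>auto simp: v_def\<close>)
  have v_eq: "(LINT a:Q|lborel. v a) = (LINT a:Q|lborel. W g a b / a)"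
    by (rule set_lebesgue_integral_cong) (use Qm QS S_props(1) in \<open>auto simp: v_def\<close>)
  show ?thesis using lim unfolding T_eq v_eq unfolding Q_def .
qed

lemma reconstruction:
  assumes scales: "0 < a1 b" "a1 b \<le> l K b" "u 1 b \<le> a2 b"
    and h: "continuous_on UNIV h" "compact (closure {\<xi>. h \<xi> \<noteq> 0})" "(LINT \<xi>|lborel. h \<xi>) = 1"
    and \<delta>: "\<delta>1 > 0" "\<delta>2 > 0" "\<delta>3 > 0"
    and k: "k \<in> {1..K}"
    and thr: "\<delta>1 \<ge> threshold \<tau>0 \<epsilon>1 \<epsilon>3 b"
    and Bd: "\<And>j. j \<in> {1..K} \<Longrightarrow> Bd \<delta>1 \<delta>2 j b \<le> \<delta>3" and L: "ereal \<delta>3 \<le> L k b / 2"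
    and c: "c_psi k b \<noteq> 0"
  shows "\<exists>lim. ((\<lambda>s. 1 / c_psi k b * (LINT \<xi>:{\<xi>. \<bar>\<xi> - \<phi>' k b\<bar> < \<delta>3}|lborel. T \<delta>1 \<delta>2 s \<xi> b)) \<longlongrightarrow> lim) (at_right 0) \<and>
    cmod (lim - comp k b) \<le> 1 / cmod (c_psi k b) * Bd_tilde \<epsilon>1 \<epsilon>3 \<delta>1 \<delta>2 k b"
proof (intro exI conjI)
  define Q where "Q = {a \<in> {l k b<..<u k b}. cmod (W g a b) > \<delta>1 \<and> cmod (Da ratio a b) > \<delta>2}"
  define m where "m = (LINT a:Q|lborel. W g a b / a)"
  have lu: "0 < l k b" using l_u_pos[OF k] by auto
  show "((\<lambda>s. 1 / c_psi k b * (LINT \<xi>:{\<xi>. \<bar>\<xi> - \<phi>' k b\<bar> < \<delta>3}|lborel. T \<delta>1 \<delta>2 s \<xi> b)) \<longlongrightarrow> 1 / c_psi k b * m) (at_right 0)"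
    unfolding m_def Q_def by (rule tendsto_mult_left[OF reconstruction_limit[OF scales h \<delta> k thr Bd L]])
  have "1 / c_psi k b * m - comp k b = 1 / c_psi k b * (m - comp k b * c_psi k b)"
    using c by (simp add: field_simps)
  then have "cmod (1 / c_psi k b * m - comp k b) = 1 / cmod (c_psi k b) * cmod (m - comp k b * c_psi k b)"
    by (simp add: norm_mult norm_divide)
  also have "\<dots> \<le> 1 / cmod (c_psi k b) * Bd_tilde \<epsilon>1 \<epsilon>3 \<delta>1 \<delta>2 k b"
    unfolding m_def
    by (intro mult_left_mono reconstruction_error[OF k \<delta>(1) _ _ Q_def] scale_set_measurable)
       (use lu \<delta> in auto)
  finally show "cmod (1 / c_psi k b * m - comp k b) \<le> 1 / cmod (c_psi k b) * Bd_tilde \<epsilon>1 \<epsilon>3 \<delta>1 \<delta>2 k b" .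
qed

end

theorem theorem2:
  fixes \<mu> \<alpha> \<tau>0 \<epsilon>1 \<epsilon>3 \<delta>1 \<delta>2 b :: real
    and g :: "real \<Rightarrow> complex" and \<sigma> :: "real \<Rightarrow> real"
    and K :: nat and A \<phi> l u :: "nat \<Rightarrow> real \<Rightarrow> real"
    and a1 a2 :: "real \<Rightarrow> real" and h :: "real \<Rightarrow> complex"
  assumes mu: "\<mu> > 0" and alpha: "\<alpha> \<ge> 0" and tau: "0 < \<tau>0" "\<tau>0 < 1"
    and schwartz: "schwartz g"
    and window: "(\<forall>\<xi>. \<xi> \<notin> {-\<alpha>..\<alpha>} \<longrightarrow> fourier g \<xi> = 0) \<or>
      ((\<forall>\<xi>. cmod (fourier g (-\<xi>)) = cmod (fourier g \<xi>)) \<and>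
       antimono_on {0..} (\<lambda>\<xi>. cmod (fourier g \<xi>)) \<and>
       cmod (fourier g \<alpha>) = \<tau>0)"
    and sigma: "\<forall>b. \<sigma> differentiable (at b)" "\<forall>b. \<sigma> b > 0" "\<forall>b. \<sigma> b > \<alpha> / \<mu>"
    and eps: "\<epsilon>1 > 0" "\<epsilon>3 > 0"
    and signal: "wsst.signal_class \<mu> g \<sigma> K A \<phi> l u \<tau>0 \<epsilon>1 \<epsilon>3"
    and scales: "\<forall>b. 0 < a1 b \<and> a1 b \<le> l K b" "\<forall>b. u 1 b \<le> a2 b"
    and h: "continuous_on UNIV h" "compact (closure {\<xi>. h \<xi> \<noteq> 0})"
      "(LINT \<xi>|lborel. h \<xi>) = 1"
    and delta: "\<delta>1 > 0" "\<delta>2 > 0"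
  shows
    "(\<delta>1 \<ge> wsst.threshold g \<sigma> K A a2 \<tau>0 \<epsilon>1 \<epsilon>3 b \<longrightarrow>
       (\<forall>a\<in>{a1 b..a2 b}. cmod (wsst.W \<mu> \<sigma> K A \<phi> g a b) > \<delta>1 \<longrightarrow>
          (\<exists>k\<in>{1..K}. (a, b) \<in> wsst.zone l u k)))
     \<and>
     (\<forall>k\<in>{1..K}. \<forall>a\<in>{a1 b..a2 b}.
        cmod (wsst.W \<mu> \<sigma> K A \<phi> g a b) > \<delta>1 \<longrightarrow>
        cmod (Da (wsst.ratio \<mu> g \<sigma> K A \<phi>) a b) > \<delta>2 \<longrightarrow>
        (a, b) \<in> wsst.zone l u k \<longrightarrow>
          wsst.omega_c \<mu> g \<sigma> K A \<phi> a b - deriv (\<phi> k) b = wsst.Res4 \<mu> g \<sigma> K A \<phi> k a b \<and>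
          (let err = \<bar>wsst.omega \<mu> g \<sigma> K A \<phi> a b - deriv (\<phi> k) b\<bar>;
               Bd = wsst.Bd \<mu> g \<sigma> K A \<phi> l u \<delta>1 \<delta>2 k b
           in err < Bd \<or> (err = 0 \<and> Bd = 0)))
     \<and>
     (\<forall>k\<in>{1..K}. \<forall>\<delta>3>0.
        let maxBd = Max ((\<lambda>j. wsst.Bd \<mu> g \<sigma> K A \<phi> l u \<delta>1 \<delta>2 j b) ` {1..K});
            c = wsst.c_psi \<mu> g \<sigma> \<phi> l u k b
        in
        \<delta>1 \<ge> wsst.threshold g \<sigma> K A a2 \<tau>0 \<epsilon>1 \<epsilon>3 b \<longrightarrow>
        ereal maxBd \<le> wsst.L K \<phi> k b / 2 \<longrightarrow>
        maxBd \<le> \<delta>3 \<longrightarrow> ereal \<delta>3 \<le> wsst.L K \<phi> k b / 2 \<longrightarrow>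
        c \<noteq> 0 \<longrightarrow>
          (\<exists>lim.
             ((\<lambda>s. 1 / c * (LINT \<xi>:{\<xi>. \<bar>\<xi> - deriv (\<phi> k) b\<bar> < \<delta>3}|lborel.
                 wsst.T \<mu> g \<sigma> K A \<phi> a1 a2 h \<delta>1 \<delta>2 s \<xi> b)) \<longlongrightarrow> lim) (at_right 0) \<and>
             cmod (lim - wsst.comp A \<phi> k b)
               \<le> 1 / cmod c * wsst.Bd_tilde \<mu> g \<sigma> K A \<phi> l u \<epsilon>1 \<epsilon>3 \<delta>1 \<delta>2 k b))"
proof -
  interpret wsst_setting \<mu> g \<sigma> K A \<phi> l u a1 a2 h \<tau>0 \<epsilon>1 \<epsilon>3
    using schwartz sigma signal by unfold_locales auto
  have sc: "0 < a1 b" "a1 b \<le> l K b" "u 1 b \<le> a2 b" using scales by auto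
  have recover: "\<exists>lim. ((\<lambda>s. 1 / c_psi k b * (LINT \<xi>:{\<xi>. \<bar>\<xi> - \<phi>' k b\<bar> < \<delta>3}|lborel. T \<delta>1 \<delta>2 s \<xi> b)) \<longlongrightarrow> lim) (at_right 0) \<and>
      cmod (lim - comp k b) \<le> 1 / cmod (c_psi k b) * Bd_tilde \<epsilon>1 \<epsilon>3 \<delta>1 \<delta>2 k b"
    if k: "k \<in> {1..K}" and "\<delta>3 > 0" and thr: "\<delta>1 \<ge> threshold \<tau>0 \<epsilon>1 \<epsilon>3 b"
      and max: "Max ((\<lambda>j. Bd \<delta>1 \<delta>2 j b) ` {1..K}) \<le> \<delta>3" and L: "ereal \<delta>3 \<le> L k b / 2" and c: "c_psi k b \<noteq> 0" for k \<delta>3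
  proof -
    have "Bd \<delta>1 \<delta>2 j b \<le> \<delta>3" if "j \<in> {1..K}" for j
      using max that by (intro order_trans[OF Max_ge max]) auto
    then show ?thesis by (intro reconstruction sc h delta that)
  qed
  show ?thesis
    unfolding Let_def
    by (intro conjI impI ballI allI zones_cover omega_error[OF _ _ delta] recover)
       (use sc in auto)
qed

end
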